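(* Let $m\geq 1$ be an integer, $\varepsilon\in\{-1,+1\}$, $W=\mathbb{Z}_2\times D_{2m}$ acting on $\mathbb{R}^3$ with root system $R$, and $\kappa:R\to\mathbb{C}$ a $W$-invariant function. With $O_{123}$, $O_0,O_+,O_-$ and $T_0,T_+,T_-$ in $\mathcal{A}_\kappa\otimes Cl^{\varepsilon}(3)$ as defined in the context, put $$L_+=\tfrac12\{O_0,O_+\},\qquad L_-=\tfrac12\{O_0,O_-\}.$$ Then $L_+$ and $L_-$ are ladder operators with respect to $O_0$, in the sense that $$[O_0,L_+]=L_+,\qquad [O_0,L_-]=-L_-,$$ and their products admit the factorisations $$L_+L_-=-\bigl((O_0-1/2)^2+\varepsilon(\varepsilon O_{123}+T_0)^2\bigr)\bigl((O_0-1/2)^2-\varepsilon T_+T_-\bigr),$$ $$L_-L_+=-\bigl((O_0+1/2)^2+\varepsilon(\varepsilon O_{123}-T_0)^2\bigr)\bigl((O_0+1/2)^2-\varepsilon T_-T_+\bigr).$$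
   Context: Notation: $[a,b]=ab-ba$, $\{a,b\}=ab+ba$, $i=\sqrt{-1}$ (when not an index). $\mathbb{R}^3$ has canonical basis $\xi_1,\xi_2,\xi_3$ and canonical bilinear form $\langle-,-\rangle$. Put $\alpha_0=(0,0,1)$ and $\alpha_j=(\sin(j\pi/m),-\cos(j\pi/m),0)$ for $1\le j\le 2m$. The root system is $R=\{\alpha_0,-\alpha_0\}\cup\{\alpha_j: 1\le j\le 2m\}$, with positive roots $R_+=\{\alpha_0,\alpha_1,\dots,\alpha_m\}$. For $\alpha\in R$, $\sigma_\alpha(x)=x-2\frac{\langle x,\alpha\rangle}{\langle\alpha,\alpha\rangle}\alpha$, and $W\cong\mathbb{Z}_2\times D_{2m}$ ($D_{2m}$ the dihedral group of order $2m$) is the group generated by these reflections, acting on functions on $\mathbb{R}^3$ by $(wf)(x)=f(w^{-1}x)$. The function $\kappa:R\to\mathbb{C}$ is constant on $W$-orbits. Dunkl operators, acting on polynomials $\mathbb{C}[x_1,x_2,x_3]$: $$\mathcal{D}_jf(x)=\partial_{x_j}f(x)+\sum_{\alpha\in R_+}\kappa(\alpha)\frac{f(x)-f(\sigma_\alpha(x))}{\langle x,\alpha\rangle}\langle\alpha,\xi_j\rangle .$$ $\mathcal{A}_\kappa$ is the associative algebra of operators on $\mathbb{C}[x_1,x_2,x_3]$ generated by the $\mathcal{D}_j$, the multiplication operators $x_j$, and $\mathbb{C}[W]$. $Cl^{\varepsilon}(3)$ is the (complex) Clifford algebra generated by $e_1,e_2,e_3$ with $\{e_j,e_k\}=2\varepsilon\delta_{jk}$.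 All elements below live in $\mathcal{A}_\kappa\otimes Cl^{\varepsilon}(3)$ (ordinary tensor product; elements of the two factors commute; $\otimes$ is often omitted). For $\alpha\in R$ let $\widetilde{\sigma}_\alpha=\sigma_\alpha\otimes\sum_{j=1}^3\langle\alpha,\xi_j\rangle e_j$. One-index symmetries: $$O_j=\varepsilon\sum_{k=0}^m\kappa(\alpha_k)\langle\alpha_k,\xi_j\rangle\widetilde{\sigma}_{\alpha_k}=\frac{\varepsilon}{2}\Bigl(\sum_{k=1}^3e_k[\mathcal{D}_k,x_j]-e_j\Bigr).$$ With $L_{ij}=x_i\mathcal{D}_j-x_j\mathcal{D}_i$, two-index symmetries: $O_{ij}=L_{ij}+\frac{\varepsilon}{2}e_ie_j+O_ie_j-O_je_i$ (equivalently $L_{ij}+\frac{\varepsilon}{2}e_ie_j+e_iO_j-e_jO_i$). Three-index symmetry: $$O_{123}=-\frac{\varepsilon}{2}e_1e_2e_3-O_1e_2e_3-O_2e_3e_1-O_3e_1e_2+O_{12}e_3+O_{31}e_2+O_{23}e_1 .$$ Define $$O_0=-iO_{12},\quad O_+=iO_{31}+O_{23},\quad O_-=iO_{31}-O_{23},$$ $$T_0=iO_3,\quad T_+=O_1+iO_2,\quad T_-=O_1-iO_2.$$ Scalars in the formulas are understood as multiples of the identity. *)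

theory Defs
  imports "HOL-Analysis.Analysis"
begin

subsection \<open>Complex vector spaces and algebras\<close>

class scaleC =
  fixes scaleC :: "complex \<Rightarrow> 'a \<Rightarrow> 'a" (infixr "*\<^sub>C" 75)

class complex_space = scaleC + ab_group_add +
  assumes scaleC_add_right: "c *\<^sub>C (x + y) = c *\<^sub>C x + c *\<^sub>C y"
    and scaleC_add_left: "(c + d) *\<^sub>C x = c *\<^sub>C x + d *\<^sub>C x"
    and scaleC_scaleC [simp]: "c *\<^sub>C d *\<^sub>C x = (c * d) *\<^sub>C x"
    and scaleC_one [simp]: "1 *\<^sub>C x = x"

class complex_alg = complex_space + ring_1 +
  assumes mult_scaleC_left [simp]: "(c *\<^sub>C x) * y = c *\<^sub>C (x * y)"
    and mult_scaleC_right [simp]: "x * (c *\<^sub>C y) = c *\<^sub>C (x * y)"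

lemma scaleC_zero_right [simp]: "c *\<^sub>C (0::'a::complex_space) = 0"
  using scaleC_add_right[of c "0::'a" 0] by simp

lemma scaleC_zero_left [simp]: "0 *\<^sub>C (x::'a::complex_space) = 0"
  using scaleC_add_left[of 0 0 x] by simp

lemma scaleC_minus_right [simp]: "c *\<^sub>C (- x) = - (c *\<^sub>C (x::'a::complex_space))"
  using scaleC_add_right[of c "x" "- x"] by (simp add: eq_neg_iff_add_eq_0 add.commute)

lemma scaleC_sum_right: "c *\<^sub>C (\<Sum>i\<in>I. f i) = (\<Sum>i\<in>I. c *\<^sub>C (f i::'a::complex_space))"
  by (induction I rule: infinite_finite_induct) (auto simp: scaleC_add_right)

lemma scaleC_minus_one [simp]: "(- 1) *\<^sub>C (x::'a::complex_space) = - x"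
  using scaleC_add_left[of 1 "- 1" x] by (simp add: eq_neg_iff_add_eq_0 add.commute)

instantiation complex :: complex_alg
begin
definition scaleC_complex :: "complex \<Rightarrow> complex \<Rightarrow> complex"
  where scaleC_complex_def [simp]: "scaleC_complex c x = c * x"
instance by standard (auto simp: algebra_simps)
end


subsection \<open>The polynomial ring in three variables and its linear operators\<close>

text \<open>A polynomial with complex coefficients is identified with the function it induces on
  real 3-space, on which the reflection group acts.\<close>

lemma polynomial_function_complex_iff:
  "polynomial_function (f :: real^3 \<Rightarrow> complex) \<longleftrightarrow>
     real_polynomial_function (\<lambda>x. Re (f x)) \<and> real_polynomial_function (\<lambda>x. Im (f x))"
proof -
  have "polynomial_function f" if "real_polynomial_function (\<lambda>x. Re (f x))"
      and "real_polynomial_function (\<lambda>x. Im (f x))"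
  proof -
    have "polynomial_function (\<lambda>x. Re (f x) *\<^sub>R (1::complex) + Im (f x) *\<^sub>R \<i>)"
      using that by (intro polynomial_function_add polynomial_function_mult polynomial_function_const)
        (auto simp: real_polynomial_function_eq)
    also have "(\<lambda>x. Re (f x) *\<^sub>R (1::complex) + Im (f x) *\<^sub>R \<i>) = f"
      by (auto simp: complex_eq_iff)
    finally show ?thesis .
  qed
  moreover have "real_polynomial_function (\<lambda>x. Re (f x))" "real_polynomial_function (\<lambda>x. Im (f x))"
    if "polynomial_function f"
    using that bounded_linear_Re bounded_linear_Im by (auto simp: polynomial_function_def o_def)
  ultimately show ?thesis by blast
qed

lemma polynomial_function_times:
  fixes f g :: "real^3 \<Rightarrow> complex"
  assumes "polynomial_function f" "polynomial_function g"
  shows "polynomial_function (\<lambda>x. f x * g x)"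
  using assms unfolding polynomial_function_complex_iff
  by (auto intro!: real_polynomial_function_diff real_polynomial_function.intros(3,4))

lemma polynomial_function_of_real:
  "real_polynomial_function f \<Longrightarrow> polynomial_function (\<lambda>x::real^3. complex_of_real (f x))"
  unfolding polynomial_function_complex_iff by auto

typedef cpoly = "{f :: real^3 \<Rightarrow> complex. polynomial_function f}"
  morphisms cpoly_eval Abs_cpoly
  by auto

setup_lifting type_definition_cpoly

instantiation cpoly :: complex_space
begin
lift_definition zero_cpoly :: cpoly is "\<lambda>_. 0" by auto
lift_definition plus_cpoly :: "cpoly \<Rightarrow> cpoly \<Rightarrow> cpoly" is "\<lambda>f g x. f x + g x" by auto
lift_definition minus_cpoly :: "cpoly \<Rightarrow> cpoly \<Rightarrow> cpoly" is "\<lambda>f g x. f x - g x" by auto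
lift_definition uminus_cpoly :: "cpoly \<Rightarrow> cpoly" is "\<lambda>f x. - f x" by auto
lift_definition scaleC_cpoly :: "complex \<Rightarrow> cpoly \<Rightarrow> cpoly" is "\<lambda>c f x. c * f x"
  by (intro polynomial_function_times polynomial_function_const)
instance by standard (transfer; auto simp: algebra_simps)+
end

typedef poly_op = "{T :: cpoly \<Rightarrow> cpoly.
    (\<forall>f g. T (f + g) = T f + T g) \<and> (\<forall>c f. T (c *\<^sub>C f) = c *\<^sub>C T f)}"
  morphisms op_apply Abs_poly_op
  by (rule exI[of _ "\<lambda>f. f"]) auto

setup_lifting type_definition_poly_op

lemma op_apply_zero: "op_apply T 0 = 0"
  using op_apply[of T] by (simp, metis scaleC_zero_left)

instantiation poly_op :: complex_alg
begin
lift_definition zero_poly_op :: poly_op is "\<lambda>_. 0" by auto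
lift_definition one_poly_op :: poly_op is "\<lambda>f. f" by auto
lift_definition plus_poly_op :: "poly_op \<Rightarrow> poly_op \<Rightarrow> poly_op" is "\<lambda>S T f. S f + T f"
  by (auto simp: scaleC_add_right)
lift_definition uminus_poly_op :: "poly_op \<Rightarrow> poly_op" is "\<lambda>T f. - T f" by auto
lift_definition minus_poly_op :: "poly_op \<Rightarrow> poly_op \<Rightarrow> poly_op" is "\<lambda>S T f. S f - T f"
  by (auto simp: scaleC_add_right simp flip: diff_conv_add_uminus)
    (metis (no_types, lifting) diff_conv_add_uminus scaleC_add_right scaleC_minus_right)
lift_definition times_poly_op :: "poly_op \<Rightarrow> poly_op \<Rightarrow> poly_op" is "\<lambda>S T f. S (T f)" by auto
lift_definition scaleC_poly_op :: "complex \<Rightarrow> poly_op \<Rightarrow> poly_op" is "\<lambda>c T f. c *\<^sub>C T f"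
  by (auto simp: scaleC_add_right mult.commute)
instance
proof
  have "\<exists>f. (\<lambda>_::real^3. 0::complex) \<noteq> f \<and> polynomial_function f"
    by (rule exI[of _ "\<lambda>_. 1"]) (auto simp: fun_eq_iff)
  then have "\<exists>f::cpoly. 0 \<noteq> f" by transfer auto
  then show "(0::poly_op) \<noteq> 1" by transfer (auto simp: fun_eq_iff)
qed (transfer; auto simp: algebra_simps scaleC_add_right scaleC_add_left)+
end


subsection \<open>The root system and its reflection group\<close>

definition root_vec :: "nat \<Rightarrow> nat \<Rightarrow> real^3" where
  "root_vec m j = (if j = 0 then vector [0, 0, 1]
     else vector [sin (real j * pi / real m), - cos (real j * pi / real m), 0])"

definition root_sys :: "nat \<Rightarrow> (real^3) set" where
  "root_sys m = {root_vec m 0, - root_vec m 0} \<union> root_vec m ` {1..2*m}"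

definition pos_roots :: "nat \<Rightarrow> (real^3) set" where
  "pos_roots m = root_vec m ` {0..m}"

definition reflection :: "real^3 \<Rightarrow> real^3 \<Rightarrow> real^3" where
  "reflection \<alpha> x = x - (2 * (x \<bullet> \<alpha>) / (\<alpha> \<bullet> \<alpha>)) *\<^sub>R \<alpha>"

text \<open>Reflections are involutions, so closing under products already gives a group.\<close>

inductive_set refl_group :: "nat \<Rightarrow> (real^3 \<Rightarrow> real^3) set" for m where
  refl_group_id: "id \<in> refl_group m"
| refl_group_step: "w \<in> refl_group m \<Longrightarrow> \<alpha> \<in> root_sys m \<Longrightarrow> reflection \<alpha> \<circ> w \<in> refl_group m"

definition refl_invariant :: "nat \<Rightarrow> (real^3 \<Rightarrow> complex) \<Rightarrow> bool" where
  "refl_invariant m \<kappa> \<longleftrightarrow> (\<forall>w\<in>refl_group m. \<forall>\<alpha>\<in>root_sys m. \<kappa> (w \<alpha>) = \<kappa> \<alpha>)"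

lemma root_vec_nonzero: "root_vec m j \<noteq> 0"
proof
  assume *: "root_vec m j = 0"
  show False
  proof (cases "j = 0")
    case True
    with arg_cong[OF *, of "\<lambda>v. v $ 3"] show ?thesis by (simp add: root_vec_def)
  next
    case False
    with arg_cong[OF *, of "\<lambda>v. v $ 1"] arg_cong[OF *, of "\<lambda>v. v $ 2"]
    have "sin (real j * pi / real m) = 0" "cos (real j * pi / real m) = 0"
      by (simp_all add: root_vec_def)
    with sin_cos_squared_add[of "real j * pi / real m"] show ?thesis by simp
  qed
qed

lemma reflection_reflection [simp]: "reflection \<alpha> (reflection \<alpha> x) = x"
  by (cases "\<alpha> = 0") (simp_all add: reflection_def inner_diff_left algebra_simps)

lemma inv_reflection: "inv (reflection \<alpha>) = reflection \<alpha>"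
  by (rule inv_equality) auto

lemma bounded_linear_reflection: "bounded_linear (reflection \<alpha>)"
proof -
  have "linear (reflection \<alpha>)"
    by (rule linearI) (simp_all add: reflection_def inner_add_left add_divide_distrib algebra_simps)
  then show ?thesis by (simp add: linear_linear)
qed


subsection \<open>Dunkl operators\<close>

text \<open>\<open>refl_quot \<alpha> f\<close> is the quotient $(f(x) - f(\sigma_\alpha x)) / \langle x, \alpha\rangle$
  as a polynomial, i.e. with its values on the hyperplane filled in.\<close>

definition refl_quot :: "real^3 \<Rightarrow> (real^3 \<Rightarrow> complex) \<Rightarrow> real^3 \<Rightarrow> complex" where
  "refl_quot \<alpha> f = (THE g. polynomial_function g \<and>
     (\<forall>x. x \<bullet> \<alpha> \<noteq> 0 \<longrightarrow> g x = (f x - f (reflection \<alpha> x)) / complex_of_real (x \<bullet> \<alpha>)))"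

lemma polynomial_function_eq_off_hyperplane:
  fixes g h :: "real^3 \<Rightarrow> complex"
  assumes "polynomial_function g" "polynomial_function h" "\<alpha> \<noteq> 0"
    and eq: "\<And>x. x \<bullet> \<alpha> \<noteq> 0 \<Longrightarrow> g x = h x"
  shows "g = h"
proof
  fix x
  define d where "d = (\<lambda>t. g (x + t *\<^sub>R \<alpha>) - h (x + t *\<^sub>R \<alpha>))"
  have cont: "continuous (at y) g" "continuous (at y) h" for y
    using assms continuous_polymonial_function by blast+
  have "isCont d 0"
    unfolding d_def
    by (intro continuous_diff continuous_within_compose3[OF cont(1)]
        continuous_within_compose3[OF cont(2)] continuous_intros)
  then have 1: "(d \<longlongrightarrow> d 0) (at 0)" by (simp add: isCont_def)
  have "d t = 0" if "t \<noteq> - (x \<bullet> \<alpha>) / (\<alpha> \<bullet> \<alpha>)" for t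
  proof -
    have "(x + t *\<^sub>R \<alpha>) \<bullet> \<alpha> \<noteq> 0"
      using that \<open>\<alpha> \<noteq> 0\<close> by (auto simp: inner_add_left field_simps)
    then show ?thesis by (simp add: d_def eq)
  qed
  then have *: "eventually (\<lambda>t. d t = 0) (at 0)"
    unfolding eventually_at_topological
    by (intro exI[of _ "if x \<bullet> \<alpha> = 0 then UNIV else - {- (x \<bullet> \<alpha>) / (\<alpha> \<bullet> \<alpha>)}"])
      (use \<open>\<alpha> \<noteq> 0\<close> in auto)
  have "(d \<longlongrightarrow> 0) (at 0)"
    by (rule tendsto_eventually[OF *])
  with 1 have "d 0 = 0" using tendsto_unique[of "at (0::real)"] by force
  then show "g x = h x" by (simp add: d_def)
qed

lemma real_refl_quot_exists:
  fixes f :: "real^3 \<Rightarrow> real"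
  assumes "real_polynomial_function f" "\<alpha> \<noteq> 0"
  shows "\<exists>g. real_polynomial_function g \<and> (\<forall>x. (x \<bullet> \<alpha>) * g x = f x - f (reflection \<alpha> x))"
  using assms(1)
proof induction
  case (linear f)
  then interpret f: bounded_linear f .
  show ?case
    by (rule exI[of _ "\<lambda>_. 2 / (\<alpha> \<bullet> \<alpha>) * f \<alpha>"])
      (auto simp: reflection_def f.diff f.scaleR)
next
  case (const c)
  show ?case by (rule exI[of _ "\<lambda>_. 0"]) auto
next
  case (add f1 f2)
  then obtain g1 g2 where "real_polynomial_function g1" "real_polynomial_function g2"
    and "\<forall>x. (x \<bullet> \<alpha>) * g1 x = f1 x - f1 (reflection \<alpha> x)"
    and "\<forall>x. (x \<bullet> \<alpha>) * g2 x = f2 x - f2 (reflection \<alpha> x)" by blast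
  then show ?case
    by (intro exI[of _ "\<lambda>x. g1 x + g2 x"]) (auto simp: algebra_simps)
next
  case (mult f1 f2)
  then obtain g1 g2 where g: "real_polynomial_function g1" "real_polynomial_function g2"
    and eq: "\<And>x. (x \<bullet> \<alpha>) * g1 x = f1 x - f1 (reflection \<alpha> x)"
      "\<And>x. (x \<bullet> \<alpha>) * g2 x = f2 x - f2 (reflection \<alpha> x)" by blast
  have "real_polynomial_function (\<lambda>x. f1 (reflection \<alpha> x))"
    using real_polynomial_function_compose[OF polynomial_function_bounded_linear[OF
        bounded_linear_reflection] mult(1)] by (simp add: o_def)
  moreover have "(x \<bullet> \<alpha>) * (g1 x * f2 x + f1 (reflection \<alpha> x) * g2 x) =
      f1 x * f2 x - f1 (reflection \<alpha> x) * f2 (reflection \<alpha> x)" for x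
  proof -
    have "(x \<bullet> \<alpha>) * (g1 x * f2 x + f1 (reflection \<alpha> x) * g2 x) =
        ((x \<bullet> \<alpha>) * g1 x) * f2 x + f1 (reflection \<alpha> x) * ((x \<bullet> \<alpha>) * g2 x)"
      by (simp only: distrib_left mult.assoc mult.left_commute)
    then show ?thesis by (simp only: eq) (simp add: algebra_simps)
  qed
  ultimately show ?case using g mult(1,2)
    by (intro exI[of _ "\<lambda>x. g1 x * f2 x + f1 (reflection \<alpha> x) * g2 x"])
      (auto intro!: real_polynomial_function.intros(3,4))
qed

lemma refl_quot_exists:
  assumes "polynomial_function f" "\<alpha> \<noteq> 0"
  shows "\<exists>g. polynomial_function g \<and>
    (\<forall>x. complex_of_real (x \<bullet> \<alpha>) * g x = f x - f (reflection \<alpha> x))"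
proof -
  from assms(1) have f: "real_polynomial_function (\<lambda>x. Re (f x))"
    "real_polynomial_function (\<lambda>x. Im (f x))"
    by (simp_all add: polynomial_function_complex_iff)
  from real_refl_quot_exists[OF f(1) assms(2)] real_refl_quot_exists[OF f(2) assms(2)]
  obtain g1 g2 where g: "real_polynomial_function g1" "real_polynomial_function g2"
    and "\<And>x. (x \<bullet> \<alpha>) * g1 x = Re (f x) - Re (f (reflection \<alpha> x))"
      "\<And>x. (x \<bullet> \<alpha>) * g2 x = Im (f x) - Im (f (reflection \<alpha> x))" by blast
  then show ?thesis
    by (intro exI[of _ "\<lambda>x. Complex (g1 x) (g2 x)"])
      (auto simp: polynomial_function_complex_iff complex_eq_iff)
qed

lemma refl_quot_eqI:
  assumes "\<alpha> \<noteq> 0" "polynomial_function g"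
    and "\<And>x. complex_of_real (x \<bullet> \<alpha>) * g x = f x - f (reflection \<alpha> x)"
  shows "refl_quot \<alpha> f = g"
  unfolding refl_quot_def
proof (rule the_equality)
  show 1: "polynomial_function g \<and>
     (\<forall>x. x \<bullet> \<alpha> \<noteq> 0 \<longrightarrow> g x = (f x - f (reflection \<alpha> x)) / complex_of_real (x \<bullet> \<alpha>))"
    using assms(2) by (simp add: assms(3)[symmetric])
  fix h assume "polynomial_function h \<and>
     (\<forall>x. x \<bullet> \<alpha> \<noteq> 0 \<longrightarrow> h x = (f x - f (reflection \<alpha> x)) / complex_of_real (x \<bullet> \<alpha>))"
  with 1 show "h = g"
    by (intro polynomial_function_eq_off_hyperplane[OF _ _ \<open>\<alpha> \<noteq> 0\<close>]) auto
qed

lemma refl_quot: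
  assumes "polynomial_function f" "\<alpha> \<noteq> 0"
  shows "polynomial_function (refl_quot \<alpha> f)"
    and "complex_of_real (x \<bullet> \<alpha>) * refl_quot \<alpha> f x = f x - f (reflection \<alpha> x)"
proof -
  obtain g where g: "polynomial_function g"
    "\<And>x. complex_of_real (x \<bullet> \<alpha>) * g x = f x - f (reflection \<alpha> x)"
    using refl_quot_exists[OF assms] by blast
  then have "refl_quot \<alpha> f = g" by (intro refl_quot_eqI assms)
  with g show "polynomial_function (refl_quot \<alpha> f)"
    "complex_of_real (x \<bullet> \<alpha>) * refl_quot \<alpha> f x = f x - f (reflection \<alpha> x)" by simp_all
qed

lemma refl_quot_add:
  assumes "polynomial_function f" "polynomial_function g" "\<alpha> \<noteq> 0"
  shows "refl_quot \<alpha> (\<lambda>x. f x + g x) = (\<lambda>x. refl_quot \<alpha> f x + refl_quot \<alpha> g x)"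
  using assms by (intro refl_quot_eqI) (auto simp: distrib_left refl_quot)

lemma refl_quot_cmult:
  assumes "polynomial_function f" "\<alpha> \<noteq> 0"
  shows "refl_quot \<alpha> (\<lambda>x. c * f x) = (\<lambda>x. c * refl_quot \<alpha> f x)"
proof (intro refl_quot_eqI)
  fix x
  show "complex_of_real (x \<bullet> \<alpha>) * (c * refl_quot \<alpha> f x) = c * f x - c * f (reflection \<alpha> x)"
    using refl_quot(2)[OF assms, of x] by (metis mult.left_commute right_diff_distrib)
qed (use assms in \<open>auto intro!: polynomial_function_times simp: refl_quot\<close>)

lemma real_polynomial_function_derivative:
  fixes f :: "real^3 \<Rightarrow> real"
  assumes "real_polynomial_function f"
  shows "\<exists>G. \<forall>v. real_polynomial_function (G v) \<and> (\<forall>x. (f has_derivative (\<lambda>v. G v x)) (at x))"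
  using assms
proof induction
  case (linear f)
  then show ?case
    by (intro exI[of _ "\<lambda>v x. f v"]) (auto simp: bounded_linear_imp_has_derivative)
next
  case (const c)
  show ?case by (rule exI[of _ "\<lambda>v x. 0"]) auto
next
  case (add f1 f2)
  then obtain G1 G2 where
    "\<And>v. real_polynomial_function (G1 v)" "\<And>x. (f1 has_derivative (\<lambda>v. G1 v x)) (at x)"
    "\<And>v. real_polynomial_function (G2 v)" "\<And>x. (f2 has_derivative (\<lambda>v. G2 v x)) (at x)"
    by meson
  then show ?case
    by (intro exI[of _ "\<lambda>v x. G1 v x + G2 v x"]) (auto intro!: has_derivative_add)
next
  case (mult f1 f2)
  then obtain G1 G2 where
    "\<And>v. real_polynomial_function (G1 v)" "\<And>x. (f1 has_derivative (\<lambda>v. G1 v x)) (at x)"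
    "\<And>v. real_polynomial_function (G2 v)" "\<And>x. (f2 has_derivative (\<lambda>v. G2 v x)) (at x)"
    by meson
  with mult(1,2) show ?case
    by (intro exI[of _ "\<lambda>v x. f1 x * G2 v x + G1 v x * f2 x"])
      (auto intro!: has_derivative_mult real_polynomial_function.intros(3,4))
qed

lemma polynomial_function_frechet:
  fixes f :: "real^3 \<Rightarrow> complex"
  assumes "polynomial_function f"
  shows "f differentiable at x" "polynomial_function (\<lambda>x. frechet_derivative f (at x) v)"
proof -
  from assms have f: "real_polynomial_function (\<lambda>x. Re (f x))"
    "real_polynomial_function (\<lambda>x. Im (f x))"
    by (simp_all add: polynomial_function_complex_iff)
  from real_polynomial_function_derivative[OF f(1)] real_polynomial_function_derivative[OF f(2)]
  obtain G1 G2 where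
    G1: "\<And>v. real_polynomial_function (G1 v)"
      "\<And>x. ((\<lambda>x. Re (f x)) has_derivative (\<lambda>v. G1 v x)) (at x)" and
    G2: "\<And>v. real_polynomial_function (G2 v)"
      "\<And>x. ((\<lambda>x. Im (f x)) has_derivative (\<lambda>v. G2 v x)) (at x)"
    by blast
  have "((\<lambda>x. complex_of_real (Re (f x)) + \<i> * complex_of_real (Im (f x))) has_derivative
      (\<lambda>v. complex_of_real (G1 v x) + \<i> * complex_of_real (G2 v x))) (at x)" for x
    by (intro has_derivative_add has_derivative_mult_right has_derivative_of_real G1 G2)
  then have D: "(f has_derivative (\<lambda>v. complex_of_real (G1 v x) + \<i> * complex_of_real (G2 v x))) (at x)"
    for x by (simp flip: complex_eq)
  then show "f differentiable at x" by (auto simp: differentiable_def)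
  have "(\<lambda>x. frechet_derivative f (at x) v) = (\<lambda>x. Complex (G1 v x) (G2 v x))"
    using frechet_derivative_at[OF D] by (auto simp: Complex_eq fun_eq_iff)
  then show "polynomial_function (\<lambda>x. frechet_derivative f (at x) v)"
    by (simp add: polynomial_function_complex_iff G1 G2)
qed

lemma frechet_derivative_add:
  assumes "polynomial_function f" "polynomial_function (g :: real^3 \<Rightarrow> complex)"
  shows "frechet_derivative (\<lambda>x. f x + g x) (at x) v =
    frechet_derivative f (at x) v + frechet_derivative g (at x) v"
proof -
  have "((\<lambda>x. f x + g x) has_derivative
      (\<lambda>v. frechet_derivative f (at x) v + frechet_derivative g (at x) v)) (at x)"
    using assms by (intro has_derivative_add)
      (simp_all add: polynomial_function_frechet flip: frechet_derivative_works)
  from frechet_derivative_at[OF this, symmetric] show ?thesis by simp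
qed

lemma frechet_derivative_cmult:
  assumes "polynomial_function (f :: real^3 \<Rightarrow> complex)"
  shows "frechet_derivative (\<lambda>x. c * f x) (at x) v = c * frechet_derivative f (at x) v"
proof -
  have "((\<lambda>x. c * f x) has_derivative (\<lambda>v. c * frechet_derivative f (at x) v)) (at x)"
    using assms by (intro has_derivative_mult_right)
      (simp_all add: polynomial_function_frechet flip: frechet_derivative_works)
  from frechet_derivative_at[OF this, symmetric] show ?thesis by simp
qed

lemma pos_roots_nonzero: "\<alpha> \<in> pos_roots m \<Longrightarrow> \<alpha> \<noteq> 0"
  by (auto simp: pos_roots_def root_vec_nonzero)

lift_definition dunkl_map :: "nat \<Rightarrow> (real^3 \<Rightarrow> complex) \<Rightarrow> 3 \<Rightarrow> cpoly \<Rightarrow> cpoly"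
  is "\<lambda>m \<kappa> j f x. frechet_derivative f (at x) (axis j 1) +
        (\<Sum>\<alpha>\<in>pos_roots m. \<kappa> \<alpha> * refl_quot \<alpha> f x * complex_of_real (\<alpha> \<bullet> axis j 1))"
  by (intro polynomial_function_add polynomial_function_frechet polynomial_function_sum
      polynomial_function_times polynomial_function_const refl_quot pos_roots_nonzero)
    (auto simp: pos_roots_def)

lift_definition dunkl_op :: "nat \<Rightarrow> (real^3 \<Rightarrow> complex) \<Rightarrow> 3 \<Rightarrow> poly_op" is dunkl_map
  by (intro conjI allI; transfer)
    (auto simp: fun_eq_iff frechet_derivative_add frechet_derivative_cmult refl_quot_add
      refl_quot_cmult pos_roots_nonzero sum.distrib sum_distrib_left algebra_simps)

lift_definition mult_var_map :: "3 \<Rightarrow> cpoly \<Rightarrow> cpoly"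
  is "\<lambda>j f x. complex_of_real (x $ j) * f x"
  by (intro polynomial_function_times polynomial_function_of_real)
    (auto intro: real_polynomial_function.intros(1) bounded_linear_vec_nth)

lift_definition mult_var_op :: "3 \<Rightarrow> poly_op" is mult_var_map
  by (intro conjI allI; transfer) (auto simp: algebra_simps)

lift_definition refl_map :: "real^3 \<Rightarrow> cpoly \<Rightarrow> cpoly"
  is "\<lambda>\<alpha> f x. f (inv (reflection \<alpha>) x)"
  using polynomial_function_compose[OF polynomial_function_bounded_linear[OF
      bounded_linear_reflection]] by (auto simp: o_def inv_reflection)

lift_definition refl_op :: "real^3 \<Rightarrow> poly_op" is refl_map
  by (intro conjI allI; transfer) auto

text \<open>The reflections generate the group algebra of the reflection group.\<close>

inductive_set dunkl_algebra :: "nat \<Rightarrow> (real^3 \<Rightarrow> complex) \<Rightarrow> poly_op set" for m \<kappa> where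
  dunkl_algebra_dunkl: "dunkl_op m \<kappa> j \<in> dunkl_algebra m \<kappa>"
| dunkl_algebra_var: "mult_var_op j \<in> dunkl_algebra m \<kappa>"
| dunkl_algebra_refl: "\<alpha> \<in> root_sys m \<Longrightarrow> refl_op \<alpha> \<in> dunkl_algebra m \<kappa>"
| dunkl_algebra_one: "1 \<in> dunkl_algebra m \<kappa>"
| dunkl_algebra_scale: "a \<in> dunkl_algebra m \<kappa> \<Longrightarrow> c *\<^sub>C a \<in> dunkl_algebra m \<kappa>"
| dunkl_algebra_add: "a \<in> dunkl_algebra m \<kappa> \<Longrightarrow> b \<in> dunkl_algebra m \<kappa> \<Longrightarrow> a + b \<in> dunkl_algebra m \<kappa>"
| dunkl_algebra_mult: "a \<in> dunkl_algebra m \<kappa> \<Longrightarrow> b \<in> dunkl_algebra m \<kappa> \<Longrightarrow> a * b \<in> dunkl_algebra m \<kappa>"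


subsection \<open>Tensor product with the Clifford algebra\<close>

text \<open>The Clifford algebra on three generators has the monomials $e_S$, $S \subseteq \{1,2,3\}$
  (ordered products of the generators in $S$), as a basis, so an element of
  $A \otimes Cl^\varepsilon(3)$ is a family of coefficients in $A$ indexed by $S$. The order
  used is that of the type \<open>3\<close>, in which \<open>3 = 0 < 1 < 2\<close>; any order gives the same algebra.
  The parameter \<open>\<epsilon>\<close> enters only through the product. The Clifford algebra
  itself is \<open>complex cl3\<close>.\<close>

typedef 'a cl3 = "UNIV :: (3 set \<Rightarrow> 'a) set"
  morphisms cl_coeff Abs_cl3 ..

setup_lifting type_definition_cl3

instantiation cl3 :: (complex_space) complex_space
begin
lift_definition zero_cl3 :: "'a cl3" is "\<lambda>_. 0" .
lift_definition plus_cl3 :: "'a cl3 \<Rightarrow> 'a cl3 \<Rightarrow> 'a cl3" is "\<lambda>a b S. a S + b S" .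
lift_definition minus_cl3 :: "'a cl3 \<Rightarrow> 'a cl3 \<Rightarrow> 'a cl3" is "\<lambda>a b S. a S - b S" .
lift_definition uminus_cl3 :: "'a cl3 \<Rightarrow> 'a cl3" is "\<lambda>a S. - a S" .
lift_definition scaleC_cl3 :: "complex \<Rightarrow> 'a cl3 \<Rightarrow> 'a cl3" is "\<lambda>c a S. c *\<^sub>C a S" .
instance
  by standard (transfer; auto simp: fun_eq_iff algebra_simps scaleC_add_right scaleC_add_left)+
end

instantiation cl3 :: (complex_alg) one
begin
lift_definition one_cl3 :: "'a cl3" is "\<lambda>S. if S = {} then 1 else 0" .
instance ..
end

text \<open>$e_S e_T = $ \<open>cl_sign \<epsilon> S T\<close> $e_{S \triangle T}$: each generator of $T$
  anticommutes with the larger generators of $S$ and squares to $\varepsilon$ against itself.\<close>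

definition cl_sign :: "complex \<Rightarrow> 3 set \<Rightarrow> 3 set \<Rightarrow> complex" where
  "cl_sign \<epsilon> S T = (\<Prod>s\<in>S. \<Prod>t\<in>T. if s = t then \<epsilon> else if t < s then - 1 else 1)"

lift_definition cl_mult :: "complex \<Rightarrow> 'a::complex_alg cl3 \<Rightarrow> 'a cl3 \<Rightarrow> 'a cl3"
  is "\<lambda>\<epsilon> a b U. \<Sum>S\<in>UNIV. \<Sum>T\<in>UNIV.
        if sym_diff S T = U then cl_sign \<epsilon> S T *\<^sub>C (a S * b T) else 0" .

abbreviation cl_mult_syntax :: "'a::complex_alg cl3 \<Rightarrow> complex \<Rightarrow> 'a cl3 \<Rightarrow> 'a cl3"
    ("(_ \<cdot>\<^bsub>_\<^esub> _)" [70, 0, 71] 70)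
  where "a \<cdot>\<^bsub>\<epsilon>\<^esub> b \<equiv> cl_mult \<epsilon> a b"

lift_definition cl_gen :: "3 \<Rightarrow> complex cl3" is "\<lambda>j S. if S = {j} then 1 else 0" .

lift_definition tensor :: "'a::complex_alg \<Rightarrow> complex cl3 \<Rightarrow> 'a cl3" (infix "\<otimes>" 73)
  is "\<lambda>a c S. c S *\<^sub>C a" .

definition cl_comm :: "complex \<Rightarrow> 'a::complex_alg cl3 \<Rightarrow> 'a cl3 \<Rightarrow> 'a cl3" where
  "cl_comm \<epsilon> a b = a \<cdot>\<^bsub>\<epsilon>\<^esub> b - b \<cdot>\<^bsub>\<epsilon>\<^esub> a"

definition cl_anticomm :: "complex \<Rightarrow> 'a::complex_alg cl3 \<Rightarrow> 'a cl3 \<Rightarrow> 'a cl3" where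
  "cl_anticomm \<epsilon> a b = a \<cdot>\<^bsub>\<epsilon>\<^esub> b + b \<cdot>\<^bsub>\<epsilon>\<^esub> a"

definition cl_square :: "complex \<Rightarrow> 'a::complex_alg cl3 \<Rightarrow> 'a cl3" where
  "cl_square \<epsilon> a = a \<cdot>\<^bsub>\<epsilon>\<^esub> a"

lemma cl_mult_coeff:
  "cl_coeff (a \<cdot>\<^bsub>\<epsilon>\<^esub> b) U =
    (\<Sum>S\<in>UNIV. cl_sign \<epsilon> S (sym_diff S U) *\<^sub>C (cl_coeff a S * cl_coeff b (sym_diff S U)))"
proof -
  have "(\<Sum>T\<in>UNIV. if sym_diff S T = U then cl_sign \<epsilon> S T *\<^sub>C (cl_coeff a S * cl_coeff b T) else 0)
      = (\<Sum>T\<in>UNIV. if T = sym_diff S U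
          then cl_sign \<epsilon> S T *\<^sub>C (cl_coeff a S * cl_coeff b T) else 0)" for S
    by (rule sum.cong[OF refl], rule if_cong) auto
  then show ?thesis by (simp add: cl_mult.rep_eq)
qed

lemma tensor_cl_mult: "(a \<otimes> c) \<cdot>\<^bsub>\<epsilon>\<^esub> (b \<otimes> d) = (a * b) \<otimes> (c \<cdot>\<^bsub>\<epsilon>\<^esub> d)"
proof -
  have sum_left: "(\<Sum>i\<in>I. f i) *\<^sub>C x = (\<Sum>i\<in>I. f i *\<^sub>C x)" for f and x :: 'a and I :: "3 set set"
    by (induction I rule: infinite_finite_induct) (auto simp: scaleC_add_left)
  show ?thesis
    unfolding cl_coeff_inject[symmetric]
    by (auto simp: fun_eq_iff cl_mult_coeff tensor.rep_eq sum_left mult_ac intro!: sum.cong)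
qed

lemma prod_sym_diff:
  fixes h :: "3 \<Rightarrow> complex"
  assumes "\<And>s. h s * h s = 1"
  shows "prod h (sym_diff S T) = prod h S * prod h T"
proof -
  have split: "prod h A = prod h (A - B) * prod h (A \<inter> B)" for A B
    using prod.Int_Diff[of A h B] by (simp add: mult.commute)
  have "prod h S * prod h T =
      (prod h (S - T) * prod h (S \<inter> T)) * (prod h (T - S) * prod h (T \<inter> S))"
    by (simp only: split[of S T] split[of T S])
  also have "\<dots> = prod h (S - T) * prod h (T - S) * prod (\<lambda>s. h s * h s) (S \<inter> T)"
    by (simp add: prod.distrib Int_commute mult_ac)
  also have "\<dots> = prod h (sym_diff S T)"
    by (subst prod.union_disjoint) (auto simp: assms)
  finally show ?thesis by simp
qed

lemma cl_sign_sym_diff_left: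
  assumes "\<epsilon> * \<epsilon> = 1"
  shows "cl_sign \<epsilon> (sym_diff S T) U = cl_sign \<epsilon> S U * cl_sign \<epsilon> T U"
  unfolding cl_sign_def
  by (rule prod_sym_diff, subst prod.distrib[symmetric], rule prod.neutral) (use assms in auto)

lemma cl_sign_sym_diff_right:
  assumes "\<epsilon> * \<epsilon> = 1"
  shows "cl_sign \<epsilon> U (sym_diff S T) = cl_sign \<epsilon> U S * cl_sign \<epsilon> U T"
proof -
  have "cl_sign \<epsilon> U V = (\<Prod>t\<in>V. \<Prod>s\<in>U. if s = t then \<epsilon> else if t < s then - 1 else 1)" for V
    unfolding cl_sign_def by (rule prod.swap)
  then show ?thesis
    by (simp only:)
      (rule prod_sym_diff, subst prod.distrib[symmetric], rule prod.neutral, use assms in auto)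
qed

lemma cl_mult_assoc:
  fixes a b c :: "'a::complex_alg cl3"
  assumes "\<epsilon> * \<epsilon> = 1"
  shows "(a \<cdot>\<^bsub>\<epsilon>\<^esub> b) \<cdot>\<^bsub>\<epsilon>\<^esub> c = a \<cdot>\<^bsub>\<epsilon>\<^esub> (b \<cdot>\<^bsub>\<epsilon>\<^esub> c)"
proof -
  have "cl_coeff ((a \<cdot>\<^bsub>\<epsilon>\<^esub> b) \<cdot>\<^bsub>\<epsilon>\<^esub> c) U = cl_coeff (a \<cdot>\<^bsub>\<epsilon>\<^esub> (b \<cdot>\<^bsub>\<epsilon>\<^esub> c)) U" for U
  proof -
    let ?f = "\<lambda>S V. cl_coeff a S * cl_coeff b (sym_diff S V) * cl_coeff c (sym_diff V U)"
    have sgn: "cl_sign \<epsilon> V (sym_diff V U) * cl_sign \<epsilon> S (sym_diff S V) =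
        cl_sign \<epsilon> S (sym_diff S U) * cl_sign \<epsilon> (sym_diff S V) (sym_diff V U)" for S V
    proof -
      have "sym_diff S V = sym_diff (sym_diff S U) (sym_diff V U)" by blast
      then have "cl_sign \<epsilon> S (sym_diff S V) =
          cl_sign \<epsilon> S (sym_diff S U) * cl_sign \<epsilon> S (sym_diff V U)"
        by (metis cl_sign_sym_diff_right[OF assms])
      then show ?thesis by (simp add: cl_sign_sym_diff_left[OF assms] mult_ac)
    qed
    have "cl_coeff ((a \<cdot>\<^bsub>\<epsilon>\<^esub> b) \<cdot>\<^bsub>\<epsilon>\<^esub> c) U =
        (\<Sum>V\<in>UNIV. \<Sum>S\<in>UNIV. (cl_sign \<epsilon> V (sym_diff V U) * cl_sign \<epsilon> S (sym_diff S V)) *\<^sub>C ?f S V)"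
      by (simp add: cl_mult_coeff scaleC_sum_right sum_distrib_right)
    also have "\<dots> = (\<Sum>S\<in>UNIV. \<Sum>V\<in>UNIV.
        (cl_sign \<epsilon> S (sym_diff S U) * cl_sign \<epsilon> (sym_diff S V) (sym_diff V U)) *\<^sub>C ?f S V)"
      unfolding sgn by (rule sum.swap)
    also have "\<dots> = (\<Sum>S\<in>UNIV. \<Sum>T\<in>UNIV.
        (cl_sign \<epsilon> S (sym_diff S U) * cl_sign \<epsilon> T (sym_diff T (sym_diff S U))) *\<^sub>C
          (cl_coeff a S * cl_coeff b T * cl_coeff c (sym_diff T (sym_diff S U))))"
    proof (rule sum.cong[OF refl])
      fix S :: "3 set"
      have "sym_diff (sym_diff S T) (sym_diff S U) = sym_diff T U"
        "sym_diff S (sym_diff S T) = T" for T by blast+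
      then show "(\<Sum>V\<in>UNIV.
          (cl_sign \<epsilon> S (sym_diff S U) * cl_sign \<epsilon> (sym_diff S V) (sym_diff V U)) *\<^sub>C ?f S V) =
        (\<Sum>T\<in>UNIV. (cl_sign \<epsilon> S (sym_diff S U) * cl_sign \<epsilon> T (sym_diff T (sym_diff S U))) *\<^sub>C
          (cl_coeff a S * cl_coeff b T * cl_coeff c (sym_diff T (sym_diff S U))))"
        by (intro sum.reindex_bij_witness[of _ "sym_diff S" "sym_diff S"]) auto
    qed
    also have "\<dots> = cl_coeff (a \<cdot>\<^bsub>\<epsilon>\<^esub> (b \<cdot>\<^bsub>\<epsilon>\<^esub> c)) U"
      by (simp add: cl_mult_coeff scaleC_sum_right sum_distrib_left mult.assoc)
    finally show ?thesis .
  qed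
  then show ?thesis by (auto simp flip: cl_coeff_inject)
qed

lemma cl_mult_one:
  fixes a :: "'a::complex_alg cl3"
  shows "1 \<cdot>\<^bsub>\<epsilon>\<^esub> a = a" "a \<cdot>\<^bsub>\<epsilon>\<^esub> 1 = a"
proof -
  have "cl_coeff (1 \<cdot>\<^bsub>\<epsilon>\<^esub> a) U = cl_coeff a U" for U
  proof -
    have "cl_coeff (1 \<cdot>\<^bsub>\<epsilon>\<^esub> a) U = (\<Sum>S\<in>UNIV. if S = ({} :: 3 set) then cl_coeff a U else 0)"
      unfolding cl_mult_coeff by (rule sum.cong) (auto simp: one_cl3.rep_eq cl_sign_def)
    then show ?thesis by simp
  qed
  moreover have "cl_coeff (a \<cdot>\<^bsub>\<epsilon>\<^esub> 1) U = cl_coeff a U" for U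
  proof -
    have "cl_coeff (a \<cdot>\<^bsub>\<epsilon>\<^esub> 1) U = (\<Sum>S\<in>UNIV. if S = U then cl_coeff a U else 0)"
      unfolding cl_mult_coeff by (rule sum.cong) (auto simp: one_cl3.rep_eq cl_sign_def)
    then show ?thesis by simp
  qed
  ultimately show "1 \<cdot>\<^bsub>\<epsilon>\<^esub> a = a" "a \<cdot>\<^bsub>\<epsilon>\<^esub> 1 = a"
    by (auto simp flip: cl_coeff_inject)
qed

lemma cl3_ring_1:
  assumes "\<epsilon> * \<epsilon> = 1"
  shows "class.ring_1 (1 :: 'a::complex_alg cl3) (cl_mult \<epsilon>) (+) 0 (-) uminus"
proof
  fix a b c :: "'a cl3"
  show "(a \<cdot>\<^bsub>\<epsilon>\<^esub> b) \<cdot>\<^bsub>\<epsilon>\<^esub> c = a \<cdot>\<^bsub>\<epsilon>\<^esub> (b \<cdot>\<^bsub>\<epsilon>\<^esub> c)" by (rule cl_mult_assoc[OF assms])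
  show "1 \<cdot>\<^bsub>\<epsilon>\<^esub> a = a" "a \<cdot>\<^bsub>\<epsilon>\<^esub> 1 = a" by (fact cl_mult_one)+
  show "(a + b) \<cdot>\<^bsub>\<epsilon>\<^esub> c = a \<cdot>\<^bsub>\<epsilon>\<^esub> c + b \<cdot>\<^bsub>\<epsilon>\<^esub> c" "a \<cdot>\<^bsub>\<epsilon>\<^esub> (b + c) = a \<cdot>\<^bsub>\<epsilon>\<^esub> b + a \<cdot>\<^bsub>\<epsilon>\<^esub> c"
    by (simp_all flip: cl_coeff_inject add: fun_eq_iff cl_mult_coeff plus_cl3.rep_eq
        distrib_left distrib_right scaleC_add_right sum.distrib)
  have "cl_coeff (0 :: 'a cl3) {} \<noteq> cl_coeff 1 {}"
    by (simp add: one_cl3.rep_eq zero_cl3.rep_eq)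
  then show "(0 :: 'a cl3) \<noteq> 1" by metis
qed

lemma cl_gen_anticomm:
  "cl_anticomm \<epsilon> (cl_gen j) (cl_gen k) = (if j = k then 2 * \<epsilon> else 0) *\<^sub>C 1"
proof -
  have "cl_coeff (cl_gen j \<cdot>\<^bsub>\<epsilon>\<^esub> cl_gen k) U =
      (if sym_diff {j} {k} = U then cl_sign \<epsilon> {j} {k} else 0)" for j k U
  proof -
    have "cl_coeff (cl_gen j \<cdot>\<^bsub>\<epsilon>\<^esub> cl_gen k) U =
        (\<Sum>S\<in>UNIV. if S = {j} then if sym_diff {j} U = {k} then cl_sign \<epsilon> {j} {k} else 0 else 0)"
      unfolding cl_mult_coeff by (rule sum.cong) (auto simp: cl_gen.rep_eq)
    also have "\<dots> = (if sym_diff {j} U = {k} then cl_sign \<epsilon> {j} {k} else 0)" by simp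
    also have "sym_diff {j} U = {k} \<longleftrightarrow> sym_diff {j} {k} = U" by blast
    finally show ?thesis .
  qed
  then show ?thesis
    by (auto simp: fun_eq_iff cl_anticomm_def plus_cl3.rep_eq scaleC_cl3.rep_eq
        one_cl3.rep_eq cl_sign_def simp flip: cl_coeff_inject)
qed


subsection \<open>The symmetries\<close>

text \<open>\<open>sym1\<close>, \<open>sym2\<close>, \<open>sym3\<close> are the one-, two- and three-index symmetries
  $O_j$, $O_{ij}$, $O_{123}$; \<open>ang_mom\<close> is $L_{ij}$ and \<open>refl_tilde\<close> is
  $\widetilde\sigma_\alpha$.\<close>

abbreviation cl_e :: "3 \<Rightarrow> poly_op cl3" where
  "cl_e j \<equiv> 1 \<otimes> cl_gen j"

definition refl_tilde :: "real^3 \<Rightarrow> poly_op cl3" where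
  "refl_tilde \<alpha> = refl_op \<alpha> \<otimes> (\<Sum>j\<in>UNIV. complex_of_real (\<alpha> \<bullet> axis j 1) *\<^sub>C cl_gen j)"

definition sym1 :: "nat \<Rightarrow> complex \<Rightarrow> (real^3 \<Rightarrow> complex) \<Rightarrow> 3 \<Rightarrow> poly_op cl3" where
  "sym1 m \<epsilon> \<kappa> j = \<epsilon> *\<^sub>C (\<Sum>k = 0..m.
     (\<kappa> (root_vec m k) * complex_of_real (root_vec m k \<bullet> axis j 1)) *\<^sub>C refl_tilde (root_vec m k))"

definition ang_mom :: "nat \<Rightarrow> (real^3 \<Rightarrow> complex) \<Rightarrow> 3 \<Rightarrow> 3 \<Rightarrow> poly_op" where
  "ang_mom m \<kappa> i j = mult_var_op i * dunkl_op m \<kappa> j - mult_var_op j * dunkl_op m \<kappa> i"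

definition sym2 :: "nat \<Rightarrow> complex \<Rightarrow> (real^3 \<Rightarrow> complex) \<Rightarrow> 3 \<Rightarrow> 3 \<Rightarrow> poly_op cl3" where
  "sym2 m \<epsilon> \<kappa> i j = ang_mom m \<kappa> i j \<otimes> 1 + (\<epsilon> / 2) *\<^sub>C (cl_e i \<cdot>\<^bsub>\<epsilon>\<^esub> cl_e j)
     + sym1 m \<epsilon> \<kappa> i \<cdot>\<^bsub>\<epsilon>\<^esub> cl_e j - sym1 m \<epsilon> \<kappa> j \<cdot>\<^bsub>\<epsilon>\<^esub> cl_e i"

definition sym3 :: "nat \<Rightarrow> complex \<Rightarrow> (real^3 \<Rightarrow> complex) \<Rightarrow> poly_op cl3" where
  "sym3 m \<epsilon> \<kappa> = - ((\<epsilon> / 2) *\<^sub>C (cl_e 1 \<cdot>\<^bsub>\<epsilon>\<^esub> cl_e 2 \<cdot>\<^bsub>\<epsilon>\<^esub> cl_e 3))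
     - sym1 m \<epsilon> \<kappa> 1 \<cdot>\<^bsub>\<epsilon>\<^esub> cl_e 2 \<cdot>\<^bsub>\<epsilon>\<^esub> cl_e 3
     - sym1 m \<epsilon> \<kappa> 2 \<cdot>\<^bsub>\<epsilon>\<^esub> cl_e 3 \<cdot>\<^bsub>\<epsilon>\<^esub> cl_e 1
     - sym1 m \<epsilon> \<kappa> 3 \<cdot>\<^bsub>\<epsilon>\<^esub> cl_e 1 \<cdot>\<^bsub>\<epsilon>\<^esub> cl_e 2
     + sym2 m \<epsilon> \<kappa> 1 2 \<cdot>\<^bsub>\<epsilon>\<^esub> cl_e 3
     + sym2 m \<epsilon> \<kappa> 3 1 \<cdot>\<^bsub>\<epsilon>\<^esub> cl_e 2
     + sym2 m \<epsilon> \<kappa> 2 3 \<cdot>\<^bsub>\<epsilon>\<^esub> cl_e 1"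

definition O_zero :: "nat \<Rightarrow> complex \<Rightarrow> (real^3 \<Rightarrow> complex) \<Rightarrow> poly_op cl3" where
  "O_zero m \<epsilon> \<kappa> = (- \<i>) *\<^sub>C sym2 m \<epsilon> \<kappa> 1 2"

definition O_plus :: "nat \<Rightarrow> complex \<Rightarrow> (real^3 \<Rightarrow> complex) \<Rightarrow> poly_op cl3" where
  "O_plus m \<epsilon> \<kappa> = \<i> *\<^sub>C sym2 m \<epsilon> \<kappa> 3 1 + sym2 m \<epsilon> \<kappa> 2 3"

definition O_minus :: "nat \<Rightarrow> complex \<Rightarrow> (real^3 \<Rightarrow> complex) \<Rightarrow> poly_op cl3" where
  "O_minus m \<epsilon> \<kappa> = \<i> *\<^sub>C sym2 m \<epsilon> \<kappa> 3 1 - sym2 m \<epsilon> \<kappa> 2 3"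

definition T_zero :: "nat \<Rightarrow> complex \<Rightarrow> (real^3 \<Rightarrow> complex) \<Rightarrow> poly_op cl3" where
  "T_zero m \<epsilon> \<kappa> = \<i> *\<^sub>C sym1 m \<epsilon> \<kappa> 3"

definition T_plus :: "nat \<Rightarrow> complex \<Rightarrow> (real^3 \<Rightarrow> complex) \<Rightarrow> poly_op cl3" where
  "T_plus m \<epsilon> \<kappa> = sym1 m \<epsilon> \<kappa> 1 + \<i> *\<^sub>C sym1 m \<epsilon> \<kappa> 2"

definition T_minus :: "nat \<Rightarrow> complex \<Rightarrow> (real^3 \<Rightarrow> complex) \<Rightarrow> poly_op cl3" where
  "T_minus m \<epsilon> \<kappa> = sym1 m \<epsilon> \<kappa> 1 - \<i> *\<^sub>C sym1 m \<epsilon> \<kappa> 2"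

definition L_plus :: "nat \<Rightarrow> complex \<Rightarrow> (real^3 \<Rightarrow> complex) \<Rightarrow> poly_op cl3" where
  "L_plus m \<epsilon> \<kappa> = (1/2) *\<^sub>C cl_anticomm \<epsilon> (O_zero m \<epsilon> \<kappa>) (O_plus m \<epsilon> \<kappa>)"

definition L_minus :: "nat \<Rightarrow> complex \<Rightarrow> (real^3 \<Rightarrow> complex) \<Rightarrow> poly_op cl3" where
  "L_minus m \<epsilon> \<kappa> = (1/2) *\<^sub>C cl_anticomm \<epsilon> (O_zero m \<epsilon> \<kappa>) (O_minus m \<epsilon> \<kappa>)"

text \<open>All these elements lie in the subalgebra $\mathcal{A}_\kappa \otimes Cl^\varepsilon(3)$,
  so identities between them may be stated with coefficients in \<open>poly_op\<close>.\<close>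

definition dunkl_tensor :: "nat \<Rightarrow> (real^3 \<Rightarrow> complex) \<Rightarrow> poly_op cl3 set" where
  "dunkl_tensor m \<kappa> = {a. \<forall>S. cl_coeff a S \<in> dunkl_algebra m \<kappa>}"

lemma dunkl_algebra_uminus: "a \<in> dunkl_algebra m \<kappa> \<Longrightarrow> - a \<in> dunkl_algebra m \<kappa>"
  using dunkl_algebra_scale[of a m \<kappa> "- 1"] by simp

lemma dunkl_algebra_diff:
  "a \<in> dunkl_algebra m \<kappa> \<Longrightarrow> b \<in> dunkl_algebra m \<kappa> \<Longrightarrow> a - b \<in> dunkl_algebra m \<kappa>"
  using dunkl_algebra_add[OF _ dunkl_algebra_uminus] by force

lemma dunkl_algebra_zero: "0 \<in> dunkl_algebra m \<kappa>"
  using dunkl_algebra_scale[OF dunkl_algebra_one, of 0] by simp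

lemma dunkl_algebra_sum:
  "(\<And>i. i \<in> I \<Longrightarrow> f i \<in> dunkl_algebra m \<kappa>) \<Longrightarrow> sum f I \<in> dunkl_algebra m \<kappa>"
  by (induction I rule: infinite_finite_induct)
    (auto intro: dunkl_algebra_zero dunkl_algebra_add)

lemma dunkl_tensor_closed:
  shows "a \<in> dunkl_tensor m \<kappa> \<Longrightarrow> b \<in> dunkl_tensor m \<kappa> \<Longrightarrow> a + b \<in> dunkl_tensor m \<kappa>"
    and "a \<in> dunkl_tensor m \<kappa> \<Longrightarrow> b \<in> dunkl_tensor m \<kappa> \<Longrightarrow> a - b \<in> dunkl_tensor m \<kappa>"
    and "a \<in> dunkl_tensor m \<kappa> \<Longrightarrow> - a \<in> dunkl_tensor m \<kappa>"
    and "a \<in> dunkl_tensor m \<kappa> \<Longrightarrow> z *\<^sub>C a \<in> dunkl_tensor m \<kappa>"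
    and "a \<in> dunkl_tensor m \<kappa> \<Longrightarrow> b \<in> dunkl_tensor m \<kappa> \<Longrightarrow> a \<cdot>\<^bsub>\<epsilon>\<^esub> b \<in> dunkl_tensor m \<kappa>"
    and "t \<in> dunkl_algebra m \<kappa> \<Longrightarrow> t \<otimes> c \<in> dunkl_tensor m \<kappa>"
  by (auto simp: dunkl_tensor_def plus_cl3.rep_eq minus_cl3.rep_eq uminus_cl3.rep_eq
      scaleC_cl3.rep_eq cl_mult_coeff tensor.rep_eq
      intro!: dunkl_algebra_add dunkl_algebra_diff dunkl_algebra_uminus dunkl_algebra_scale
        dunkl_algebra_mult dunkl_algebra_sum)

lemma dunkl_tensor_sum:
  "(\<And>i. i \<in> I \<Longrightarrow> f i \<in> dunkl_tensor m \<kappa>) \<Longrightarrow> sum f I \<in> dunkl_tensor m \<kappa>"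
proof (induction I rule: infinite_finite_induct)
  case (insert x F)
  then show ?case by (auto intro: dunkl_tensor_closed(1))
qed (auto simp: dunkl_tensor_def zero_cl3.rep_eq dunkl_algebra_zero)

lemma sym_in_dunkl_tensor:
  shows "sym1 m \<epsilon> \<kappa> j \<in> dunkl_tensor m \<kappa>" and "sym2 m \<epsilon> \<kappa> i j \<in> dunkl_tensor m \<kappa>"
    and "sym3 m \<epsilon> \<kappa> \<in> dunkl_tensor m \<kappa>"
proof -
  have e: "cl_e j \<in> dunkl_tensor m \<kappa>" for j
    by (intro dunkl_tensor_closed dunkl_algebra_one)
  have "root_vec m k \<in> root_sys m" if "k \<le> m" for k
    using that by (cases "k = 0") (auto simp: root_sys_def)
  then show 1: "sym1 m \<epsilon> \<kappa> j \<in> dunkl_tensor m \<kappa>" for j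
    unfolding sym1_def refl_tilde_def
    by (intro dunkl_tensor_closed dunkl_tensor_sum dunkl_algebra_refl) auto
  show 2: "sym2 m \<epsilon> \<kappa> i j \<in> dunkl_tensor m \<kappa>" for i j
    unfolding sym2_def ang_mom_def
    by (intro dunkl_tensor_closed dunkl_algebra_diff dunkl_algebra_mult dunkl_algebra_var
        dunkl_algebra_dunkl e 1)
  show "sym3 m \<epsilon> \<kappa> \<in> dunkl_tensor m \<kappa>"
    unfolding sym3_def by (intro dunkl_tensor_closed e 1 2)
qed

end

theory Submission
  imports Defs
begin

text \<open>
  Write $L_k$ for the angular momentum $L_{k+1,k+2}$ (indices cyclic), $s$ for the sum of
  $\kappa(\alpha)\sigma_\alpha$ over the positive roots and $\omega = e_1 e_2 e_3$, which is
  central with $\omega^2 = -\varepsilon$. The whole algebra is governed by the single element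
  $Y = \omega \sum_k L_k e_k - s - 1/2$. The Dunkl deformation of the commutation relations of the
  $L_k$ says precisely that $Y^2$ has no Clifford component, so that $Y^2$ commutes with every
  $e_k$ (lemma \<open>Y_sq\<close>), and $Y$ commutes with the one-index symmetries because angular
  momenta transform as pseudovectors under reflections (\<open>Y_O1\<close>). The symmetries are
  simple in terms of $Y$:
  \[ O_{k+1,k+2} = - (\omega/2) (\{Y, e_k\} + 2 \varepsilon O_k), \qquad
     O_{123} = - \varepsilon \omega (Y - 1/2), \]
  and $[Y, \{Y, e_k\}] = [Y^2, e_k] = 0$. Hence $O_{123}$ commutes with all symmetries, the
  commutators of the two-index symmetries close (\<open>O2_comm\<close>), and the sum of their squares is
  $1/4 + \varepsilon O_{123}^2 - \varepsilon \sum_k O_k^2$ (\<open>O2_sq_sum\<close>).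

  The group $\mathbb{Z}_2 \times D_{2m}$ enters through two facts only: no root mixes the third
  coordinate with the others, and the reflection along the third axis commutes with all
  reflections. Therefore $T_\pm$ anticommutes with $O_0$ and $T_0$, while $T_0$ commutes with $O_0$
  and anticommutes with $O_\pm$. Setting $P = \varepsilon O_{123} + T_0$ and $P' = \varepsilon O_{123} - T_0$, the
  relations above become $[O_0, O_+] = O_+ + 2 \varepsilon P T_+$,
  $[O_0, O_-] = - O_- + 2 \varepsilon P' T_-$, $T_+ O_- = - O_+ T_-$ and
  $O_+ O_- = - ((O_0 - 1/2)^2 + \varepsilon P^2 - \varepsilon T_+ T_-)$. The anticommutator
  with $O_0$ removes the term $P T_+$ from the first relation, as $T_+$ anticommutes with $O_0$;
  this gives the ladder property. In $L_+ L_-$ the mixed terms cancel and leave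
  $(O_0 - 1/2)^2 O_+ O_- + P^2 T_+ T_-$, which is the asserted product
  (\<open>ladder_raising\<close>).

  The input from analysis consists of the commutation relations between coordinates, reflections
  and Dunkl operators. That the Dunkl operators commute with each other follows from the others:
  by the Jacobi identity $[D_j, D_k]$ commutes with all coordinates, and it annihilates the
  constant $1$, from which the coordinates generate every polynomial.
\<close>

section \<open>Calculation in the Clifford algebra\<close>

lemma cl_mult_add_left: "(a + b) \<cdot>\<^bsub>\<epsilon>\<^esub> c = a \<cdot>\<^bsub>\<epsilon>\<^esub> c + b \<cdot>\<^bsub>\<epsilon>\<^esub> c"
  and cl_mult_add_right: "a \<cdot>\<^bsub>\<epsilon>\<^esub> (b + c) = a \<cdot>\<^bsub>\<epsilon>\<^esub> b + a \<cdot>\<^bsub>\<epsilon>\<^esub> c"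
  and cl_mult_scaleC_left: "(z *\<^sub>C a) \<cdot>\<^bsub>\<epsilon>\<^esub> c = z *\<^sub>C (a \<cdot>\<^bsub>\<epsilon>\<^esub> c)"
  and cl_mult_scaleC_right: "a \<cdot>\<^bsub>\<epsilon>\<^esub> (z *\<^sub>C c) = z *\<^sub>C (a \<cdot>\<^bsub>\<epsilon>\<^esub> c)"
  for a b c :: "'a::complex_alg cl3"
  by (simp_all flip: cl_coeff_inject add: fun_eq_iff cl_mult_coeff plus_cl3.rep_eq scaleC_cl3.rep_eq
        distrib_left distrib_right scaleC_add_right sum.distrib scaleC_sum_right mult.commute)

lemma cl_mult_minus_left: "(- a) \<cdot>\<^bsub>\<epsilon>\<^esub> c = - (a \<cdot>\<^bsub>\<epsilon>\<^esub> c)"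
  and cl_mult_minus_right: "a \<cdot>\<^bsub>\<epsilon>\<^esub> (- c) = - (a \<cdot>\<^bsub>\<epsilon>\<^esub> c)"
  for a c :: "'a::complex_alg cl3"
  using cl_mult_scaleC_left[of \<epsilon> "- 1" a c] cl_mult_scaleC_right[of \<epsilon> a "- 1" c] by simp_all

lemma cl_mult_diff_left: "(a - b) \<cdot>\<^bsub>\<epsilon>\<^esub> c = a \<cdot>\<^bsub>\<epsilon>\<^esub> c - b \<cdot>\<^bsub>\<epsilon>\<^esub> c"
  and cl_mult_diff_right: "a \<cdot>\<^bsub>\<epsilon>\<^esub> (b - c) = a \<cdot>\<^bsub>\<epsilon>\<^esub> b - a \<cdot>\<^bsub>\<epsilon>\<^esub> c"
  for a b c :: "'a::complex_alg cl3"
  using cl_mult_add_left[of \<epsilon> a "- b" c] cl_mult_add_right[of \<epsilon> a b "- c"]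
  by (simp_all add: cl_mult_minus_left cl_mult_minus_right)

lemma cl_mult_zero_left: "0 \<cdot>\<^bsub>\<epsilon>\<^esub> a = 0" and cl_mult_zero_right: "a \<cdot>\<^bsub>\<epsilon>\<^esub> 0 = 0"
  for a :: "'a::complex_alg cl3"
  using cl_mult_diff_left[of \<epsilon> 0 0 a] cl_mult_diff_right[of \<epsilon> a 0 0] by simp_all

lemmas cl_mult_linear =
  cl_mult_add_left cl_mult_add_right cl_mult_diff_left cl_mult_diff_right
  cl_mult_minus_left cl_mult_minus_right cl_mult_scaleC_left cl_mult_scaleC_right
  cl_mult_zero_left cl_mult_zero_right cl_mult_one

lemma scaleC_diff_right: "c *\<^sub>C (x - y) = c *\<^sub>C x - c *\<^sub>C (y :: 'a::complex_space)"
  using scaleC_add_right[of c x "- y"] by simp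

lemma scaleC_minus_left: "(- c) *\<^sub>C x = - (c *\<^sub>C (x :: 'a::complex_space))"
  using scaleC_scaleC[of "- 1" c x] by (simp del: scaleC_scaleC)

text \<open>Splitting even numerals turns integer multiples into repeated sums, so that terms with
  different integer coefficients cancel by rewriting in the additive group.\<close>

lemma scaleC_even:
  fixes x :: "'a::complex_space"
  shows "numeral (num.Bit0 n) *\<^sub>C x = numeral n *\<^sub>C x + numeral n *\<^sub>C x"
    and "(numeral (num.Bit0 n) * c) *\<^sub>C x = (numeral n * c) *\<^sub>C x + (numeral n * c) *\<^sub>C x"
    and "(c * numeral (num.Bit0 n)) *\<^sub>C x = (c * numeral n) *\<^sub>C x + (c * numeral n) *\<^sub>C x"
  unfolding numeral_Bit0 scaleC_add_left distrib_left distrib_right by (rule refl)+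

text \<open>The type \<open>3\<close> is the ring of integers modulo three, so \<open>k + 1\<close> and \<open>k + 2\<close> are
  the two indices that follow \<open>k\<close> cyclically.\<close>

lemma cyc_3: "(1::3) + 1 = 2" "(2::3) + 1 = 3" "(3::3) + 1 = 1" "(1::3) + 2 = 3" "(2::3) + 2 = 1" "(3::3) + 2 = 2"
  "(4::3) = 1" "(5::3) = 2" "(6::3) = 3"
  by simp_all

lemmas scaleC_dist = scaleC_add_right scaleC_diff_right scaleC_minus_left
lemmas scaleC_linear = scaleC_dist scaleC_even

text \<open>For clearing denominators before terms are collected.\<close>

lemma scaleC_cancel: "c *\<^sub>C x = c *\<^sub>C y \<Longrightarrow> c \<noteq> 0 \<Longrightarrow> x = (y :: 'a::complex_space)"
  by (metis scaleC_scaleC scaleC_one left_inverse)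

lemma sum_cyc: "(\<Sum>j\<in>UNIV. f j) = f k + f (k + 1) + f (k + 2 :: 3)" for f :: "3 \<Rightarrow> 'b::comm_monoid_add"
  using exhaust_3[of k] by (auto simp: sum_3 cyc_3 add_ac)

locale clifford_sign =
  fixes \<epsilon> :: complex
  assumes eps: "\<epsilon> * \<epsilon> = 1"
begin

abbreviation mul :: "'a::complex_alg cl3 \<Rightarrow> 'a cl3 \<Rightarrow> 'a cl3" (infixl "\<odot>" 70)
  where "a \<odot> b \<equiv> a \<cdot>\<^bsub>\<epsilon>\<^esub> b"

lemmas mul_assoc = cl_mult_assoc[OF eps]

lemma eps_eps: "\<epsilon> * (\<epsilon> * c) = c"
  using mult.assoc[of \<epsilon> \<epsilon> c] unfolding eps mult_1 by (rule sym)

lemma eps_numeral: "\<epsilon> * numeral n = numeral n * \<epsilon>" "\<epsilon> * (numeral n * c) = numeral n * (\<epsilon> * c)"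
  and eps_i: "\<epsilon> * \<i> = \<i> * \<epsilon>"
  by simp_all

lemmas eps_simps = eps eps_eps eps_numeral

text \<open>The two tensor factors, embedded with commuting images (\<open>e_coef\<close>).\<close>

definition coef :: "'a::complex_alg \<Rightarrow> 'a cl3" where "coef a = a \<otimes> 1"
definition e :: "3 \<Rightarrow> 'a::complex_alg cl3" where "e k = 1 \<otimes> cl_gen k"

text \<open>In dimension three the pseudoscalar is central, and it identifies bivectors with vectors
  (\<open>e_cyc\<close>).\<close>

definition \<omega> :: "'a::complex_alg cl3" where "\<omega> = e 1 \<odot> e 2 \<odot> e 3"

lemma coef_linear:
  "coef (a + b) = coef a + coef b" "coef (a - b) = coef a - coef b" "coef (- a) = - coef a"
  "coef (c *\<^sub>C a) = c *\<^sub>C coef a" "coef 0 = 0" "coef 1 = 1"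
  by (simp_all flip: cl_coeff_inject add: coef_def fun_eq_iff tensor.rep_eq plus_cl3.rep_eq
     minus_cl3.rep_eq uminus_cl3.rep_eq scaleC_cl3.rep_eq one_cl3.rep_eq zero_cl3.rep_eq
     scaleC_add_right scaleC_diff_right)

lemma coef_mult: "coef a \<odot> coef b = coef (a * b)"
  by (simp add: coef_def tensor_cl_mult cl_mult_one)

lemma e_coef: "e k \<odot> coef a = coef a \<odot> e k"
  by (simp add: coef_def e_def tensor_cl_mult cl_mult_one)

lemma tensor_gen: "a \<otimes> cl_gen k = coef a \<odot> e k"
  by (simp add: coef_def e_def tensor_cl_mult cl_mult_one)

lemma e_anticomm: "e j \<odot> e k + e k \<odot> e j = (if j = k then 2 * \<epsilon> else 0) *\<^sub>C 1"
proof -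
  have "e j \<odot> e k + e k \<odot> e j = 1 \<otimes> cl_anticomm \<epsilon> (cl_gen j) (cl_gen k)"
    by (simp flip: cl_coeff_inject add: e_def tensor_cl_mult cl_anticomm_def fun_eq_iff tensor.rep_eq plus_cl3.rep_eq
      scaleC_add_left)
  also have "\<dots> = (if j = k then 2 * \<epsilon> else 0) *\<^sub>C 1"
    unfolding cl_gen_anticomm
    by (simp flip: cl_coeff_inject add: fun_eq_iff tensor.rep_eq scaleC_cl3.rep_eq one_cl3.rep_eq)
  finally show ?thesis .
qed

lemma e_sq: "e k \<odot> e k = \<epsilon> *\<^sub>C 1"
proof -
  have "(1/2) *\<^sub>C (e k \<odot> e k + e k \<odot> e k) = \<epsilon> *\<^sub>C 1"
    unfolding e_anticomm by simp
  then show ?thesis by (simp add: scaleC_add_right flip: scaleC_add_left)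
qed

lemma e_swap: "j \<noteq> k \<Longrightarrow> e j \<odot> e k = - (e k \<odot> e j)"
  using e_anticomm[of j k] by (simp add: eq_neg_iff_add_eq_0)

lemma neq_3: "(1::3) \<noteq> 2" "(1::3) \<noteq> 3" "(2::3) \<noteq> 3" "(2::3) \<noteq> 1" "(3::3) \<noteq> 1" "(3::3) \<noteq> 2"
  by simp_all

text \<open>Products are kept associated to the right; this lets a rule for \<open>a \<odot> b\<close> act in front of
  further factors.\<close>

lemma mul_eq_tail: "a \<odot> b = c \<Longrightarrow> a \<odot> (b \<odot> d) = c \<odot> d"
  by (simp only: mul_assoc[symmetric])

lemma e_tail:
  "e k \<odot> (e k \<odot> b) = \<epsilon> *\<^sub>C b"
  "e k \<odot> (coef a \<odot> b) = coef a \<odot> (e k \<odot> b)"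
  "coef a \<odot> (coef a' \<odot> b) = coef (a * a') \<odot> b"
  using mul_eq_tail[OF e_sq, of k b]
    mul_eq_tail[OF e_coef, of k a b] mul_eq_tail[OF coef_mult, of a a' b]
  by (simp_all only: mul_assoc cl_mult_linear)

lemma e_swap_tail: "e j \<odot> (e k \<odot> b) = - (e k \<odot> (e j \<odot> b))" if "j \<noteq> k"
  using mul_eq_tail[OF e_swap[OF that], of b] by (simp only: mul_assoc cl_mult_linear)

lemmas e_order = e_swap[OF neq_3(4)] e_swap[OF neq_3(5)] e_swap[OF neq_3(6)]
  e_swap_tail[OF neq_3(4)] e_swap_tail[OF neq_3(5)] e_swap_tail[OF neq_3(6)]

lemma \<omega>_coef: "\<omega> \<odot> coef a = coef a \<odot> \<omega>"
  by (simp add: \<omega>_def mul_assoc e_coef e_tail)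

lemma \<omega>_sq: "\<omega> \<odot> \<omega> = - \<epsilon> *\<^sub>C 1"
  by (simp add: \<omega>_def mul_assoc e_sq e_tail e_order cl_mult_linear eps scaleC_linear)

lemma e_\<omega>: "e k \<odot> \<omega> = \<omega> \<odot> e k"
  using exhaust_3[of k]
  by (auto simp add: \<omega>_def mul_assoc e_sq e_tail e_order cl_mult_linear)

lemma e_cyc: "e k \<odot> e (k + 1) = \<epsilon> *\<^sub>C (\<omega> \<odot> e (k + 2))"
  "e (k + 1) \<odot> e k = - (\<epsilon> *\<^sub>C (\<omega> \<odot> e (k + 2)))"
  using exhaust_3[of k]
  by (auto simp add: \<omega>_def mul_assoc e_sq e_tail e_order cl_mult_linear eps cyc_3)

lemma \<omega>_tail: "\<omega> \<odot> (coef a \<odot> b) = coef a \<odot> (\<omega> \<odot> b)" "\<omega> \<odot> (\<omega> \<odot> b) = - \<epsilon> *\<^sub>C b"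
  "e k \<odot> (\<omega> \<odot> b) = \<omega> \<odot> (e k \<odot> b)"
  "e k \<odot> (e (k + 1) \<odot> b) = \<epsilon> *\<^sub>C (\<omega> \<odot> (e (k + 2) \<odot> b))"
  "e (k + 1) \<odot> (e k \<odot> b) = - (\<epsilon> *\<^sub>C (\<omega> \<odot> (e (k + 2) \<odot> b)))"
  using mul_eq_tail[OF \<omega>_coef, of a b] mul_eq_tail[OF \<omega>_sq, of b]
    mul_eq_tail[OF e_\<omega>, of k b] mul_eq_tail[OF e_cyc(1), of k b] mul_eq_tail[OF e_cyc(2), of k b]
  by (simp_all only: mul_assoc cl_mult_linear)

lemmas cl_table =
  e_cyc[of 1, unfolded cyc_3] e_cyc[of 2, unfolded cyc_3] e_cyc[of 3, unfolded cyc_3]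
  \<omega>_tail(4,5)[of 1, unfolded cyc_3] \<omega>_tail(4,5)[of 2, unfolded cyc_3] \<omega>_tail(4,5)[of 3, unfolded cyc_3]
  e_sq e_tail(1)

text \<open>Every product reduces to a coefficient, times \<open>1\<close> or \<open>\<omega>\<close>, times \<open>1\<close> or one
  generator.\<close>

lemmas cl_normal = cl_mult_linear mul_assoc scaleC_linear cl_table
   e_coef e_tail(2,3) coef_mult e_\<omega> \<omega>_sq \<omega>_coef \<omega>_tail(1-3) eps eps_eps

end

section \<open>Symmetries of the Dirac operator of a rank three Dunkl system\<close>

text \<open>The relations between angular momenta and reflections that hold for the Dunkl operators of
  every root system in three dimensions: \<open>L k\<close> stands for $L_{k+1,k+2}$, \<open>C j k\<close> for half of $[D_j, x_k] - \delta_{jk}$,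
  and \<open>s\<close> for the sum of $\kappa(\alpha) \sigma_\alpha$. With \<open>q\<close> in place of \<open>s\<close> the
  assumption \<open>L_comm\<close> states that the part of \<open>Y \<odot> Y\<close> proportional to a generator
  vanishes.\<close>

locale angular_algebra = clifford_sign \<epsilon> for \<epsilon> +
  fixes L :: "3 \<Rightarrow> 'a::complex_alg" and C :: "3 \<Rightarrow> 3 \<Rightarrow> 'a" and s q :: 'a
  assumes C_sym: "C j k = C k j"
    and C_trace: "C 1 1 + C 2 2 + C 3 3 = s"
    and s_C: "s * C j k = C j k * s"
    and L_C: "L p * C l k + C l k * L p = L l * C p k + C p k * L l"
    and L_C_div: "L 1 * C 1 k + L 2 * C 2 k + L 3 * C 3 k = C 1 k * L 1 + C 2 k * L 2 + C 3 k * L 3"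
    and L_comm: "L k * L (k + 1) - L (k + 1) * L k = L (k + 2) * q + q * L (k + 2)"
    and q_def: "q = - s - (1/2) *\<^sub>C 1"
begin

text \<open>The shift by $1/2$ in \<open>q\<close> is the one that makes the square of \<open>Y\<close> free of Clifford
  generators; \<open>O3_eq_Y\<close> identifies \<open>Y\<close> with the three-index symmetry up to this shift.\<close>

definition Y :: "'a cl3" where "Y = coef q + \<omega> \<odot> (coef (L 1) \<odot> e 1 + coef (L 2) \<odot> e 2 + coef (L 3) \<odot> e 3)"

text \<open>\<open>O1 k\<close> is $O_k$, while \<open>O2 k\<close> is $O_{k+1,k+2}$, named by the complementary index.\<close>

definition O1 :: "3 \<Rightarrow> 'a cl3" where
  "O1 k = \<epsilon> *\<^sub>C (coef (C 1 k) \<odot> e 1 + coef (C 2 k) \<odot> e 2 + coef (C 3 k) \<odot> e 3)"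

definition O2 :: "3 \<Rightarrow> 'a cl3" where
  "O2 k = coef (L k) + (1/2) *\<^sub>C (\<omega> \<odot> e k) + O1 (k + 1) \<odot> e (k + 2) - O1 (k + 2) \<odot> e (k + 1)"

lemma e_Y_anticomm: "Y \<odot> e k + e k \<odot> Y = 2 *\<^sub>C (coef q \<odot> e k + \<epsilon> *\<^sub>C (\<omega> \<odot> coef (L k)))"
  using exhaust_3[of k] by (auto simp: Y_def cl_normal algebra_simps)

text \<open>Enclosing \<open>Y\<close> between generators multiplies its scalar part \<open>q\<close> and its vector part by
  different constants, so the result is again a combination of \<open>Y\<close> and \<open>q\<close>.\<close>

lemma e_Y_e_cyc: "e k \<odot> Y \<odot> e (k + 1) - e (k + 1) \<odot> Y \<odot> e k =
    (4 * \<epsilon>) *\<^sub>C (\<omega> \<odot> coef q \<odot> e (k + 2)) - \<epsilon> *\<^sub>C (\<omega> \<odot> (Y \<odot> e (k + 2) + e (k + 2) \<odot> Y))"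
  using exhaust_3[of k] by (auto simp: Y_def cl_normal cyc_3 algebra_simps)

lemma e_Y_e_sum: "e 1 \<odot> Y \<odot> e 1 + e 2 \<odot> Y \<odot> e 2 + e 3 \<odot> Y \<odot> e 3 = (4 * \<epsilon>) *\<^sub>C coef q - \<epsilon> *\<^sub>C Y"
  by (simp add: Y_def cl_normal algebra_simps)

lemma L_comm': "L 2 * L 3 = L 3 * L 2 + (L 1 * q + q * L 1)" "L 3 * L 1 = L 1 * L 3 + (L 2 * q + q * L 2)"
  "L 1 * L 2 = L 2 * L 1 + (L 3 * q + q * L 3)"
  using L_comm[of 1] L_comm[of 2] L_comm[of 3] by (simp_all add: cyc_3 algebra_simps)

text \<open>The component along $\omega e_k$ is $\{q, L_k\} - [L_{k+1}, L_{k+2}]$, which is zero by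
  \<open>L_comm\<close>.\<close>

lemma Y_sq: "Y \<odot> Y = coef (q * q - L 1 * L 1 - L 2 * L 2 - L 3 * L 3)"
  by (simp add: Y_def cl_normal coef_linear L_comm' algebra_simps)

lemma Y_sq_e: "Y \<odot> (Y \<odot> e k) = e k \<odot> (Y \<odot> Y)"
  by (simp add: Y_sq e_coef flip: mul_assoc)

text \<open>The next three lemmas rest on the symmetry of \<open>C\<close>: the terms with $C_{jk}$ and $C_{kj}$
  occur with opposite signs.\<close>

lemma O1_e_antisym:
   "O1 j \<odot> e k - O1 k \<odot> e j = e j \<odot> O1 k - e k \<odot> O1 j"
  using C_sym[of 1 2] C_sym[of 1 3] C_sym[of 2 3] exhaust_3[of j] exhaust_3[of k] by (auto simp: O1_def cl_normal algebra_simps)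

lemma O1_e_cyc: "O1 k \<odot> e (k + 1) - O1 (k + 1) \<odot> e k = \<omega> \<odot> (coef s \<odot> e (k + 2) - \<epsilon> *\<^sub>C O1 (k + 2))"
  using C_sym[of 1 2] C_sym[of 1 3] C_sym[of 2 3] exhaust_3[of k] by (auto simp: O1_def cl_normal algebra_simps cyc_3 coef_linear simp flip: C_trace)

lemma O1_e_sum: "O1 1 \<odot> e 1 + O1 2 \<odot> e 2 + O1 3 \<odot> e 3 = coef s"
    "e 1 \<odot> O1 1 + e 2 \<odot> O1 2 + e 3 \<odot> O1 3 = coef s"
  using C_sym[of 1 2] C_sym[of 1 3] C_sym[of 2 3] by (auto simp: O1_def cl_normal algebra_simps coef_linear simp flip: C_trace)

lemma q_C: "q * C j k = C j k * q"
  by (simp add: q_def s_C algebra_simps)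

text \<open>The scalar part of the commutator vanishes by \<open>L_C_div\<close>, the bivector part by
  \<open>L_C\<close>, and \<open>q\<close> contributes nothing because \<open>s\<close> commutes with all \<open>C j k\<close>.\<close>

lemma Y_O1: "Y \<odot> O1 k = O1 k \<odot> Y"
proof -
  have LC: "L 2 * C 1 k = L 1 * C 2 k + C 2 k * L 1 - C 1 k * L 2"
    "L 3 * C 1 k = L 1 * C 3 k + C 3 k * L 1 - C 1 k * L 3"
    "L 3 * C 2 k = L 2 * C 3 k + C 3 k * L 2 - C 2 k * L 3"
    "L 1 * C 1 k = C 1 k * L 1 + C 2 k * L 2 + C 3 k * L 3 - L 2 * C 2 k - L 3 * C 3 k"
    using L_C[of 1 2 k] L_C[of 1 3 k] L_C[of 2 3 k] L_C_div[of k] by (simp_all add: algebra_simps)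
  show ?thesis
    by (simp add: Y_def O1_def cl_normal coef_linear LC q_C algebra_simps)
qed

text \<open>These anticommutators commute with \<open>Y\<close> although the generators do not, since
  $[Y, \{Y, e_k\}] = [Y^2, e_k]$.\<close>

definition K :: "3 \<Rightarrow> 'a cl3" where "K k = Y \<odot> e k + e k \<odot> Y"

lemma Y_\<omega>: "Y \<odot> \<omega> = \<omega> \<odot> Y"
  by (simp add: Y_def cl_normal)

lemma Y_\<omega>_tail: "Y \<odot> (\<omega> \<odot> b) = \<omega> \<odot> (Y \<odot> b)"
  using mul_eq_tail[OF Y_\<omega>, of b] by (simp add: mul_assoc)

lemma O1_\<omega>: "O1 k \<odot> \<omega> = \<omega> \<odot> O1 k"
  by (simp add: O1_def cl_normal)

lemma K_\<omega>: "K k \<odot> \<omega> = \<omega> \<odot> K k"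
  by (simp add: K_def cl_mult_linear mul_assoc e_\<omega> Y_\<omega> Y_\<omega>_tail \<omega>_tail(3))

lemma Y_K: "Y \<odot> K k = K k \<odot> Y"
  by (simp add: K_def cl_mult_linear mul_assoc Y_sq_e)

lemma O2_expand: "O2 k = coef (L k) + (1/2) *\<^sub>C (\<omega> \<odot> e k) + \<omega> \<odot> (coef s \<odot> e k - \<epsilon> *\<^sub>C O1 k)"
proof -
  have "O1 (k + 1) \<odot> e (k + 2) - O1 (k + 2) \<odot> e (k + 1) = \<omega> \<odot> (coef s \<odot> e k - \<epsilon> *\<^sub>C O1 k)"
    using O1_e_cyc[of "k + 1"] exhaust_3[of k] by (auto simp: cyc_3)
  then show ?thesis by (simp add: O2_def flip: add_diff_eq)
qed

lemma coef_q: "coef q = - coef s - (1/2) *\<^sub>C 1"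
  by (simp add: q_def coef_linear)

text \<open>Both $L_k$ and the multiples of $e_k$ in \<open>O2_expand\<close> are absorbed by $\{Y, e_k\}$; in this
  form it is evident that the two-index symmetries commute with \<open>Y\<close>.\<close>

lemma O2_eq_K: "O2 k = - (1/2) *\<^sub>C (\<omega> \<odot> (K k + (2 * \<epsilon>) *\<^sub>C O1 k))"
proof -
  have "K k + (2 * \<epsilon>) *\<^sub>C O1 k = 2 *\<^sub>C (coef q \<odot> e k + \<epsilon> *\<^sub>C (\<omega> \<odot> coef (L k)) + \<epsilon> *\<^sub>C O1 k)"
    by (simp add: K_def e_Y_anticomm scaleC_add_right)
  then show ?thesis
    by (simp add: O2_expand coef_q cl_mult_linear mul_assoc \<omega>_tail(2) scaleC_dist eps)
qed

lemma e_Y_Y: "e k \<odot> (Y \<odot> (Y \<odot> b)) = Y \<odot> (Y \<odot> (e k \<odot> b))"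
  using mul_eq_tail[OF Y_sq_e, of k b] by (simp add: mul_assoc)

text \<open>The terms $Y e_{k+2} Y$ and $Y^2 e_{k+2}$ produced by \<open>e_Y_e_cyc\<close> cancel against those
  coming from $[e_k, e_{k+1}]$.\<close>

lemma K_comm: "K k \<odot> K (k + 1) - K (k + 1) \<odot> K k =
   (4 * \<epsilon>) *\<^sub>C (\<omega> \<odot> (Y \<odot> coef q \<odot> e (k + 2) + coef q \<odot> e (k + 2) \<odot> Y))"
proof -
  let ?X = "e k \<odot> Y \<odot> e (k + 1) - e (k + 1) \<odot> Y \<odot> e k"
  let ?Z = "e k \<odot> e (k + 1) - e (k + 1) \<odot> e k"
  have "K k \<odot> K (k + 1) - K (k + 1) \<odot> K k = Y \<odot> ?X + ?X \<odot> Y + Y \<odot> ?Z \<odot> Y + Y \<odot> (Y \<odot> ?Z)"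
    by (simp add: K_def cl_mult_linear mul_assoc e_Y_Y algebra_simps)
  also have "\<dots> = (4 * \<epsilon>) *\<^sub>C (\<omega> \<odot> (Y \<odot> coef q \<odot> e (k + 2) + coef q \<odot> e (k + 2) \<odot> Y))"
    unfolding e_Y_e_cyc e_cyc
    by (simp add: cl_mult_linear mul_assoc scaleC_linear Y_\<omega> Y_\<omega>_tail Y_sq_e algebra_simps)
  finally show ?thesis .
qed

lemma K_sq_sum: "K 1 \<odot> K 1 + K 2 \<odot> K 2 + K 3 \<odot> K 3 = (4 * \<epsilon>) *\<^sub>C (Y \<odot> coef q + coef q \<odot> Y + Y \<odot> Y)"
proof -
  let ?X = "e 1 \<odot> Y \<odot> e 1 + e 2 \<odot> Y \<odot> e 2 + e 3 \<odot> Y \<odot> e 3"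
  \<comment> \<open>The factor 6 is written as 2 + 4 because only even numerals are split.\<close>
  have "K 1 \<odot> K 1 + K 2 \<odot> K 2 + K 3 \<odot> K 3 = Y \<odot> ?X + ?X \<odot> Y + (2 * \<epsilon>) *\<^sub>C (Y \<odot> Y) + (4 * \<epsilon>) *\<^sub>C (Y \<odot> Y)"
    by (simp add: K_def cl_mult_linear mul_assoc e_Y_Y e_sq e_tail scaleC_linear algebra_simps)
  also have "\<dots> = (4 * \<epsilon>) *\<^sub>C (Y \<odot> coef q + coef q \<odot> Y + Y \<odot> Y)"
    unfolding e_Y_e_sum
    by (simp add: cl_mult_linear mul_assoc scaleC_linear algebra_simps)
  finally show ?thesis .
qed

definition O3 :: "'a cl3" where "O3 = - ((\<epsilon> / 2) *\<^sub>C (e 1 \<odot> e 2 \<odot> e 3)) - O1 1 \<odot> e 2 \<odot> e 3 - O1 2 \<odot> e 3 \<odot> e 1 - O1 3 \<odot> e 1 \<odot> e 2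
   + O2 3 \<odot> e 3 + O2 2 \<odot> e 2 + O2 1 \<odot> e 1"

lemma O3_eq_Y: "O3 = - \<epsilon> *\<^sub>C (\<omega> \<odot> (Y - (1/2) *\<^sub>C 1))"
proof -
  have 1: "\<omega> \<odot> e 1 \<odot> e 1 = \<epsilon> *\<^sub>C \<omega>" "\<omega> \<odot> e 2 \<odot> e 2 = \<epsilon> *\<^sub>C \<omega>" "\<omega> \<odot> e 3 \<odot> e 3 = \<epsilon> *\<^sub>C \<omega>"
    by (simp_all add: mul_assoc e_sq cl_mult_linear)
  have 2: "O2 k \<odot> e k = coef (L k) \<odot> e k + (\<epsilon> / 2) *\<^sub>C \<omega> + \<omega> \<odot> (\<epsilon> *\<^sub>C coef s - \<epsilon> *\<^sub>C (O1 k \<odot> e k))" for k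
    by (simp add: O2_expand cl_mult_linear scaleC_dist mul_assoc e_sq)
  have 3: "O1 1 \<odot> e 2 \<odot> e 3 = \<epsilon> *\<^sub>C (\<omega> \<odot> (O1 1 \<odot> e 1))" "O1 2 \<odot> e 3 \<odot> e 1 = \<epsilon> *\<^sub>C (\<omega> \<odot> (O1 2 \<odot> e 2))"
    "O1 3 \<odot> e 1 \<odot> e 2 = \<epsilon> *\<^sub>C (\<omega> \<odot> (O1 3 \<odot> e 3))"
    by (simp_all add: mul_assoc cl_table cl_mult_linear mul_eq_tail[OF O1_\<omega>])
  have 4: "O1 1 \<odot> e 1 = coef s - O1 2 \<odot> e 2 - O1 3 \<odot> e 3"
    by (simp flip: O1_e_sum)
  have "2 *\<^sub>C O3 = 2 *\<^sub>C (- \<epsilon> *\<^sub>C (\<omega> \<odot> (Y - (1/2) *\<^sub>C 1)))"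
    unfolding O3_def 2 3 4 \<omega>_def[symmetric] Y_def coef_q
    by (simp add: cl_mult_linear scaleC_dist coef_linear \<omega>_tail(2) eps_simps)
  then show ?thesis by (rule scaleC_cancel) simp
qed

text \<open>The three-index symmetry is central in the algebra of all symmetries.\<close>

lemma O3_O1: "O3 \<odot> O1 k = O1 k \<odot> O3"
  by (simp add: O3_eq_Y cl_mult_linear mul_assoc Y_O1 O1_\<omega> mul_eq_tail[OF O1_\<omega>])

lemma O3_K: "O3 \<odot> K k = K k \<odot> O3"
  by (simp add: O3_eq_Y cl_mult_linear mul_assoc Y_K K_\<omega> mul_eq_tail[OF K_\<omega>])

lemma O3_\<omega>: "O3 \<odot> \<omega> = \<omega> \<odot> O3"
  by (simp add: O3_eq_Y cl_mult_linear mul_assoc Y_\<omega>)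

lemma O3_O2: "O3 \<odot> O2 k = O2 k \<odot> O3"
  by (simp add: O2_eq_K cl_mult_linear mul_assoc O3_O1 O3_K mul_eq_tail[OF O3_\<omega>])

lemma O2_O2: "4 *\<^sub>C (O2 j \<odot> O2 k) = - \<epsilon> *\<^sub>C ((K j + (2 * \<epsilon>) *\<^sub>C O1 j) \<odot> (K k + (2 * \<epsilon>) *\<^sub>C O1 k))"
  by (simp add: O2_eq_K cl_mult_linear mul_assoc mul_eq_tail[OF K_\<omega>] mul_eq_tail[OF O1_\<omega>] \<omega>_tail(2) scaleC_dist eps_simps)

text \<open>Since \<open>Y\<close> commutes with $O_j$, the mixed terms $[\{Y, e_k\}, O_j]$ are
  anticommutators of \<open>Y\<close> with $[e_k, O_j]$, which \<open>O1_e_cyc\<close> evaluates. The contributions of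
  \<open>q\<close> and \<open>s\<close> then combine to $q + s = -1/2$ and leave a multiple of $\{Y, e_{k+2}\}$.\<close>

lemma O2_comm: "O2 k \<odot> O2 (k + 1) - O2 (k + 1) \<odot> O2 k =
    - O2 (k + 2) - 2 *\<^sub>C (O3 \<odot> O1 (k + 2)) - \<epsilon> *\<^sub>C (O1 k \<odot> O1 (k + 1) - O1 (k + 1) \<odot> O1 k)"
proof -
  let ?j = "k + 1" and ?l = "k + 2"
  let ?X = "\<omega> \<odot> (coef s \<odot> e ?l - \<epsilon> *\<^sub>C O1 ?l)"
  have "K k \<odot> O1 ?j - O1 ?j \<odot> K k + (O1 k \<odot> K ?j - K ?j \<odot> O1 k) =
      Y \<odot> (O1 k \<odot> e ?j - O1 ?j \<odot> e k + (e k \<odot> O1 ?j - e ?j \<odot> O1 k)) +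
      (O1 k \<odot> e ?j - O1 ?j \<odot> e k + (e k \<odot> O1 ?j - e ?j \<odot> O1 k)) \<odot> Y"
    by (simp add: K_def cl_mult_linear mul_assoc mul_eq_tail[OF Y_O1[symmetric]] Y_O1[symmetric] algebra_simps)
  also have "\<dots> = 2 *\<^sub>C (Y \<odot> ?X + ?X \<odot> Y)"
    by (simp add: O1_e_antisym[symmetric] O1_e_cyc cl_mult_add_left cl_mult_add_right scaleC_linear)
  finally have 1: "K k \<odot> O1 ?j - O1 ?j \<odot> K k + (O1 k \<odot> K ?j - K ?j \<odot> O1 k) = 2 *\<^sub>C (Y \<odot> ?X + ?X \<odot> Y)" .
  have "4 *\<^sub>C (O2 k \<odot> O2 ?j - O2 ?j \<odot> O2 k) = - \<epsilon> *\<^sub>C (K k \<odot> K ?j - K ?j \<odot> K k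
    + (2 * \<epsilon>) *\<^sub>C (K k \<odot> O1 ?j - O1 ?j \<odot> K k + (O1 k \<odot> K ?j - K ?j \<odot> O1 k)) +
     4 *\<^sub>C (O1 k \<odot> O1 ?j - O1 ?j \<odot> O1 k))"
    unfolding scaleC_diff_right O2_O2
    by (simp add: cl_mult_linear scaleC_dist eps_simps)
  also have "\<dots> = 2 *\<^sub>C (\<omega> \<odot> K ?l) + (8 * \<epsilon>) *\<^sub>C (\<omega> \<odot> (Y \<odot> O1 ?l))
      - (4 * \<epsilon>) *\<^sub>C (O1 k \<odot> O1 ?j - O1 ?j \<odot> O1 k)"
    unfolding K_comm 1 coef_q unfolding K_def
    by (simp add: cl_mult_linear mul_assoc scaleC_dist Y_\<omega>_tail Y_O1[symmetric] eps_simps)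
      (simp add: scaleC_linear algebra_simps)
  also have "\<dots> = 4 *\<^sub>C (- O2 ?l - 2 *\<^sub>C (O3 \<odot> O1 ?l) - \<epsilon> *\<^sub>C (O1 k \<odot> O1 ?j - O1 ?j \<odot> O1 k))"
    unfolding O3_eq_Y O2_eq_K
    by (simp add: cl_mult_linear mul_assoc scaleC_dist eps_simps)
  finally show ?thesis by (rule scaleC_cancel) simp
qed

text \<open>The Casimir relation: after expansion all terms are polynomials in \<open>Y\<close>, because
  $q + s = -1/2$ removes the remaining reflections.\<close>

lemma O2_sq_sum: "O2 1 \<odot> O2 1 + O2 2 \<odot> O2 2 + O2 3 \<odot> O2 3 =
    (1/4) *\<^sub>C 1 + \<epsilon> *\<^sub>C (O3 \<odot> O3) - \<epsilon> *\<^sub>C (O1 1 \<odot> O1 1 + O1 2 \<odot> O1 2 + O1 3 \<odot> O1 3)"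
proof -
  let ?S = "(O1 1 \<odot> e 1 + O1 2 \<odot> e 2 + O1 3 \<odot> e 3) + (e 1 \<odot> O1 1 + e 2 \<odot> O1 2 + e 3 \<odot> O1 3)"
  have "K 1 \<odot> O1 1 + K 2 \<odot> O1 2 + K 3 \<odot> O1 3 + (O1 1 \<odot> K 1 + O1 2 \<odot> K 2 + O1 3 \<odot> K 3) =
      Y \<odot> ?S + ?S \<odot> Y"
    by (simp add: K_def cl_mult_linear mul_assoc mul_eq_tail[OF Y_O1[symmetric]] Y_O1[symmetric] algebra_simps)
  also have "\<dots> = 2 *\<^sub>C (Y \<odot> coef s + coef s \<odot> Y)"
    unfolding O1_e_sum by (simp add: cl_mult_linear scaleC_linear)
  finally have 1: "K 1 \<odot> O1 1 + K 2 \<odot> O1 2 + K 3 \<odot> O1 3 + (O1 1 \<odot> K 1 + O1 2 \<odot> K 2 + O1 3 \<odot> K 3)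
     = 2 *\<^sub>C (Y \<odot> coef s + coef s \<odot> Y)" .
  have s: "coef s = - coef q - (1/2) *\<^sub>C 1"
    by (simp add: coef_q)
  have "4 *\<^sub>C (O2 1 \<odot> O2 1 + O2 2 \<odot> O2 2 + O2 3 \<odot> O2 3) = - \<epsilon> *\<^sub>C (K 1 \<odot> K 1 + K 2 \<odot> K 2 + K 3 \<odot> K 3 +
    (2 * \<epsilon>) *\<^sub>C (K 1 \<odot> O1 1 + K 2 \<odot> O1 2 + K 3 \<odot> O1 3 + (O1 1 \<odot> K 1 + O1 2 \<odot> K 2 + O1 3 \<odot> K 3)) +
     4 *\<^sub>C (O1 1 \<odot> O1 1 + O1 2 \<odot> O1 2 + O1 3 \<odot> O1 3))"
    unfolding scaleC_add_right O2_O2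
    by (simp add: cl_mult_linear scaleC_dist eps_simps)
  also have "\<dots> = 4 *\<^sub>C Y - 4 *\<^sub>C (Y \<odot> Y) - (4 * \<epsilon>) *\<^sub>C (O1 1 \<odot> O1 1 + O1 2 \<odot> O1 2 + O1 3 \<odot> O1 3)"
    unfolding K_sq_sum 1 s
    by (simp add: cl_mult_linear scaleC_dist eps_simps)
      (simp add: scaleC_linear algebra_simps)
  also have "\<dots> = 4 *\<^sub>C ((1/4) *\<^sub>C 1 + \<epsilon> *\<^sub>C (O3 \<odot> O3) - \<epsilon> *\<^sub>C (O1 1 \<odot> O1 1 + O1 2 \<odot> O1 2 + O1 3 \<odot> O1 3))"
    unfolding O3_eq_Y
    by (simp add: cl_mult_linear mul_assoc scaleC_dist Y_\<omega> Y_\<omega>_tail \<omega>_sq \<omega>_tail(2) eps_simps)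
      (simp add: scaleC_linear algebra_simps)
  finally show ?thesis by (rule scaleC_cancel) simp
qed

text \<open>Relations between $O_k$ and the two-index symmetries reduce to relations between $O_k$ and
  the generators, since $O_k$ commutes with \<open>Y\<close>.\<close>

lemma K_O1_anticomm:
  "K j \<odot> O1 k + O1 k \<odot> K j = Y \<odot> (e j \<odot> O1 k + O1 k \<odot> e j) + (e j \<odot> O1 k + O1 k \<odot> e j) \<odot> Y"
  by (simp add: K_def cl_mult_linear mul_assoc mul_eq_tail[OF Y_O1[symmetric]] Y_O1[symmetric] algebra_simps)

lemma O2_O1_anticomm: "O2 j \<odot> O1 k + O1 k \<odot> O2 j = - (1/2) *\<^sub>C (\<omega> \<odot> (K j \<odot> O1 k + O1 k \<odot> K j + (2 * \<epsilon>) *\<^sub>C (O1 j \<odot> O1 k + O1 k \<odot> O1 j)))"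
  by (simp add: O2_eq_K cl_mult_linear mul_assoc mul_eq_tail[OF O1_\<omega>] scaleC_dist)

lemma O2_O1_comm: "O2 j \<odot> O1 k - O1 k \<odot> O2 j = - (1/2) *\<^sub>C (\<omega> \<odot> (K j \<odot> O1 k - O1 k \<odot> K j + (2 * \<epsilon>) *\<^sub>C (O1 j \<odot> O1 k - O1 k \<odot> O1 j)))"
  by (simp add: O2_eq_K cl_mult_linear mul_assoc mul_eq_tail[OF O1_\<omega>] scaleC_dist)

lemma O2_O1_sym: "O2 j \<odot> O1 k + O1 k \<odot> O2 j = O2 k \<odot> O1 j + O1 j \<odot> O2 k"
proof -
  have 1: "e j \<odot> O1 k + O1 k \<odot> e j = e k \<odot> O1 j + O1 j \<odot> e k"
    using O1_e_antisym[of j k] by (simp add: algebra_simps)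
  show ?thesis
    unfolding O2_O1_anticomm K_O1_anticomm 1 by (simp add: add.commute)
qed

end

text \<open>The situation of a reflection group that is a product of a group acting on the first two
  coordinates and the group generated by the reflection along the third axis.\<close>

locale axial_angular_algebra = angular_algebra \<epsilon> L C s q
  for \<epsilon> and L :: "3 \<Rightarrow> 'a::complex_alg" and C s q +
  assumes C_axial: "C 1 3 = 0" "C 2 3 = 0" and C_33: "C 3 3 * C j k = C j k * C 3 3"
begin

lemma C_axial': "C 3 1 = 0" "C 3 2 = 0"
  using C_axial C_sym by metis+

lemma O1_axial_anticomm:
  "O1 3 \<odot> O1 1 = - (O1 1 \<odot> O1 3)" "O1 3 \<odot> O1 2 = - (O1 2 \<odot> O1 3)"
  "e 3 \<odot> O1 1 + O1 1 \<odot> e 3 = 0" "e 3 \<odot> O1 2 + O1 2 \<odot> e 3 = 0"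
  "e 1 \<odot> O1 3 + O1 3 \<odot> e 1 = 0" "e 2 \<odot> O1 3 + O1 3 \<odot> e 2 = 0"
  by (simp_all add: O1_def C_axial C_axial' coef_linear cl_normal C_33)

lemma O2_O1_axial_anticomm:
  "O2 3 \<odot> O1 1 = - (O1 1 \<odot> O2 3)" "O2 3 \<odot> O1 2 = - (O1 2 \<odot> O2 3)"
  "O2 1 \<odot> O1 3 = - (O1 3 \<odot> O2 1)" "O2 2 \<odot> O1 3 = - (O1 3 \<odot> O2 2)"
  unfolding eq_neg_iff_add_eq_0 O2_O1_anticomm K_O1_anticomm
  by (simp_all add: O1_axial_anticomm cl_mult_linear)

lemma O2_O1_axial_comm: "O2 3 \<odot> O1 3 = O1 3 \<odot> O2 3"
proof -
  have "e 3 \<odot> O1 3 = O1 3 \<odot> e 3"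
    by (simp add: O1_def C_axial coef_linear cl_normal)
  from this[symmetric] have "K 3 \<odot> O1 3 = O1 3 \<odot> K 3"
    by (simp add: K_def cl_mult_linear mul_assoc mul_eq_tail[OF Y_O1[symmetric]] Y_O1[symmetric]
        mul_eq_tail[OF \<open>O1 3 \<odot> e 3 = e 3 \<odot> O1 3\<close>])
  then have "O2 3 \<odot> O1 3 - O1 3 \<odot> O2 3 = 0"
    unfolding O2_O1_comm by (simp add: cl_mult_linear)
  then show ?thesis by simp
qed

text \<open>Here $[O_1, e_1] + [O_2, e_2]$ vanishes: up to the factor $\varepsilon$, its two contributions are
  $C_{21} [e_2, e_1]$ and
  $C_{12} [e_1, e_2]$, as $C_{31} = C_{32} = 0$.\<close>

lemma O2_O1_planar: "O2 1 \<odot> O1 1 + O2 2 \<odot> O1 2 = O1 1 \<odot> O2 1 + O1 2 \<odot> O2 2"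
proof -
  let ?Z = "e 1 \<odot> O1 1 - O1 1 \<odot> e 1 + (e 2 \<odot> O1 2 - O1 2 \<odot> e 2)"
  have Z: "?Z = 0"
    by (simp add: O1_def C_axial' C_sym[of 2 1] coef_linear cl_normal algebra_simps)
  have "K 1 \<odot> O1 1 - O1 1 \<odot> K 1 + (K 2 \<odot> O1 2 - O1 2 \<odot> K 2) = Y \<odot> ?Z + ?Z \<odot> Y"
    by (simp add: K_def cl_mult_linear mul_assoc mul_eq_tail[OF Y_O1[symmetric]] Y_O1[symmetric] algebra_simps)
  then have "O2 1 \<odot> O1 1 - O1 1 \<odot> O2 1 + (O2 2 \<odot> O1 2 - O1 2 \<odot> O2 2) = 0"
    unfolding O2_O1_comm scaleC_add_right[symmetric] cl_mult_add_right[symmetric] Z by (simp add: cl_mult_linear algebra_simps)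
  then show ?thesis by (simp add: algebra_simps)
qed

end

section \<open>Ladder operators\<close>

context clifford_sign begin

text \<open>Moving \<open>H\<close> to the left gives \<open>Lp = (H - 1/2) Op - \<epsilon> P Tp\<close> and
  \<open>Lm = (H + 1/2) Om - \<epsilon> P' Tm\<close>. In the product the mixed terms are multiples of
  \<open>Tp Om + Op Tm\<close>, which is zero, and \<open>(H - 1/2)\<^sup>2 Op Om + P\<^sup>2 Tp Tm\<close> remains; inserting
  \<open>Op_Om\<close> factors it.\<close>

lemma ladder_raising:
  fixes H Op Om Tp Tm P P' :: "'a::complex_alg cl3"
  assumes PH: "P \<odot> H = H \<odot> P" and P'H: "P' \<odot> H = H \<odot> P'" and TH: "Tp \<odot> H = - (H \<odot> Tp)"
    and Op_H: "Op \<odot> H = H \<odot> Op - Op - (2 * \<epsilon>) *\<^sub>C (P \<odot> Tp)"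
    and Om_H: "Om \<odot> H = H \<odot> Om + Om - (2 * \<epsilon>) *\<^sub>C (P' \<odot> Tm)"
    and Op_P': "Op \<odot> P' = P \<odot> Op" and Tp_P': "Tp \<odot> P' = P \<odot> Tp"
    and Tp_Om: "Tp \<odot> Om = - (Op \<odot> Tm)"
    and Op_Om: "Op \<odot> Om = - ((H - (1/2) *\<^sub>C 1) \<odot> (H - (1/2) *\<^sub>C 1) + \<epsilon> *\<^sub>C (P \<odot> P) - \<epsilon> *\<^sub>C (Tp \<odot> Tm))"
  defines "Lp \<equiv> (1/2) *\<^sub>C (H \<odot> Op + Op \<odot> H)" and "Lm \<equiv> (1/2) *\<^sub>C (H \<odot> Om + Om \<odot> H)"
  shows "H \<odot> Lp - Lp \<odot> H = Lp"
    and "Lp \<odot> Lm = - (((H - (1/2) *\<^sub>C 1) \<odot> (H - (1/2) *\<^sub>C 1) + \<epsilon> *\<^sub>C (P \<odot> P)) \<odot>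
        ((H - (1/2) *\<^sub>C 1) \<odot> (H - (1/2) *\<^sub>C 1) - \<epsilon> *\<^sub>C (Tp \<odot> Tm)))"
proof -
  define h where "h = H - (1/2) *\<^sub>C 1"
  have H: "H = h + (1/2) *\<^sub>C 1" by (simp add: h_def)
  have Ph: "P \<odot> h = h \<odot> P" using PH by (simp add: h_def cl_mult_linear)
  have Lp: "Lp = h \<odot> Op - \<epsilon> *\<^sub>C (P \<odot> Tp)"
  proof -
    have "H \<odot> Op + Op \<odot> H = 2 *\<^sub>C (h \<odot> Op - \<epsilon> *\<^sub>C (P \<odot> Tp))"
      unfolding Op_H by (simp add: h_def cl_mult_linear scaleC_dist) (simp add: scaleC_linear algebra_simps)
    then show ?thesis by (simp add: Lp_def)
  qed
  have Lm: "Lm = h \<odot> Om + Om - \<epsilon> *\<^sub>C (P' \<odot> Tm)"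
  proof -
    have "H \<odot> Om + Om \<odot> H = 2 *\<^sub>C (h \<odot> Om + Om - \<epsilon> *\<^sub>C (P' \<odot> Tm))"
      unfolding Om_H by (simp add: h_def cl_mult_linear scaleC_dist) (simp add: scaleC_linear algebra_simps)
    then show ?thesis by (simp add: Lm_def)
  qed
  have Op_h: "Op \<odot> h = h \<odot> Op - Op - (2 * \<epsilon>) *\<^sub>C (P \<odot> Tp)"
    using Op_H by (simp add: H cl_mult_linear algebra_simps)
  have Tp_h: "Tp \<odot> h = - (h \<odot> Tp) - Tp"
  proof -
    have "Tp \<odot> h = - (H \<odot> Tp) - (1/2) *\<^sub>C Tp" using TH by (simp add: h_def cl_mult_linear)
    also have "\<dots> = - (h \<odot> Tp) - ((1/2) *\<^sub>C Tp + (1/2) *\<^sub>C Tp)" by (simp add: H cl_mult_linear)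
    finally show ?thesis by (simp flip: scaleC_add_left)
  qed
  show "H \<odot> Lp - Lp \<odot> H = Lp"
    unfolding Lp H
    by (simp add: cl_mult_linear mul_assoc Op_h Tp_h Ph mul_eq_tail[OF Ph] scaleC_linear algebra_simps)
  have "Lp \<odot> Lm = h \<odot> (h \<odot> (Op \<odot> Om)) + P \<odot> (P \<odot> (Tp \<odot> Tm))"
    unfolding Lp Lm
    by (simp add: cl_mult_linear mul_assoc mul_eq_tail[OF Op_h] mul_eq_tail[OF Tp_h] mul_eq_tail[OF Op_P']
       mul_eq_tail[OF Tp_P'] Tp_Om mul_eq_tail[OF Ph] scaleC_linear eps eps_eps algebra_simps)
  then show "Lp \<odot> Lm = - (((H - (1/2) *\<^sub>C 1) \<odot> (H - (1/2) *\<^sub>C 1) + \<epsilon> *\<^sub>C (P \<odot> P)) \<odot>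
        ((H - (1/2) *\<^sub>C 1) \<odot> (H - (1/2) *\<^sub>C 1) - \<epsilon> *\<^sub>C (Tp \<odot> Tm)))"
    unfolding Op_Om h_def[symmetric]
    by (simp add: cl_mult_linear mul_assoc Ph mul_eq_tail[OF Ph] scaleC_linear eps eps_eps algebra_simps)
qed

end

context axial_angular_algebra begin

text \<open>\<open>H\<close>, \<open>Op\<close>, \<open>Om\<close> are $O_0$, $O_+$, $O_-$.\<close>

definition "H = (- \<i>) *\<^sub>C O2 3"
definition "Op = \<i> *\<^sub>C O2 2 + O2 1"
definition "Om = \<i> *\<^sub>C O2 2 - O2 1"
definition "T0 = \<i> *\<^sub>C O1 3"
definition "Tp = O1 1 + \<i> *\<^sub>C O1 2"
definition "Tm = O1 1 - \<i> *\<^sub>C O1 2"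

lemma O2_comms:
  "O2 1 \<odot> O2 2 = O2 2 \<odot> O2 1 - O2 3 - 2 *\<^sub>C (O3 \<odot> O1 3) - \<epsilon> *\<^sub>C (O1 1 \<odot> O1 2 - O1 2 \<odot> O1 1)"
  "O2 2 \<odot> O2 3 = O2 3 \<odot> O2 2 - O2 1 - 2 *\<^sub>C (O3 \<odot> O1 1) - (2 * \<epsilon>) *\<^sub>C (O1 2 \<odot> O1 3)"
  "O2 1 \<odot> O2 3 = O2 3 \<odot> O2 1 + O2 2 + 2 *\<^sub>C (O3 \<odot> O1 2) - (2 * \<epsilon>) *\<^sub>C (O1 1 \<odot> O1 3)"
  using O2_comm[of 1] O2_comm[of 2] O2_comm[of 3]
  by (simp_all add: cyc_3 O1_axial_anticomm scaleC_linear algebra_simps)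

lemma H_relations:
  "(\<epsilon> *\<^sub>C O3 + T0) \<odot> H = H \<odot> (\<epsilon> *\<^sub>C O3 + T0)" "(\<epsilon> *\<^sub>C O3 - T0) \<odot> H = H \<odot> (\<epsilon> *\<^sub>C O3 - T0)"
  "Tp \<odot> H = - (H \<odot> Tp)" "Tm \<odot> H = - (H \<odot> Tm)"
  by (simp_all add: H_def T0_def Tp_def Tm_def cl_mult_linear O3_O2 O2_O1_axial_comm O2_O1_axial_anticomm scaleC_dist eps_i)

lemma Op_H: "Op \<odot> H = H \<odot> Op - Op - (2 * \<epsilon>) *\<^sub>C ((\<epsilon> *\<^sub>C O3 + T0) \<odot> Tp)"
  by (simp add: Op_def H_def T0_def Tp_def cl_mult_linear O2_comms O1_axial_anticomm scaleC_dist eps_simps)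
    (simp add: scaleC_linear eps eps_eps algebra_simps)

lemma Om_H: "Om \<odot> H = H \<odot> Om + Om - (2 * \<epsilon>) *\<^sub>C ((\<epsilon> *\<^sub>C O3 - T0) \<odot> Tm)"
  by (simp add: Om_def H_def T0_def Tm_def cl_mult_linear O2_comms O1_axial_anticomm scaleC_dist eps_simps)
    (simp add: scaleC_linear eps eps_eps algebra_simps)

lemma P_swaps:
  "Op \<odot> (\<epsilon> *\<^sub>C O3 - T0) = (\<epsilon> *\<^sub>C O3 + T0) \<odot> Op" "Om \<odot> (\<epsilon> *\<^sub>C O3 + T0) = (\<epsilon> *\<^sub>C O3 - T0) \<odot> Om"
  "Tp \<odot> (\<epsilon> *\<^sub>C O3 - T0) = (\<epsilon> *\<^sub>C O3 + T0) \<odot> Tp" "Tm \<odot> (\<epsilon> *\<^sub>C O3 + T0) = (\<epsilon> *\<^sub>C O3 - T0) \<odot> Tm"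
  by (simp_all add: Op_def Om_def T0_def Tp_def Tm_def cl_mult_linear O3_O2 O3_O1 O2_O1_axial_anticomm O1_axial_anticomm scaleC_dist eps_i)

text \<open>Both sides are combinations of $O_1 O_{23} + O_2 O_{31}$ and $O_1 O_{31} - O_2 O_{23}$; under
  reversal of the factors the first is preserved by \<open>O2_O1_planar\<close> and the second changes sign
  by \<open>O2_O1_sym\<close>.\<close>

lemma T_O_swap: "Tp \<odot> Om = - (Op \<odot> Tm)" "Tm \<odot> Op = - (Om \<odot> Tp)"
proof -
  have 1: "O2 1 \<odot> O1 1 = O1 1 \<odot> O2 1 + O1 2 \<odot> O2 2 - O2 2 \<odot> O1 2"
    using O2_O1_planar by (simp add: algebra_simps)
  have 2: "O2 2 \<odot> O1 1 = O2 1 \<odot> O1 2 + O1 2 \<odot> O2 1 - O1 1 \<odot> O2 2"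
    using O2_O1_sym[of 2 1] by (simp add: algebra_simps)
  show "Tp \<odot> Om = - (Op \<odot> Tm)" "Tm \<odot> Op = - (Om \<odot> Tp)"
    by (simp_all add: Op_def Om_def Tp_def Tm_def cl_mult_linear 1 2 scaleC_dist)
qed

text \<open>The squares in these products are $- O_{31}^2 - O_{23}^2$, which \<open>O2_sq_sum\<close> expresses by
  $O_{12}^2$, and the mixed terms form a commutator, which \<open>O2_comm\<close> evaluates.\<close>

lemma Op_Om_products:
  "Op \<odot> Om = - ((H - (1/2) *\<^sub>C 1) \<odot> (H - (1/2) *\<^sub>C 1) + \<epsilon> *\<^sub>C ((\<epsilon> *\<^sub>C O3 + T0) \<odot> (\<epsilon> *\<^sub>C O3 + T0)) - \<epsilon> *\<^sub>C (Tp \<odot> Tm))"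
  "Om \<odot> Op = - ((H + (1/2) *\<^sub>C 1) \<odot> (H + (1/2) *\<^sub>C 1) + \<epsilon> *\<^sub>C ((\<epsilon> *\<^sub>C O3 - T0) \<odot> (\<epsilon> *\<^sub>C O3 - T0)) - \<epsilon> *\<^sub>C (Tm \<odot> Tp))"
proof -
  have 1: "O2 1 \<odot> O2 1 = (1/4) *\<^sub>C 1 + \<epsilon> *\<^sub>C (O3 \<odot> O3) - \<epsilon> *\<^sub>C (O1 1 \<odot> O1 1 + O1 2 \<odot> O1 2 + O1 3 \<odot> O1 3)
    - O2 2 \<odot> O2 2 - O2 3 \<odot> O2 3"
    using O2_sq_sum by (simp add: algebra_simps)
  have "4 *\<^sub>C (Op \<odot> Om) = 4 *\<^sub>C (- ((H - (1/2) *\<^sub>C 1) \<odot> (H - (1/2) *\<^sub>C 1) + \<epsilon> *\<^sub>C ((\<epsilon> *\<^sub>C O3 + T0) \<odot> (\<epsilon> *\<^sub>C O3 + T0)) - \<epsilon> *\<^sub>C (Tp \<odot> Tm)))"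
    "4 *\<^sub>C (Om \<odot> Op) = 4 *\<^sub>C (- ((H + (1/2) *\<^sub>C 1) \<odot> (H + (1/2) *\<^sub>C 1) + \<epsilon> *\<^sub>C ((\<epsilon> *\<^sub>C O3 - T0) \<odot> (\<epsilon> *\<^sub>C O3 - T0)) - \<epsilon> *\<^sub>C (Tm \<odot> Tp)))"
    by (simp_all add: Op_def Om_def H_def T0_def Tp_def Tm_def cl_mult_linear O2_comms 1 O3_O1[symmetric] scaleC_dist eps_simps)
      (simp_all add: scaleC_linear eps eps_eps algebra_simps)
  then show "Op \<odot> Om = - ((H - (1/2) *\<^sub>C 1) \<odot> (H - (1/2) *\<^sub>C 1) + \<epsilon> *\<^sub>C ((\<epsilon> *\<^sub>C O3 + T0) \<odot> (\<epsilon> *\<^sub>C O3 + T0)) - \<epsilon> *\<^sub>C (Tp \<odot> Tm))"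
  "Om \<odot> Op = - ((H + (1/2) *\<^sub>C 1) \<odot> (H + (1/2) *\<^sub>C 1) + \<epsilon> *\<^sub>C ((\<epsilon> *\<^sub>C O3 - T0) \<odot> (\<epsilon> *\<^sub>C O3 - T0)) - \<epsilon> *\<^sub>C (Tm \<odot> Tp))"
    by (auto dest!: scaleC_cancel)
qed

lemmas ladder_up = ladder_raising[OF H_relations(1,2,3) Op_H Om_H P_swaps(1,3) T_O_swap(1) Op_Om_products(1)]

text \<open>The hypotheses of \<open>ladder_raising\<close> are invariant under changing the sign of \<open>H\<close>,
  exchanging \<open>Op\<close> with \<open>Om\<close> and \<open>Tp\<close> with \<open>Tm\<close>, and replacing $(P, P')$ by
  $(-P', -P)$. This turns the raising operator into minus the lowering operator.\<close>

lemma ladder_down: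
  "H \<odot> ((1/2) *\<^sub>C (H \<odot> Om + Om \<odot> H)) - ((1/2) *\<^sub>C (H \<odot> Om + Om \<odot> H)) \<odot> H = - ((1/2) *\<^sub>C (H \<odot> Om + Om \<odot> H))"
  "((1/2) *\<^sub>C (H \<odot> Om + Om \<odot> H)) \<odot> ((1/2) *\<^sub>C (H \<odot> Op + Op \<odot> H)) =
    - (((H + (1/2) *\<^sub>C 1) \<odot> (H + (1/2) *\<^sub>C 1) + \<epsilon> *\<^sub>C ((\<epsilon> *\<^sub>C O3 - T0) \<odot> (\<epsilon> *\<^sub>C O3 - T0))) \<odot>
        ((H + (1/2) *\<^sub>C 1) \<odot> (H + (1/2) *\<^sub>C 1) - \<epsilon> *\<^sub>C (Tm \<odot> Tp)))"
proof -
  let ?P = "\<epsilon> *\<^sub>C O3 + T0" and ?P' = "\<epsilon> *\<^sub>C O3 - T0"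
  have neg: "- H - (1/2) *\<^sub>C 1 = - (H + (1/2) *\<^sub>C 1)" by simp
  have sq: "(- H - (1/2) *\<^sub>C 1) \<odot> (- H - (1/2) *\<^sub>C 1) = (H + (1/2) *\<^sub>C 1) \<odot> (H + (1/2) *\<^sub>C 1)"
    "(- ?P') \<odot> (- ?P') = ?P' \<odot> ?P'"
    unfolding neg cl_mult_minus_left cl_mult_minus_right minus_minus by (rule refl)+
  have "(- ?P') \<odot> (- H) = (- H) \<odot> (- ?P')" "(- ?P) \<odot> (- H) = (- H) \<odot> (- ?P)" "Tm \<odot> (- H) = - ((- H) \<odot> Tm)"
    using H_relations by (simp_all only: cl_mult_minus_left cl_mult_minus_right)
  moreover have "Om \<odot> (- H) = (- H) \<odot> Om - Om - (2 * \<epsilon>) *\<^sub>C ((- ?P') \<odot> Tm)"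
    "Op \<odot> (- H) = (- H) \<odot> Op + Op - (2 * \<epsilon>) *\<^sub>C ((- ?P) \<odot> Tp)"
    unfolding cl_mult_minus_left cl_mult_minus_right Op_H Om_H by simp_all
  moreover have "Om \<odot> (- ?P) = (- ?P') \<odot> Om" "Tm \<odot> (- ?P) = (- ?P') \<odot> Tm"
    using P_swaps by (simp_all only: cl_mult_minus_left cl_mult_minus_right)
  moreover have "Om \<odot> Op = - ((- H - (1/2) *\<^sub>C 1) \<odot> (- H - (1/2) *\<^sub>C 1) + \<epsilon> *\<^sub>C ((- ?P') \<odot> (- ?P')) - \<epsilon> *\<^sub>C (Tm \<odot> Tp))"
    unfolding sq by (rule Op_Om_products)
  ultimately have
    "(- H) \<odot> ((1/2) *\<^sub>C ((- H) \<odot> Om + Om \<odot> (- H))) - ((1/2) *\<^sub>C ((- H) \<odot> Om + Om \<odot> (- H))) \<odot> (- H) = (1/2) *\<^sub>C ((- H) \<odot> Om + Om \<odot> (- H))"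
    "((1/2) *\<^sub>C ((- H) \<odot> Om + Om \<odot> (- H))) \<odot> ((1/2) *\<^sub>C ((- H) \<odot> Op + Op \<odot> (- H))) =
     - (((- H - (1/2) *\<^sub>C 1) \<odot> (- H - (1/2) *\<^sub>C 1) + \<epsilon> *\<^sub>C ((- ?P') \<odot> (- ?P'))) \<odot>
        ((- H - (1/2) *\<^sub>C 1) \<odot> (- H - (1/2) *\<^sub>C 1) - \<epsilon> *\<^sub>C (Tm \<odot> Tp)))"
    using ladder_raising[where H = "- H" and Op = Om and Om = Op and P = "- ?P'" and P' = "- ?P" and Tp = Tm and Tm = Tp, OF _ _ _ _ _ _ _ T_O_swap(2)]
    by blast+
  moreover have n: "(1/2) *\<^sub>C ((- H) \<odot> A + A \<odot> (- H)) = - ((1/2) *\<^sub>C (H \<odot> A + A \<odot> H))" for A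
    by (simp add: cl_mult_linear scaleC_dist)
  ultimately show "H \<odot> ((1/2) *\<^sub>C (H \<odot> Om + Om \<odot> H)) - ((1/2) *\<^sub>C (H \<odot> Om + Om \<odot> H)) \<odot> H = - ((1/2) *\<^sub>C (H \<odot> Om + Om \<odot> H))"
    "((1/2) *\<^sub>C (H \<odot> Om + Om \<odot> H)) \<odot> ((1/2) *\<^sub>C (H \<odot> Op + Op \<odot> H)) =
    - (((H + (1/2) *\<^sub>C 1) \<odot> (H + (1/2) *\<^sub>C 1) + \<epsilon> *\<^sub>C ((\<epsilon> *\<^sub>C O3 - T0) \<odot> (\<epsilon> *\<^sub>C O3 - T0))) \<odot>
        ((H + (1/2) *\<^sub>C 1) \<odot> (H + (1/2) *\<^sub>C 1) - \<epsilon> *\<^sub>C (Tm \<odot> Tp)))"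
    unfolding n sq by (simp_all only: cl_mult_minus_left cl_mult_minus_right minus_minus)
qed

end

section \<open>Angular momenta from commutation relations of Dunkl operators\<close>

abbreviation coord :: "real^3 \<Rightarrow> 3 \<Rightarrow> complex" where "coord \<alpha> k \<equiv> complex_of_real (\<alpha> $ k)"

text \<open>The set \<open>P\<close> consists of the positive roots, normalised to unit length, and \<open>\<sigma> \<alpha>\<close> is
  the reflection along \<open>\<alpha>\<close>. Commutativity of the \<open>D j\<close> is assumed only in the next
  locale, because its proof for polynomials uses the relations listed here.\<close>

locale dunkl_exchange =
  fixes x D :: "3 \<Rightarrow> 'a::complex_alg" and \<sigma> :: "real^3 \<Rightarrow> 'a" and P :: "(real^3) set" and \<kappa> :: "real^3 \<Rightarrow> complex"
    and S :: 'a and C :: "3 \<Rightarrow> 3 \<Rightarrow> 'a"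
  assumes unit: "\<alpha> \<in> P \<Longrightarrow> \<alpha> \<bullet> \<alpha> = 1"
    and x_x: "x j * x k = x k * x j"
    and D_x: "D j * x k - x k * D j = (if j = k then 1 else 0) + 2 *\<^sub>C C j k"
    and \<sigma>_x: "\<alpha> \<in> P \<Longrightarrow> \<sigma> \<alpha> * x k = (x k - (2 * coord \<alpha> k) *\<^sub>C (\<Sum>l\<in>UNIV. coord \<alpha> l *\<^sub>C x l)) * \<sigma> \<alpha>"
    and \<sigma>_D: "\<alpha> \<in> P \<Longrightarrow> \<sigma> \<alpha> * D k = (D k - (2 * coord \<alpha> k) *\<^sub>C (\<Sum>l\<in>UNIV. coord \<alpha> l *\<^sub>C D l)) * \<sigma> \<alpha>"
    and \<sigma>_S: "\<alpha> \<in> P \<Longrightarrow> \<sigma> \<alpha> * S = S * \<sigma> \<alpha>"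
    and S_def: "S = (\<Sum>\<alpha>\<in>P. \<kappa> \<alpha> *\<^sub>C \<sigma> \<alpha>)"
    and C_def: "C j k = (\<Sum>\<alpha>\<in>P. (\<kappa> \<alpha> * coord \<alpha> j * coord \<alpha> k) *\<^sub>C \<sigma> \<alpha>)"
begin

lemma \<sigma>_D_comm:
  assumes "\<alpha> \<in> P"
  shows "D j * \<sigma> \<alpha> - \<sigma> \<alpha> * D j = (2 * coord \<alpha> j) *\<^sub>C ((\<Sum>l\<in>UNIV. coord \<alpha> l *\<^sub>C D l) * \<sigma> \<alpha>)"
  unfolding \<sigma>_D[OF assms] by (simp add: algebra_simps)

text \<open>The contribution of a root to the left hand side is proportional to
  $\alpha_j \alpha_k \alpha_l D_\alpha \sigma_\alpha$, which is symmetric in $j$, $k$, $l$.\<close>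

lemma D_C_comm: "D j * C k l - C k l * D j = D k * C j l - C j l * D k"
proof -
  have "D j * C k l - C k l * D j =
    (\<Sum>\<alpha>\<in>P. (2 * \<kappa> \<alpha> * coord \<alpha> j * coord \<alpha> k * coord \<alpha> l) *\<^sub>C ((\<Sum>l\<in>UNIV. coord \<alpha> l *\<^sub>C D l) * \<sigma> \<alpha>))" for j k
  proof -
    have "D j * C k l - C k l * D j = (\<Sum>\<alpha>\<in>P. (\<kappa> \<alpha> * coord \<alpha> k * coord \<alpha> l) *\<^sub>C (D j * \<sigma> \<alpha> - \<sigma> \<alpha> * D j))"
      by (simp add: C_def sum_distrib_left sum_distrib_right scaleC_diff_right sum_subtractf)
    then show ?thesis by (simp add: \<sigma>_D_comm mult_ac cong: sum.cong)
  qed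
  from this[of j k] this[of k j] show ?thesis by (simp add: mult_ac)
qed

text \<open>This is the Jacobi identity combined with \<open>D_C_comm\<close>.\<close>

lemma D_D_comm_x: "(D j * D k - D k * D j) * x l = x l * (D j * D k - D k * D j)"
proof -
  define E where "E j = D j * x l - x l * D j" for j
  have E: "D j * E k - E k * D j = D k * E j - E j * D k"
    using D_C_comm[of j k l] by (simp add: E_def D_x algebra_simps flip: scaleC_add_right)
  have "(D j * D k - D k * D j) * x l - x l * (D j * D k - D k * D j) =
    (D j * E k - E k * D j) - (D k * E j - E j * D k)"
    by (simp add: E_def algebra_simps)
  with E show ?thesis by simp
qed

end

locale dunkl_commutation = dunkl_exchange +
  assumes D_D: "D j * D k = D k * D j"
begin

definition L :: "3 \<Rightarrow> 'a" where "L k = x (k + 1) * D (k + 2) - x (k + 2) * D (k + 1)"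
definition L_dir :: "real^3 \<Rightarrow> 'a" where "L_dir \<alpha> = (\<Sum>k\<in>UNIV. coord \<alpha> k *\<^sub>C L k)"

lemma coord_sq:
  assumes "\<alpha> \<in> P"
  shows "coord \<alpha> k * coord \<alpha> k + coord \<alpha> (k + 1) * coord \<alpha> (k + 1) + coord \<alpha> (k + 2) * coord \<alpha> (k + 2) = 1"
proof -
  have "\<alpha> $ k * \<alpha> $ k + \<alpha> $ (k + 1) * \<alpha> $ (k + 1) + \<alpha> $ (k + 2) * \<alpha> $ (k + 2) = 1"
    using unit[OF assms] unfolding inner_vec_def inner_real_def sum_cyc[of _ k] .
  from arg_cong[OF this, of complex_of_real] show ?thesis by simp
qed

text \<open>Angular momentum is a pseudovector: a reflection preserves its component along the root and
  changes the sign of the orthogonal components.\<close>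

lemma \<sigma>_L:
  assumes "\<alpha> \<in> P"
  shows "\<sigma> \<alpha> * L k = ((2 * coord \<alpha> k) *\<^sub>C L_dir \<alpha> - L k) * \<sigma> \<alpha>"
proof -
  define X where "X = (\<Sum>l\<in>UNIV. coord \<alpha> l *\<^sub>C x l)"
  define Y where "Y = (\<Sum>l\<in>UNIV. coord \<alpha> l *\<^sub>C D l)"
  let ?i = "k + 1" and ?j = "k + 2"
  let ?a = "coord \<alpha> ?i" and ?b = "coord \<alpha> ?j" and ?c = "coord \<alpha> k"
  have X: "X = ?c *\<^sub>C x k + ?a *\<^sub>C x ?i + ?b *\<^sub>C x ?j" and Y: "Y = ?c *\<^sub>C D k + ?a *\<^sub>C D ?i + ?b *\<^sub>C D ?j"
    by (simp_all add: X_def Y_def sum_cyc[of _ k])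
  have sx: "\<sigma> \<alpha> * x l = (x l - (2 * coord \<alpha> l) *\<^sub>C X) * \<sigma> \<alpha>" for l
    using \<sigma>_x[OF assms] by (simp add: X_def)
  have sD: "\<sigma> \<alpha> * D l = (D l - (2 * coord \<alpha> l) *\<^sub>C Y) * \<sigma> \<alpha>" for l
    using \<sigma>_D[OF assms] by (simp add: Y_def)
  have sxD: "\<sigma> \<alpha> * (x l * D n) = (x l - (2 * coord \<alpha> l) *\<^sub>C X) * (D n - (2 * coord \<alpha> n) *\<^sub>C Y) * \<sigma> \<alpha>" for l n
    unfolding mult.assoc[symmetric] sx unfolding mult.assoc sD by (rule refl)
  have "\<sigma> \<alpha> * L k = ((x ?i - (2 * ?a) *\<^sub>C X) * (D ?j - (2 * ?b) *\<^sub>C Y) -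
     (x ?j - (2 * ?b) *\<^sub>C X) * (D ?i - (2 * ?a) *\<^sub>C Y)) * \<sigma> \<alpha>"
    unfolding L_def by (simp only: right_diff_distrib left_diff_distrib sxD)
  also have "(x ?i - (2 * ?a) *\<^sub>C X) * (D ?j - (2 * ?b) *\<^sub>C Y) - (x ?j - (2 * ?b) *\<^sub>C X) * (D ?i - (2 * ?a) *\<^sub>C Y)
    = L k - 2 *\<^sub>C (?b *\<^sub>C (x ?i * Y) + ?a *\<^sub>C (X * D ?j) - ?a *\<^sub>C (x ?j * Y) - ?b *\<^sub>C (X * D ?i))"
    unfolding L_def by (simp add: scaleC_dist algebra_simps)
  also have "?b *\<^sub>C (x ?i * Y) + ?a *\<^sub>C (X * D ?j) - ?a *\<^sub>C (x ?j * Y) - ?b *\<^sub>C (X * D ?i)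
    = (?a * ?a + ?b * ?b) *\<^sub>C L k - (?c * ?b) *\<^sub>C L ?j - (?c * ?a) *\<^sub>C L ?i"
  proof -
    have L: "L ?i = x ?j * D k - x k * D ?j" "L ?j = x k * D ?i - x ?i * D k"
      using exhaust_3[of k] by (auto simp: L_def cyc_3)
    show ?thesis
      unfolding X Y L_def[of k] L by (simp add: scaleC_dist scaleC_add_left algebra_simps)
  qed
  also have "?a * ?a + ?b * ?b = 1 - ?c * ?c"
    using coord_sq[OF assms, of k] by (simp add: algebra_simps)
  also have "L k - 2 *\<^sub>C ((1 - ?c * ?c) *\<^sub>C L k - (?c * ?b) *\<^sub>C L ?j - (?c * ?a) *\<^sub>C L ?i) = (2 * ?c) *\<^sub>C L_dir \<alpha> - L k"
  proof -
    have c: "(1 - ?c * ?c) *\<^sub>C L k = L k - (?c * ?c) *\<^sub>C L k"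
      using scaleC_add_left[of 1 "- (?c * ?c)" "L k"] by (simp add: scaleC_minus_left)
    show ?thesis
      unfolding c by (simp add: L_dir_def sum_cyc[of _ k] scaleC_dist scaleC_even algebra_simps)
  qed
  finally show ?thesis .
qed

lemma L_\<sigma>:
  assumes "\<alpha> \<in> P"
  shows "L k * \<sigma> \<alpha> + \<sigma> \<alpha> * L k = (2 * coord \<alpha> k) *\<^sub>C (L_dir \<alpha> * \<sigma> \<alpha>)"
  by (simp add: \<sigma>_L[OF assms] left_diff_distrib)

lemma L_dir_\<sigma>:
  assumes "\<alpha> \<in> P"
  shows "\<sigma> \<alpha> * L_dir \<alpha> = L_dir \<alpha> * \<sigma> \<alpha>"
proof -
  have "\<sigma> \<alpha> * L_dir \<alpha> = (\<Sum>k\<in>UNIV. (2 * (coord \<alpha> k * coord \<alpha> k)) *\<^sub>C (L_dir \<alpha> * \<sigma> \<alpha>) - coord \<alpha> k *\<^sub>C (L k * \<sigma> \<alpha>))"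
    unfolding L_dir_def sum_distrib_left mult_scaleC_right
    by (rule sum.cong) (simp_all add: \<sigma>_L[OF assms] left_diff_distrib scaleC_diff_right L_dir_def mult_ac)
  also have "\<dots> = (2 * (coord \<alpha> 1 * coord \<alpha> 1 + coord \<alpha> 2 * coord \<alpha> 2 + coord \<alpha> 3 * coord \<alpha> 3)) *\<^sub>C (L_dir \<alpha> * \<sigma> \<alpha>) - L_dir \<alpha> * \<sigma> \<alpha>"
    by (simp add: sum_subtractf L_dir_def[symmetric] sum_3 distrib_left scaleC_add_left) (simp add: L_dir_def sum_3 distrib_right)
  also have "\<dots> = L_dir \<alpha> * \<sigma> \<alpha>"
    unfolding coord_sq[OF assms, of 1, unfolded cyc_3] by (simp add: scaleC_even)
  finally show ?thesis .
qed

lemma C_between: "u * C j k * v = (\<Sum>\<alpha>\<in>P. \<kappa> \<alpha> *\<^sub>C (coord \<alpha> j * coord \<alpha> k) *\<^sub>C (u * \<sigma> \<alpha> * v))"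
  by (simp add: C_def sum_distrib_left sum_distrib_right mult.assoc)

text \<open>By \<open>L_\<sigma>\<close> the contribution of a root is proportional to
  $\alpha_p \alpha_l \alpha_k L_\alpha \sigma_\alpha$ and thus symmetric in $p$ and $l$.\<close>

lemma L_C: "L p * C l k + C l k * L p = L l * C p k + C p k * L l"
proof -
  have "L p * C l k + C l k * L p = (\<Sum>\<alpha>\<in>P. (2 * \<kappa> \<alpha> * coord \<alpha> l * coord \<alpha> k * coord \<alpha> p) *\<^sub>C (L_dir \<alpha> * \<sigma> \<alpha>))" for p l
  proof -
    have "L p * C l k + C l k * L p = (\<Sum>\<alpha>\<in>P. (\<kappa> \<alpha> * coord \<alpha> l * coord \<alpha> k) *\<^sub>C (L p * \<sigma> \<alpha> + \<sigma> \<alpha> * L p))"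
      by (simp add: C_def sum_distrib_left sum_distrib_right scaleC_add_right sum.distrib)
    also have "\<dots> = (\<Sum>\<alpha>\<in>P. (2 * \<kappa> \<alpha> * coord \<alpha> l * coord \<alpha> k * coord \<alpha> p) *\<^sub>C (L_dir \<alpha> * \<sigma> \<alpha>))"
      by (rule sum.cong) (simp_all add: L_\<sigma> mult_ac)
    finally show ?thesis .
  qed
  from this[of p l] this[of l p] show ?thesis by (simp add: mult_ac)
qed

lemma L_C_div: "L 1 * C 1 k + L 2 * C 2 k + L 3 * C 3 k = C 1 k * L 1 + C 2 k * L 2 + C 3 k * L 3"
proof -
  have "L 1 * C 1 k + L 2 * C 2 k + L 3 * C 3 k = (\<Sum>\<alpha>\<in>P. (\<kappa> \<alpha> * coord \<alpha> k) *\<^sub>C (L_dir \<alpha> * \<sigma> \<alpha>))"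
    by (simp add: C_def L_dir_def sum_3 sum_distrib_left distrib_right scaleC_add_right sum.distrib mult_ac)
  moreover have "C 1 k * L 1 + C 2 k * L 2 + C 3 k * L 3 = (\<Sum>\<alpha>\<in>P. (\<kappa> \<alpha> * coord \<alpha> k) *\<^sub>C (\<sigma> \<alpha> * L_dir \<alpha>))"
    by (simp add: C_def L_dir_def sum_3 sum_distrib_right distrib_left scaleC_add_right sum.distrib mult_ac)
  moreover have "(\<Sum>\<alpha>\<in>P. (\<kappa> \<alpha> * coord \<alpha> k) *\<^sub>C (\<sigma> \<alpha> * L_dir \<alpha>)) = (\<Sum>\<alpha>\<in>P. (\<kappa> \<alpha> * coord \<alpha> k) *\<^sub>C (L_dir \<alpha> * \<sigma> \<alpha>))"
    by (rule sum.cong) (simp_all add: L_dir_\<sigma>)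
  ultimately show ?thesis by simp
qed

lemma S_C: "S * C j k = C j k * S"
  unfolding C_def sum_distrib_left sum_distrib_right by (rule sum.cong) (simp_all add: \<sigma>_S)

lemma C_sym: "C j k = C k j"
  by (simp add: C_def mult_ac)

lemma C_trace: "C 1 1 + C 2 2 + C 3 3 = S"
proof -
  have "C 1 1 + C 2 2 + C 3 3 = (\<Sum>\<alpha>\<in>P. (\<kappa> \<alpha> * (coord \<alpha> 1 * coord \<alpha> 1 + coord \<alpha> 2 * coord \<alpha> 2 + coord \<alpha> 3 * coord \<alpha> 3)) *\<^sub>C \<sigma> \<alpha>)"
    by (simp add: C_def sum.distrib distrib_left scaleC_add_left mult_ac)
  also have "\<dots> = S"
    unfolding S_def by (rule sum.cong) (use coord_sq[of _ 1] in \<open>simp_all add: cyc_3\<close>)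
  finally show ?thesis .
qed

text \<open>The terms of second order in the \<open>D\<close> cancel as they do for undeformed angular momenta; the
  corrections come from moving one \<open>D\<close> past one \<open>x\<close>.\<close>

lemma L_comm_C:
  assumes "i \<noteq> j" "j \<noteq> l" "i \<noteq> l"
  shows "(x j * D l - x l * D j) * (x l * D i - x i * D l) - (x l * D i - x i * D l) * (x j * D l - x l * D j) =
    - (x i * D j - x j * D i) + 2 *\<^sub>C (x j * C l l * D i - x i * C l l * D j
     - x j * C l i * D l + x l * C l i * D j + x i * C j l * D l - x l * C j l * D i)"
proof -
  have Dx: "D p * (x p * b) = x p * (D p * b) + b + 2 *\<^sub>C (C p p * b)" 
    "p \<noteq> r \<Longrightarrow> D p * (x r * b) = x r * (D p * b) + 2 *\<^sub>C (C p r * b)" for p r b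
    using arg_cong[OF D_x[of p p], of "\<lambda>t. t * b"] arg_cong[OF D_x[of p r], of "\<lambda>t. t * b"]
    by (simp_all add: algebra_simps)
  have x: "x l * (x j * b) = x j * (x l * b)" "x j * (x i * b) = x i * (x j * b)" "x l * (x i * b) = x i * (x l * b)" for b
    by (simp_all only: mult.assoc[symmetric] x_x[of l j] x_x[of j i] x_x[of l i])
  show ?thesis
    using assms by (simp add: Dx x D_D[of l j] D_D[of l i] D_D[of j i] C_sym[of i l] C_sym[of l j] C_sym[of j i] scaleC_dist algebra_simps)
qed

text \<open>Moving $\sigma_\alpha$ to the right creates terms with $D_\alpha$, whose coefficients cancel
  in this combination; the rest is the component of angular momentum along the root.\<close>

lemma L_comm_root:
  assumes "\<alpha> \<in> P"
  shows "(coord \<alpha> l * coord \<alpha> l) *\<^sub>C (x j * \<sigma> \<alpha> * D i - x i * \<sigma> \<alpha> * D j)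
     - (coord \<alpha> l * coord \<alpha> i) *\<^sub>C (x j * \<sigma> \<alpha> * D l) + (coord \<alpha> l * coord \<alpha> i) *\<^sub>C (x l * \<sigma> \<alpha> * D j)
     + (coord \<alpha> j * coord \<alpha> l) *\<^sub>C (x i * \<sigma> \<alpha> * D l) - (coord \<alpha> j * coord \<alpha> l) *\<^sub>C (x l * \<sigma> \<alpha> * D i)
    = - coord \<alpha> l *\<^sub>C ((coord \<alpha> l *\<^sub>C (x i * D j - x j * D i) + coord \<alpha> i *\<^sub>C (x j * D l - x l * D j) + coord \<alpha> j *\<^sub>C (x l * D i - x i * D l)) * \<sigma> \<alpha>)"
  unfolding mult.assoc \<sigma>_D[OF assms] 
  by (simp add: scaleC_dist algebra_simps)

text \<open>For a single root the correction terms equal $- \alpha_{k+2} L_\alpha \sigma_\alpha$ by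
  \<open>L_comm_root\<close>, which by \<open>L_\<sigma>\<close> is minus half the anticommutator of $L_{k+2}$ with
  $\sigma_\alpha$.\<close>

lemma L_comm: "L k * L (k + 1) - L (k + 1) * L k = - L (k + 2) - (L (k + 2) * S + S * L (k + 2))"
proof -
  let ?j = "k + 1" and ?l = "k + 2"
  have ne: "k \<noteq> ?j" "?j \<noteq> ?l" "k \<noteq> ?l" using exhaust_3[of k] by auto
  have L: "L ?j = x ?l * D k - x k * D ?l" "L ?l = x k * D ?j - x ?j * D k"
    using exhaust_3[of k] by (auto simp: L_def cyc_3)
  have L_dir: "L_dir \<alpha> = coord \<alpha> ?l *\<^sub>C (x k * D ?j - x ?j * D k) + coord \<alpha> k *\<^sub>C (x ?j * D ?l - x ?l * D ?j)
     + coord \<alpha> ?j *\<^sub>C (x ?l * D k - x k * D ?l)" for \<alpha>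
    unfolding L_dir_def sum_cyc[of _ k] L L_def[of k] by (simp only: add_ac)
  have "x ?j * C ?l ?l * D k - x k * C ?l ?l * D ?j - x ?j * C ?l k * D ?l + x ?l * C ?l k * D ?j
     + x k * C ?j ?l * D ?l - x ?l * C ?j ?l * D k = (\<Sum>\<alpha>\<in>P. \<kappa> \<alpha> *\<^sub>C (- coord \<alpha> ?l *\<^sub>C (L_dir \<alpha> * \<sigma> \<alpha>)))"
    unfolding C_between sum_subtractf[symmetric] sum.distrib[symmetric] scaleC_diff_right[symmetric] scaleC_add_right[symmetric]
    by (rule sum.cong[OF refl]) (simp only: L_comm_root L_dir)
  moreover have "L ?l * S + S * L ?l = (\<Sum>\<alpha>\<in>P. \<kappa> \<alpha> *\<^sub>C (L ?l * \<sigma> \<alpha> + \<sigma> \<alpha> * L ?l))"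
    by (simp add: S_def sum_distrib_left sum_distrib_right scaleC_add_right sum.distrib)
  moreover have "\<dots> = - 2 *\<^sub>C (\<Sum>\<alpha>\<in>P. \<kappa> \<alpha> *\<^sub>C (- coord \<alpha> ?l *\<^sub>C (L_dir \<alpha> * \<sigma> \<alpha>)))"
    unfolding scaleC_sum_right by (rule sum.cong) (simp_all add: L_\<sigma> mult_ac)
  ultimately show ?thesis
    unfolding L_def[of k] L L_comm_C[OF ne] by (simp add: scaleC_minus_left)
qed

lemma angular_algebra:
  assumes "\<epsilon> * \<epsilon> = 1"
  shows "angular_algebra \<epsilon> L C S (- S - (1/2) *\<^sub>C 1)"
proof
  show "L k * L (k + 1) - L (k + 1) * L k = L (k + 2) * (- S - (1/2) *\<^sub>C 1) + (- S - (1/2) *\<^sub>C 1) * L (k + 2)" for k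
  proof -
    have "L (k + 2) = (1/2) *\<^sub>C L (k + 2) + (1/2) *\<^sub>C L (k + 2)" by (simp flip: scaleC_add_left)
    then show ?thesis unfolding L_comm by (simp add: algebra_simps)
  qed
qed (use assms C_sym C_trace S_C L_C L_C_div in auto)

end

section \<open>The root system\<close>

definition planar :: "real \<Rightarrow> real^3" where "planar t = vector [sin t, - cos t, 0]"

lemma planar_nth: "planar t $ 1 = sin t" "planar t $ 2 = - cos t" "planar t $ 3 = 0"
  by (simp_all add: planar_def)

lemma root_vec_planar: "j \<noteq> 0 \<Longrightarrow> root_vec m j = planar (real j * pi / real m)"
  by (simp add: root_vec_def planar_def)

lemma root_vec_0: "root_vec m 0 = axis 3 1"
  by (simp add: root_vec_def vec_eq_iff forall_3 axis_def)

lemma minus_planar: "- planar t = planar (t + pi)"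
  by (simp add: planar_nth vec_eq_iff forall_3)

lemma root_vec_unit: "root_vec m j \<bullet> root_vec m j = 1"
  by (cases "j = 0") (simp_all add: root_vec_0 root_vec_planar inner_axis_axis axis_def inner_vec_def sum_3 planar_nth flip: power2_eq_square)

text \<open>Allowing all integers as index, with angles modulo $2\pi$, makes the closure under
  reflections a computation with angles.\<close>

lemma planar_root:
  assumes "m \<ge> 1"
  shows "planar (of_int t * pi / real m) \<in> root_sys m"
proof -
  define r where "r = (t - 1) mod (2 * int m)"
  define j where "j = nat (r + 1)"
  have r: "0 \<le> r" "r < 2 * int m" using assms by (simp_all add: r_def)
  have "t - 1 = 2 * int m * ((t - 1) div (2 * int m)) + r" by (simp add: r_def)
  then have "t = 2 * int m * ((t - 1) div (2 * int m)) + (r + 1)" by simp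
  then obtain q where "t = 2 * int m * q + (r + 1)" by blast
  then have "real_of_int t = 2 * real m * of_int q + real j" using r by (simp add: j_def)
  then have "of_int t * pi / real m = real j * pi / real m + of_int q * (2 * pi)"
    using assms by (simp add: field_simps)
  then have "planar (of_int t * pi / real m) = planar (real j * pi / real m)"
    using sin.plus_of_int[of "real j * pi / real m" q] cos.plus_of_int[of "real j * pi / real m" q]
    by (simp add: planar_def)
  moreover have "j \<in> {1..2 * m}" using r by (auto simp: j_def)
  ultimately show ?thesis by (auto simp: root_sys_def root_vec_planar intro!: image_eqI[of _ _ j])
qed

lemma root_sys_cases:
  assumes "\<alpha> \<in> root_sys m"
  obtains "\<alpha> = axis 3 1" | "\<alpha> = - axis 3 1" | t where "\<alpha> = planar (of_int t * pi / real m)"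
proof -
  consider "\<alpha> = axis 3 1" | "\<alpha> = - axis 3 1" | j where "j \<in> {1..2*m}" "\<alpha> = root_vec m j"
    using assms by (auto simp: root_sys_def root_vec_0)
  then show ?thesis
  proof cases
    case (3 j)
    then have "\<alpha> = planar (of_int (int j) * pi / real m)" by (simp add: root_vec_planar)
    then show ?thesis using that(3) by blast
  qed (use that in auto)
qed

lemma axis_root: "axis 3 1 \<in> root_sys m" "- axis 3 1 \<in> root_sys m"
  by (simp_all add: root_sys_def root_vec_0)

lemma root_unit:
  assumes "\<alpha> \<in> root_sys m" shows "\<alpha> \<bullet> \<alpha> = 1"
  using assms root_vec_unit[of m] by (auto simp: root_sys_def)

lemma reflection_unit: "\<alpha> \<bullet> \<alpha> = 1 \<Longrightarrow> reflection \<alpha> x = x - (2 * (x \<bullet> \<alpha>)) *\<^sub>R \<alpha>"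
  by (simp add: reflection_def)

lemma reflection_minus: "reflection (- \<alpha>) x = reflection \<alpha> x"
  by (simp add: reflection_def)

lemma planar_unit: "planar a \<bullet> planar a = 1"
  by (simp add: inner_vec_def sum_3 planar_nth flip: power2_eq_square)

lemma reflection_planar: "reflection (planar a) (planar b) = planar (2 * a - b + pi)"
proof -
  have ip: "planar b \<bullet> planar a = cos (a - b)"
    by (simp add: inner_vec_def sum_3 planar_nth cos_diff mult.commute)
  have ab: "sin (2 * a - b) = sin a * cos (a - b) + cos a * sin (a - b)"
    "cos (2 * a - b) = cos a * cos (a - b) - sin a * sin (a - b)"
    using sin_add[of a "a - b"] cos_add[of a "a - b"] by simp_all
  have b: "sin b = sin a * cos (a - b) - cos a * sin (a - b)" "cos b = cos a * cos (a - b) + sin a * sin (a - b)"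
    using sin_diff[of a "a - b"] cos_diff[of a "a - b"] by simp_all
  show ?thesis
    unfolding reflection_unit[OF planar_unit] ip
    by (simp add: vec_eq_iff forall_3 planar_nth ab b)
qed

lemma inner_planar_axis: "planar a \<bullet> axis 3 1 = 0" "axis 3 1 \<bullet> planar a = 0"
  by (simp_all add: inner_axis inner_axis' planar_nth)

lemma reflection_root:
  assumes "m \<ge> 1" "\<beta> \<in> root_sys m" "\<alpha> \<in> root_sys m"
  shows "reflection \<beta> \<alpha> \<in> root_sys m"
proof -
  have *: "reflection \<beta> \<alpha> \<in> root_sys m" if b: "\<beta> = axis 3 1 \<or> (\<exists>s. \<beta> = planar (of_int s * pi / real m))" for \<beta>
    using assms(3)
  proof (cases rule: root_sys_cases)
    case (3 t)
    from b show ?thesis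
    proof
      assume "\<exists>s. \<beta> = planar (of_int s * pi / real m)"
      then obtain s where "\<beta> = planar (of_int s * pi / real m)" ..
      then have "reflection \<beta> \<alpha> = planar (of_int (2 * s - t + int m) * pi / real m)"
        using assms(1) unfolding 3 by (simp add: reflection_planar field_simps)
      then show ?thesis using planar_root[OF assms(1), of "2 * s - t + int m"] by (simp only:)
    qed (use assms(3) 3 in \<open>simp add: reflection_def inner_planar_axis\<close>)
  qed (use b axis_root in \<open>auto simp: reflection_def inner_planar_axis inner_axis_axis scaleR_2\<close>)
  from assms(2) show ?thesis
  proof (cases rule: root_sys_cases)
    case 2
    then show ?thesis using *[of "axis 3 1"] by (simp add: reflection_minus)
  qed (use * in auto)
qed

lemma pos_roots_sub: "pos_roots m \<subseteq> root_sys m"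
proof
  fix \<alpha> assume "\<alpha> \<in> pos_roots m"
  then obtain j where "j \<le> m" "\<alpha> = root_vec m j" by (auto simp: pos_roots_def)
  then show "\<alpha> \<in> root_sys m" by (cases "j = 0") (auto simp: root_sys_def)
qed

lemma pos_roots_cover:
  assumes "\<alpha> \<in> root_sys m"
  shows "\<alpha> \<in> pos_roots m \<or> - \<alpha> \<in> pos_roots m"
proof -
  consider "\<alpha> = root_vec m 0 \<or> - \<alpha> = root_vec m 0" | j where "j \<in> {1..2*m}" "\<alpha> = root_vec m j"
    using assms by (auto simp: root_sys_def)
  then show ?thesis
  proof cases
    case (2 j)
    show ?thesis
    proof (cases "j \<le> m")
      case False
      then have E: "real j * pi / real m = real (j - m) * pi / real m + pi"
        using 2 by (simp add: of_nat_diff field_simps)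
      have "\<alpha> = planar (real j * pi / real m)"
        using 2 False by (simp add: root_vec_planar)
      also have "\<dots> = - planar (real (j - m) * pi / real m)"
        unfolding minus_planar E ..
      finally have "- \<alpha> = root_vec m (j - m)"
        using False by (simp add: root_vec_planar)
      then show ?thesis using False 2 by (auto simp: pos_roots_def)
    qed (use 2 in \<open>auto simp: pos_roots_def\<close>)
  qed (auto simp: pos_roots_def)
qed

text \<open>Positivity in a lexicographic ordering for which all elements of \<open>pos_roots m\<close> are positive;
  hence no root lies among them together with its negative.\<close>

definition lex_pos :: "real^3 \<Rightarrow> bool" where
  "lex_pos \<alpha> \<longleftrightarrow> \<alpha> $ 3 > 0 \<or> \<alpha> $ 3 = 0 \<and> (\<alpha> $ 1 > 0 \<or> \<alpha> $ 1 = 0 \<and> \<alpha> $ 2 > 0)"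

lemma pos_roots_lex_pos:
  assumes "\<alpha> \<in> pos_roots m"
  shows "lex_pos \<alpha>"
proof -
  obtain j where j: "j \<le> m" "\<alpha> = root_vec m j" using assms by (auto simp: pos_roots_def)
  consider "j = 0" | "0 < j" "j < m" | "j = m" "j > 0" using j by linarith
  then show ?thesis
  proof cases
    case 2
    then have "0 < real j * pi / real m" "real j * pi / real m < pi"
      by (simp_all add: pos_divide_less_eq mult.commute[of pi])
    then show ?thesis using 2 by (simp add: j lex_pos_def root_vec_planar planar_nth sin_gt_zero)
  qed (simp_all add: j lex_pos_def root_vec_0 root_vec_planar planar_nth axis_def)
qed

lemma pos_roots_minus: "\<alpha> \<in> pos_roots m \<Longrightarrow> - \<alpha> \<notin> pos_roots m"
  using pos_roots_lex_pos[of \<alpha> m] pos_roots_lex_pos[of "- \<alpha>" m] by (auto simp: lex_pos_def)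

text \<open>A reflection maps the positive roots to a set of representatives of the roots modulo sign.
  Correcting the signs gives an involution of the positive roots.\<close>

lemma sum_pos_roots_reflection:
  fixes F :: "real^3 \<Rightarrow> 'b::comm_monoid_add"
  assumes "m \<ge> 1" "\<beta> \<in> root_sys m" and even: "\<And>\<alpha>. \<alpha> \<in> root_sys m \<Longrightarrow> F (- \<alpha>) = F \<alpha>"
  shows "(\<Sum>\<alpha>\<in>pos_roots m. F (reflection \<beta> \<alpha>)) = (\<Sum>\<alpha>\<in>pos_roots m. F \<alpha>)"
proof -
  define rep where "rep \<alpha> = (if \<alpha> \<in> pos_roots m then \<alpha> else - \<alpha>)" for \<alpha>
  define g where "g \<alpha> = rep (reflection \<beta> \<alpha>)" for \<alpha>
  have root: "reflection \<beta> \<alpha> \<in> root_sys m" if "\<alpha> \<in> pos_roots m" for \<alpha>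
    using reflection_root[OF assms(1,2)] pos_roots_sub that by blast
  have lin: "reflection \<beta> (- \<alpha>) = - reflection \<beta> \<alpha>" for \<alpha>
    by (simp add: reflection_def algebra_simps)
  have g_pos: "g \<alpha> \<in> pos_roots m" if "\<alpha> \<in> pos_roots m" for \<alpha>
    using pos_roots_cover[OF root[OF that]] by (auto simp: g_def rep_def)
  have g_g: "g (g \<alpha>) = \<alpha>" if "\<alpha> \<in> pos_roots m" for \<alpha>
    using that pos_roots_minus[OF that] by (auto simp: g_def rep_def lin)
  have F_g: "F (g \<alpha>) = F (reflection \<beta> \<alpha>)" if "\<alpha> \<in> pos_roots m" for \<alpha>
    using even[OF root[OF that]] by (simp add: g_def rep_def)
  show ?thesis
    by (rule sum.reindex_bij_witness[of _ g g]) (use g_pos g_g F_g in \<open>auto\<close>)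
qed

lemma inj_on_root_vec: "inj_on (root_vec m) {0..m}"
proof (rule inj_onI)
  fix j k assume jk: "j \<in> {0..m}" "k \<in> {0..m}" and eq: "root_vec m j = root_vec m k"
  have z: "root_vec m i $ 3 = (if i = 0 then 1 else 0)" for i
    by (cases "i = 0") (simp_all add: root_vec_0 root_vec_planar planar_nth)
  have jk0: "j = 0 \<longleftrightarrow> k = 0"
    using z[of j] z[of k] unfolding eq by (metis zero_neq_one)
  show "j = k"
  proof (cases "k = 0")
    case True
    then show ?thesis using jk0 by simp
  next
    case False
    then have m: "real m \<noteq> 0" "real m > 0" using jk(2) by auto
    let ?a = "\<lambda>i. real i * pi / real m"
    have "0 \<le> ?a i" "?a i \<le> pi" if "i \<in> {0..m}" for i
      using mult_right_mono[of "real i" "real m" pi] that m by (simp_all add: pos_divide_le_eq)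
    moreover have "cos (?a j) = cos (?a k)"
      using arg_cong[OF eq, of "\<lambda>v. v $ 2"] unfolding root_vec_planar[OF False]
        root_vec_planar[OF False[folded jk0]] planar_nth by (simp only: neg_equal_iff_equal)
    ultimately have "?a j = ?a k"
      using jk cos_inj_pi[of "?a j" "?a k"] by blast
    then have "real j = real k"
      unfolding divide_cancel_right mult_cancel_right using m pi_neq_zero by blast
    then show ?thesis by simp
  qed
qed

lemma sum_pos_roots: "(\<Sum>\<alpha>\<in>pos_roots m. f \<alpha>) = (\<Sum>k=0..m. f (root_vec m k))"
  unfolding pos_roots_def by (simp add: sum.reindex inj_on_root_vec)

section \<open>Dunkl operators on polynomials\<close>

lemma poly_op_eqI: "(\<And>f x. cpoly_eval (op_apply S f) x = cpoly_eval (op_apply T f) x) \<Longrightarrow> S = T"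
  by (metis cpoly_eval_inject op_apply_inject ext)

lemma cpoly_eval_simps:
  "cpoly_eval (f + g) x = cpoly_eval f x + cpoly_eval g x" "cpoly_eval (f - g) x = cpoly_eval f x - cpoly_eval g x"
  "cpoly_eval (c *\<^sub>C f) x = c * cpoly_eval f x" "cpoly_eval 0 x = 0" "cpoly_eval (- f) x = - cpoly_eval f x"
  by (simp_all add: plus_cpoly.rep_eq minus_cpoly.rep_eq scaleC_cpoly.rep_eq zero_cpoly.rep_eq uminus_cpoly.rep_eq)

lemma op_apply_simps:
  "op_apply (S + T) f = op_apply S f + op_apply T f" "op_apply (S - T) f = op_apply S f - op_apply T f"
  "op_apply (c *\<^sub>C T) f = c *\<^sub>C op_apply T f" "op_apply 0 f = 0" "op_apply 1 f = f"
  "op_apply (S * T) f = op_apply S (op_apply T f)"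
  by (simp_all add: plus_poly_op.rep_eq minus_poly_op.rep_eq scaleC_poly_op.rep_eq zero_poly_op.rep_eq
      one_poly_op.rep_eq times_poly_op.rep_eq)

lemma op_apply_sum: "cpoly_eval (op_apply (\<Sum>i\<in>I. T i) f) x = (\<Sum>i\<in>I. cpoly_eval (op_apply (T i) f) x)"
  by (induction I rule: infinite_finite_induct) (simp_all add: op_apply_simps cpoly_eval_simps)

lemma op_apply_linear: "op_apply T (f + g) = op_apply T f + op_apply T g" "op_apply T (c *\<^sub>C f) = c *\<^sub>C op_apply T f"
  using op_apply[of T] by auto

lemma poly_cpoly: "polynomial_function (cpoly_eval f)"
  using cpoly_eval[of f] by simp

lemma eval_mult_var: "cpoly_eval (op_apply (mult_var_op k) f) x = complex_of_real (x $ k) * cpoly_eval f x"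
  by (simp add: mult_var_op.rep_eq mult_var_map.rep_eq)

lemma eval_refl: "cpoly_eval (op_apply (refl_op \<alpha>) f) x = cpoly_eval f (reflection \<alpha> x)"
  by (simp add: refl_op.rep_eq refl_map.rep_eq inv_reflection)

text \<open>The Dunkl operator in an arbitrary direction, for stating equivariance without coordinates.\<close>

definition dunkl_dir :: "nat \<Rightarrow> (real^3 \<Rightarrow> complex) \<Rightarrow> real^3 \<Rightarrow> (real^3 \<Rightarrow> complex) \<Rightarrow> real^3 \<Rightarrow> complex" where
  "dunkl_dir m \<kappa> v f x = frechet_derivative f (at x) v +
     (\<Sum>\<alpha>\<in>pos_roots m. \<kappa> \<alpha> * refl_quot \<alpha> f x * complex_of_real (\<alpha> \<bullet> v))"

lemma eval_dunkl: "cpoly_eval (op_apply (dunkl_op m \<kappa> j) f) x = dunkl_dir m \<kappa> (axis j 1) (cpoly_eval f) x"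
  by (simp add: dunkl_op.rep_eq dunkl_map.rep_eq dunkl_dir_def)

lemma linear_dunkl_dir:
  assumes "polynomial_function f"
  shows "linear (\<lambda>v. dunkl_dir m \<kappa> v f x)"
proof -
  interpret F: linear "frechet_derivative f (at x)"
    using linear_frechet_derivative[OF polynomial_function_frechet(1)[OF assms]] .
  show ?thesis
    by (rule linearI) (simp_all add: dunkl_dir_def F.add F.scaleR inner_add_right sum.distrib algebra_simps
        scaleR_right.sum scaleR_conv_of_real[of _ "_ :: complex"] sum_distrib_left)
qed

lemma sum_axis: "(\<Sum>l\<in>UNIV. (v $ l) *\<^sub>R axis l 1) = (v :: real^3)"
  by (simp add: vec_eq_iff axis_def if_distrib cong: if_cong)

lemma reflection_linear: "linear (reflection \<alpha>)"
  using bounded_linear_reflection by (rule bounded_linear.linear)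

lemma eval_dunkl_sum:
  "(\<Sum>l\<in>UNIV. complex_of_real (v $ l) * dunkl_dir m \<kappa> (axis l 1) (cpoly_eval f) x) = dunkl_dir m \<kappa> v (cpoly_eval f) x"
proof -
  interpret F: linear "\<lambda>v. dunkl_dir m \<kappa> v (cpoly_eval f) x"
    by (rule linear_dunkl_dir[OF poly_cpoly])
  have "dunkl_dir m \<kappa> (\<Sum>l\<in>UNIV. (v $ l) *\<^sub>R axis l 1) (cpoly_eval f) x =
    (\<Sum>l\<in>UNIV. complex_of_real (v $ l) * dunkl_dir m \<kappa> (axis l 1) (cpoly_eval f) x)"
    unfolding F.sum F.scaleR by (simp only: scaleR_conv_of_real)
  then show ?thesis by (simp only: sum_axis)
qed

lemma reflection_inner:
  assumes "\<alpha> \<bullet> \<alpha> = 1"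
  shows "reflection \<alpha> x \<bullet> y = x \<bullet> reflection \<alpha> y" "reflection \<alpha> x \<bullet> reflection \<alpha> y = x \<bullet> y"
proof -
  show 1: "reflection \<alpha> x \<bullet> y = x \<bullet> reflection \<alpha> y" for x y
    using assms by (simp add: reflection_unit inner_diff_left inner_diff_right inner_commute[of y \<alpha>])
  show "reflection \<alpha> x \<bullet> reflection \<alpha> y = x \<bullet> y"
    by (simp add: 1)
qed

lemma reflection_conj:
  assumes "\<beta> \<bullet> \<beta> = 1"
  shows "reflection (reflection \<beta> \<alpha>) (reflection \<beta> x) = reflection \<beta> (reflection \<alpha> x)"
proof -
  interpret linear "reflection \<beta>" by (rule reflection_linear)
  show ?thesis
    unfolding reflection_def[of "reflection \<beta> \<alpha>"] reflection_inner(2)[OF assms]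
    by (simp add: reflection_def[of \<alpha>] diff scaleR)
qed

lemma refl_quot_minus:
  assumes "polynomial_function f" "\<alpha> \<noteq> 0"
  shows "refl_quot (- \<alpha>) f x = - refl_quot \<alpha> f x"
proof -
  have "refl_quot (- \<alpha>) f = (\<lambda>x. - refl_quot \<alpha> f x)"
  proof (rule refl_quot_eqI)
    show "polynomial_function (\<lambda>x. - refl_quot \<alpha> f x)"
      using refl_quot(1)[OF assms] by (rule polynomial_function_minus)
  qed (use assms in \<open>simp_all add: refl_quot(2)[OF assms] reflection_minus\<close>)
  then show ?thesis by simp
qed

lemma refl_quot_compose:
  assumes "polynomial_function f" "\<alpha> \<noteq> 0" "\<beta> \<bullet> \<beta> = 1"
  shows "refl_quot \<alpha> (\<lambda>x. f (reflection \<beta> x)) x = refl_quot (reflection \<beta> \<alpha>) f (reflection \<beta> x)"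
proof -
  have nz: "reflection \<beta> \<alpha> \<noteq> 0"
    using assms(2,3) reflection_inner(2)[of \<beta> \<alpha> \<alpha>] by (metis inner_eq_zero_iff)
  have "refl_quot \<alpha> (\<lambda>x. f (reflection \<beta> x)) = (\<lambda>x. refl_quot (reflection \<beta> \<alpha>) f (reflection \<beta> x))"
  proof (rule refl_quot_eqI)
    show "polynomial_function (\<lambda>x. refl_quot (reflection \<beta> \<alpha>) f (reflection \<beta> x))"
      using polynomial_function_compose[OF polynomial_function_bounded_linear[OF
      bounded_linear_reflection] refl_quot(1)[OF assms(1) nz]] by (auto simp: o_def)
    show "complex_of_real (x \<bullet> \<alpha>) * refl_quot (reflection \<beta> \<alpha>) f (reflection \<beta> x) =
        f (reflection \<beta> x) - f (reflection \<beta> (reflection \<alpha> x))" for x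
      using refl_quot(2)[OF assms(1) nz, of "reflection \<beta> x"]
      by (simp add: reflection_inner(2)[OF assms(3)] reflection_conj[OF assms(3)])
  qed fact
  then show ?thesis by simp
qed

lemma kappa_reflection:
  assumes "refl_invariant m \<kappa>" "\<beta> \<in> root_sys m" "\<alpha> \<in> root_sys m"
  shows "\<kappa> (reflection \<beta> \<alpha>) = \<kappa> \<alpha>"
proof -
  have "reflection \<beta> \<circ> id \<in> refl_group m"
    by (intro refl_group_id refl_group_step assms)
  then show ?thesis using assms by (auto simp: refl_invariant_def)
qed

lemma reflection_self: "\<alpha> \<bullet> \<alpha> = 1 \<Longrightarrow> reflection \<alpha> \<alpha> = - \<alpha>"
  by (simp add: reflection_unit scaleR_2)

lemma kappa_minus:
  assumes "refl_invariant m \<kappa>" "\<alpha> \<in> root_sys m"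
  shows "\<kappa> (- \<alpha>) = \<kappa> \<alpha>"
  using kappa_reflection[OF assms(1,2,2)] by (simp add: reflection_self root_unit[OF assms(2)])

lemma root_nonzero: "\<alpha> \<in> root_sys m \<Longrightarrow> \<alpha> \<noteq> 0"
  using root_unit by force

text \<open>Equivariance: the derivative transforms by the chain rule, and the reflection along \<open>\<beta>\<close>
  permutes the summands of the reflection part, each of which is even in its root.\<close>

lemma dunkl_dir_reflection:
  assumes m: "m \<ge> 1" and inv: "refl_invariant m \<kappa>" and \<beta>: "\<beta> \<in> root_sys m" and f: "polynomial_function f"
  shows "dunkl_dir m \<kappa> (reflection \<beta> v) (\<lambda>x. f (reflection \<beta> x)) x = dunkl_dir m \<kappa> v f (reflection \<beta> x)"
proof -
  note u = root_unit[OF \<beta>]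
  interpret R: bounded_linear "reflection \<beta>" by (rule bounded_linear_reflection)
  have "(f has_derivative frechet_derivative f (at (reflection \<beta> x))) (at (reflection \<beta> x))"
    using polynomial_function_frechet(1)[OF f] by (simp add: frechet_derivative_works)
  then have "((\<lambda>x. f (reflection \<beta> x)) has_derivative (\<lambda>v. frechet_derivative f (at (reflection \<beta> x)) (reflection \<beta> v))) (at x)"
    by (rule has_derivative_compose[OF R.has_derivative[OF has_derivative_ident]])
  from frechet_derivative_at[OF this, symmetric]
  have 1: "frechet_derivative (\<lambda>x. f (reflection \<beta> x)) (at x) (reflection \<beta> v) = frechet_derivative f (at (reflection \<beta> x)) v"
    by simp
  define F where "F \<alpha> = \<kappa> \<alpha> * refl_quot \<alpha> f (reflection \<beta> x) * complex_of_real (\<alpha> \<bullet> v)" for \<alpha>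
  have "(\<Sum>\<alpha>\<in>pos_roots m. \<kappa> \<alpha> * refl_quot \<alpha> (\<lambda>x. f (reflection \<beta> x)) x * complex_of_real (\<alpha> \<bullet> reflection \<beta> v))
    = (\<Sum>\<alpha>\<in>pos_roots m. F (reflection \<beta> \<alpha>))"
  proof (rule sum.cong[OF refl])
    fix \<alpha> assume "\<alpha> \<in> pos_roots m"
    then have \<alpha>: "\<alpha> \<in> root_sys m" using pos_roots_sub by blast
    show "\<kappa> \<alpha> * refl_quot \<alpha> (\<lambda>x. f (reflection \<beta> x)) x * complex_of_real (\<alpha> \<bullet> reflection \<beta> v) = F (reflection \<beta> \<alpha>)"
      unfolding F_def kappa_reflection[OF inv \<beta> \<alpha>] refl_quot_compose[OF f root_nonzero[OF \<alpha>] u] reflection_inner(1)[OF u] ..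
  qed
  also have "\<dots> = (\<Sum>\<alpha>\<in>pos_roots m. F \<alpha>)"
    by (rule sum_pos_roots_reflection[OF m \<beta>]) (simp add: F_def kappa_minus[OF inv] refl_quot_minus[OF f root_nonzero])
  finally show ?thesis
    unfolding dunkl_dir_def 1 F_def by simp
qed

definition refl_weight :: "nat \<Rightarrow> (real^3 \<Rightarrow> complex) \<Rightarrow> 3 \<Rightarrow> 3 \<Rightarrow> poly_op" where
  "refl_weight m \<kappa> j k = (\<Sum>\<alpha>\<in>pos_roots m. (\<kappa> \<alpha> * coord \<alpha> j * coord \<alpha> k) *\<^sub>C refl_op \<alpha>)"

definition refl_sum :: "nat \<Rightarrow> (real^3 \<Rightarrow> complex) \<Rightarrow> poly_op" where
  "refl_sum m \<kappa> = (\<Sum>\<alpha>\<in>pos_roots m. \<kappa> \<alpha> *\<^sub>C refl_op \<alpha>)"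

lemma pos_unit: "\<alpha> \<in> pos_roots m \<Longrightarrow> \<alpha> \<bullet> \<alpha> = 1"
  using root_unit pos_roots_sub by blast

lemma cpoly_eqI: "(\<And>x. cpoly_eval f x = cpoly_eval g x) \<Longrightarrow> f = g"
  by (simp add: fun_eq_iff flip: cpoly_eval_inject)

lemmas op_eval_simps = op_apply_simps cpoly_eval_simps op_apply_sum op_apply_linear eval_mult_var eval_refl eval_dunkl

text \<open>The difference quotient of a product, using that the $k$-th coordinate has difference
  quotient $2 \alpha_k$.\<close>

lemma refl_quot_mult_var:
  assumes "polynomial_function f" "\<alpha> \<bullet> \<alpha> = 1"
  shows "refl_quot \<alpha> (\<lambda>x. complex_of_real (x $ k) * f x) x =
    complex_of_real (x $ k) * refl_quot \<alpha> f x + 2 * complex_of_real (\<alpha> $ k) * f (reflection \<alpha> x)"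
proof -
  have nz: "\<alpha> \<noteq> 0" using assms(2) by force
  have poly: "polynomial_function (\<lambda>x. f (reflection \<alpha> x))"
    using polynomial_function_compose[OF polynomial_function_bounded_linear[OF bounded_linear_reflection] assms(1)]
    by (auto simp: o_def)
  have "refl_quot \<alpha> (\<lambda>x. complex_of_real (x $ k) * f x) =
     (\<lambda>x. complex_of_real (x $ k) * refl_quot \<alpha> f x + 2 * complex_of_real (\<alpha> $ k) * f (reflection \<alpha> x))"
  proof (rule refl_quot_eqI[OF nz])
    show "polynomial_function (\<lambda>x. complex_of_real (x $ k) * refl_quot \<alpha> f x + 2 * complex_of_real (\<alpha> $ k) * f (reflection \<alpha> x))"
      by (intro polynomial_function_add polynomial_function_times polynomial_function_of_real polynomial_function_const
         refl_quot(1)[OF assms(1) nz] poly real_polynomial_function.intros(1) bounded_linear_vec_nth)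
    fix x
    have "complex_of_real (x \<bullet> \<alpha>) * (complex_of_real (x $ k) * refl_quot \<alpha> f x + 2 * complex_of_real (\<alpha> $ k) * f (reflection \<alpha> x))
      = complex_of_real (x $ k) * (complex_of_real (x \<bullet> \<alpha>) * refl_quot \<alpha> f x) + 2 * complex_of_real (x \<bullet> \<alpha>) * complex_of_real (\<alpha> $ k) * f (reflection \<alpha> x)"
      by (simp only: distrib_left mult_ac)
    also have "\<dots> = complex_of_real (x $ k) * f x - complex_of_real (reflection \<alpha> x $ k) * f (reflection \<alpha> x)"
      unfolding refl_quot(2)[OF assms(1) nz] by (simp add: reflection_unit[OF assms(2)] algebra_simps)
    finally show "complex_of_real (x \<bullet> \<alpha>) * (complex_of_real (x $ k) * refl_quot \<alpha> f x + 2 * complex_of_real (\<alpha> $ k) * f (reflection \<alpha> x))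
      = complex_of_real (x $ k) * f x - complex_of_real (reflection \<alpha> x $ k) * f (reflection \<alpha> x)" .
  qed
  then show ?thesis by simp
qed

lemma frechet_mult_var:
  assumes "polynomial_function (f :: real^3 \<Rightarrow> complex)"
  shows "frechet_derivative (\<lambda>x. complex_of_real (x $ k) * f x) (at x) v =
    complex_of_real (x $ k) * frechet_derivative f (at x) v + complex_of_real (v $ k) * f x"
proof -
  have "((\<lambda>x. complex_of_real (x $ k) * f x) has_derivative
      (\<lambda>v. complex_of_real (x $ k) * frechet_derivative f (at x) v + complex_of_real (v $ k) * f x)) (at x)"
    using polynomial_function_frechet(1)[OF assms]
    by (intro has_derivative_mult has_derivative_of_real bounded_linear_imp_has_derivative bounded_linear_vec_nth)
      (simp add: frechet_derivative_works)
  from frechet_derivative_at[OF this, symmetric] show ?thesis by simp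
qed

lemma dunkl_var:
  "dunkl_op m \<kappa> j * mult_var_op k - mult_var_op k * dunkl_op m \<kappa> j = (if j = k then 1 else 0) + 2 *\<^sub>C refl_weight m \<kappa> j k"
proof (rule poly_op_eqI)
  fix f x
  have ev: "cpoly_eval (op_apply (mult_var_op k) f) = (\<lambda>x. complex_of_real (x $ k) * cpoly_eval f x)"
    by (simp add: fun_eq_iff eval_mult_var)
  have "(\<Sum>\<alpha>\<in>pos_roots m. \<kappa> \<alpha> * refl_quot \<alpha> (\<lambda>x. complex_of_real (x $ k) * cpoly_eval f x) x * complex_of_real (\<alpha> \<bullet> axis j 1))
    = (\<Sum>\<alpha>\<in>pos_roots m. complex_of_real (x $ k) * (\<kappa> \<alpha> * refl_quot \<alpha> (cpoly_eval f) x * complex_of_real (\<alpha> \<bullet> axis j 1))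
       + 2 * (\<kappa> \<alpha> * coord \<alpha> j * coord \<alpha> k * cpoly_eval f (reflection \<alpha> x)))"
    by (rule sum.cong[OF refl]) (simp add: refl_quot_mult_var[OF poly_cpoly pos_unit] inner_axis distrib_left distrib_right)
  then show "cpoly_eval (op_apply (dunkl_op m \<kappa> j * mult_var_op k - mult_var_op k * dunkl_op m \<kappa> j) f) x
    = cpoly_eval (op_apply ((if j = k then 1 else 0) + 2 *\<^sub>C refl_weight m \<kappa> j k) f) x"
    by (simp add: op_eval_simps ev refl_weight_def dunkl_dir_def frechet_mult_var[OF poly_cpoly] sum.distrib
      sum_distrib_left[symmetric] distrib_left axis_def)
qed

lemma refl_var:
  assumes "\<alpha> \<bullet> \<alpha> = 1"
  shows "refl_op \<alpha> * mult_var_op k = (mult_var_op k - (2 * coord \<alpha> k) *\<^sub>C (\<Sum>l\<in>UNIV. coord \<alpha> l *\<^sub>C mult_var_op l)) * refl_op \<alpha>"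
proof (rule poly_op_eqI)
  fix f x
  have "complex_of_real (x \<bullet> \<alpha>) = (\<Sum>l\<in>UNIV. coord \<alpha> l * complex_of_real (x $ l))"
    by (simp add: inner_vec_def mult.commute)
  then show "cpoly_eval (op_apply (refl_op \<alpha> * mult_var_op k) f) x =
     cpoly_eval (op_apply ((mult_var_op k - (2 * coord \<alpha> k) *\<^sub>C (\<Sum>l\<in>UNIV. coord \<alpha> l *\<^sub>C mult_var_op l)) * refl_op \<alpha>) f) x"
    by (simp add: op_eval_simps reflection_unit[OF assms] sum_distrib_right[symmetric] algebra_simps)
      (simp add: sum_distrib_right mult_ac)
qed

lemma refl_dunkl:
  assumes m: "m \<ge> 1" and inv: "refl_invariant m \<kappa>" and \<alpha>: "\<alpha> \<in> root_sys m"
  shows "refl_op \<alpha> * dunkl_op m \<kappa> k = (dunkl_op m \<kappa> k - (2 * coord \<alpha> k) *\<^sub>C (\<Sum>l\<in>UNIV. coord \<alpha> l *\<^sub>C dunkl_op m \<kappa> l)) * refl_op \<alpha>"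
proof (rule poly_op_eqI)
  fix f x
  let ?g = "op_apply (refl_op \<alpha>) f"
  interpret F: linear "\<lambda>v. dunkl_dir m \<kappa> v (cpoly_eval ?g) x"
    by (rule linear_dunkl_dir[OF poly_cpoly])
  have g: "cpoly_eval ?g = (\<lambda>x. cpoly_eval f (reflection \<alpha> x))"
    by (simp add: fun_eq_iff eval_refl)
  have "reflection \<alpha> (axis k 1) = axis k 1 - (2 * \<alpha> $ k) *\<^sub>R \<alpha>"
    by (simp add: reflection_unit[OF root_unit[OF \<alpha>]] inner_axis')
  then have "dunkl_dir m \<kappa> (reflection \<alpha> (axis k 1)) (cpoly_eval ?g) x =
    dunkl_dir m \<kappa> (axis k 1) (cpoly_eval ?g) x - 2 * coord \<alpha> k * dunkl_dir m \<kappa> \<alpha> (cpoly_eval ?g) x"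
    by (simp only: F.diff F.scaleR) (simp add: scaleR_conv_of_real)
  moreover have "dunkl_dir m \<kappa> (reflection \<alpha> (axis k 1)) (cpoly_eval ?g) x = dunkl_dir m \<kappa> (axis k 1) (cpoly_eval f) (reflection \<alpha> x)"
    unfolding g by (rule dunkl_dir_reflection[OF m inv \<alpha> poly_cpoly])
  ultimately show "cpoly_eval (op_apply (refl_op \<alpha> * dunkl_op m \<kappa> k) f) x =
     cpoly_eval (op_apply ((dunkl_op m \<kappa> k - (2 * coord \<alpha> k) *\<^sub>C (\<Sum>l\<in>UNIV. coord \<alpha> l *\<^sub>C dunkl_op m \<kappa> l)) * refl_op \<alpha>) f) x"
    by (simp add: op_apply_simps cpoly_eval_simps op_apply_sum eval_dunkl eval_dunkl_sum) (simp add: eval_refl eval_dunkl)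
qed

text \<open>Conjugation by a reflection permutes the reflections, up to the signs of the roots, and
  preserves $\kappa$.\<close>

lemma refl_refl_sum:
  assumes m: "m \<ge> 1" and inv: "refl_invariant m \<kappa>" and \<alpha>: "\<alpha> \<in> root_sys m"
  shows "refl_op \<alpha> * refl_sum m \<kappa> = refl_sum m \<kappa> * refl_op \<alpha>"
proof (rule poly_op_eqI)
  fix f x
  note u = root_unit[OF \<alpha>]
  define F where "F \<gamma> = \<kappa> \<gamma> * cpoly_eval f (reflection \<gamma> (reflection \<alpha> x))" for \<gamma>
  have "(\<Sum>\<gamma>\<in>pos_roots m. F (reflection \<alpha> \<gamma>)) = (\<Sum>\<gamma>\<in>pos_roots m. F \<gamma>)"
    by (rule sum_pos_roots_reflection[OF m \<alpha>]) (simp add: F_def kappa_minus[OF inv] reflection_minus)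
  moreover have "F (reflection \<alpha> \<gamma>) = \<kappa> \<gamma> * cpoly_eval f (reflection \<alpha> (reflection \<gamma> x))" if "\<gamma> \<in> pos_roots m" for \<gamma>
    unfolding F_def reflection_conj[OF u] using kappa_reflection[OF inv \<alpha>] that pos_roots_sub by auto
  ultimately have "(\<Sum>\<gamma>\<in>pos_roots m. \<kappa> \<gamma> * cpoly_eval f (reflection \<alpha> (reflection \<gamma> x))) = (\<Sum>\<gamma>\<in>pos_roots m. F \<gamma>)"
    by simp
  then show "cpoly_eval (op_apply (refl_op \<alpha> * refl_sum m \<kappa>) f) x = cpoly_eval (op_apply (refl_sum m \<kappa> * refl_op \<alpha>) f) x"
    by (simp add: op_apply_simps cpoly_eval_simps op_apply_sum refl_sum_def eval_refl F_def)
qed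

lemma dunkl_exchange:
  assumes m: "m \<ge> 1" and inv: "refl_invariant m \<kappa>"
  shows "dunkl_exchange mult_var_op (dunkl_op m \<kappa>) refl_op (pos_roots m) \<kappa> (refl_sum m \<kappa>) (refl_weight m \<kappa>)"
proof
  show "mult_var_op j * mult_var_op k = mult_var_op k * mult_var_op j" for j k
    by (rule poly_op_eqI) (simp add: op_eval_simps)
next
  show "refl_op \<alpha> * refl_sum m \<kappa> = refl_sum m \<kappa> * refl_op \<alpha>" if "\<alpha> \<in> pos_roots m" for \<alpha>
    using refl_refl_sum[OF m inv] pos_roots_sub that by blast
  show "refl_op \<alpha> * dunkl_op m \<kappa> k =
      (dunkl_op m \<kappa> k - (2 * coord \<alpha> k) *\<^sub>C (\<Sum>l\<in>UNIV. coord \<alpha> l *\<^sub>C dunkl_op m \<kappa> l)) * refl_op \<alpha>"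
    if "\<alpha> \<in> pos_roots m" for \<alpha> k
    using refl_dunkl[OF m inv] pos_roots_sub that by blast
qed (simp_all add: pos_unit dunkl_var refl_var refl_sum_def refl_weight_def)

text \<open>The coordinates generate all polynomials from the constant $1$. The induction is over real
  polynomials, and the final step splits a polynomial into real and imaginary part.\<close>

lemma op_zeroI:
  assumes comm: "\<And>l. B * mult_var_op l = mult_var_op l * B"
    and one: "\<And>f. cpoly_eval f = (\<lambda>_. 1) \<Longrightarrow> op_apply B f = 0"
  shows "B = 0"
proof -
  have B_var: "op_apply B (op_apply (mult_var_op l) f) = op_apply (mult_var_op l) (op_apply B f)" for l f
    unfolding op_apply_simps(6)[symmetric] comm ..
  have B_poly: "(\<forall>x. cpoly_eval g x = complex_of_real (p x) * cpoly_eval f x) \<longrightarrow>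
     (\<forall>x. cpoly_eval (op_apply B g) x = complex_of_real (p x) * cpoly_eval (op_apply B f) x)"
    if "real_polynomial_function p" for p :: "real^3 \<Rightarrow> real" and f g
    using that
  proof (induction p arbitrary: f g)
    case (linear h)
    interpret h: bounded_linear h by fact
    have h: "h x = (\<Sum>l\<in>UNIV. x $ l * h (axis l 1))" for x
      by (subst sum_axis[of x, symmetric]) (simp add: h.sum h.scaleR)
    show ?case
    proof (intro impI allI)
      fix x assume *: "\<forall>x. cpoly_eval g x = complex_of_real (h x) * cpoly_eval f x"
      have eq: "op_apply (\<Sum>l\<in>UNIV. complex_of_real (h (axis l 1)) *\<^sub>C mult_var_op l) f' = g'"
        if "\<And>x. cpoly_eval g' x = complex_of_real (h x) * cpoly_eval f' x" for f' g'
      proof (rule cpoly_eqI)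
        show "cpoly_eval (op_apply (\<Sum>l\<in>UNIV. complex_of_real (h (axis l 1)) *\<^sub>C mult_var_op l) f') x = cpoly_eval g' x" for x
          unfolding that h[of x] by (simp add: op_eval_simps sum_distrib_left sum_distrib_right mult_ac)
      qed
      have "op_apply B g = op_apply (\<Sum>l\<in>UNIV. complex_of_real (h (axis l 1)) *\<^sub>C mult_var_op l) (op_apply B f)"
        unfolding eq[of g f, OF *[rule_format], symmetric]
        by (simp only: sum_3 op_apply_simps op_apply_linear B_var)
      then show "cpoly_eval (op_apply B g) x = complex_of_real (h x) * cpoly_eval (op_apply B f) x"
        unfolding h[of x] by (simp add: op_eval_simps sum_distrib_left sum_distrib_right mult_ac)
    qed
  next
    case (const c)
    show ?case
    proof (intro impI allI)
      fix x assume "\<forall>x. cpoly_eval g x = complex_of_real c * cpoly_eval f x"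
      then have "g = complex_of_real c *\<^sub>C f"
        by (simp flip: cpoly_eval_inject add: fun_eq_iff cpoly_eval_simps)
      then show "cpoly_eval (op_apply B g) x = complex_of_real c * cpoly_eval (op_apply B f) x"
        by (simp add: op_eval_simps)
    qed
  next
    case (add p1 p2)
    define G where "G p = Abs_cpoly (\<lambda>x. complex_of_real (p x) * cpoly_eval f x)" for p :: "real^3 \<Rightarrow> real"
    have G: "cpoly_eval (G p) x = complex_of_real (p x) * cpoly_eval f x" if "real_polynomial_function p" for p x
      unfolding G_def using that by (subst Abs_cpoly_inverse) (auto intro!: polynomial_function_times polynomial_function_of_real poly_cpoly)
    show ?case
    proof (intro impI allI)
      fix x assume "\<forall>x. cpoly_eval g x = complex_of_real (p1 x + p2 x) * cpoly_eval f x"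
      then have "g = G p1 + G p2"
        by (simp flip: cpoly_eval_inject add: fun_eq_iff cpoly_eval_simps G add.hyps distrib_right)
      moreover have "cpoly_eval (op_apply B (G p1)) x = complex_of_real (p1 x) * cpoly_eval (op_apply B f) x"
        "cpoly_eval (op_apply B (G p2)) x = complex_of_real (p2 x) * cpoly_eval (op_apply B f) x"
        using add.IH(1)[of "G p1" f] add.IH(2)[of "G p2" f] G[OF add.hyps(1)] G[OF add.hyps(2)] by blast+
      ultimately show "cpoly_eval (op_apply B g) x = complex_of_real (p1 x + p2 x) * cpoly_eval (op_apply B f) x"
        by (simp add: op_eval_simps distrib_right)
    qed
  next
    case (mult p1 p2)
    define G where "G = Abs_cpoly (\<lambda>x. complex_of_real (p2 x) * cpoly_eval f x)"
    have G: "cpoly_eval G x = complex_of_real (p2 x) * cpoly_eval f x" for x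
      unfolding G_def using mult.hyps by (subst Abs_cpoly_inverse) (auto intro!: polynomial_function_times polynomial_function_of_real poly_cpoly)
    show ?case
    proof (intro impI allI)
      fix x assume "\<forall>x. cpoly_eval g x = complex_of_real (p1 x * p2 x) * cpoly_eval f x"
      then have "\<forall>x. cpoly_eval g x = complex_of_real (p1 x) * cpoly_eval G x"
        by (simp add: G)
      then have "cpoly_eval (op_apply B g) x = complex_of_real (p1 x) * cpoly_eval (op_apply B G) x"
        using mult.IH(1)[of g G] by blast
      moreover have "cpoly_eval (op_apply B G) x = complex_of_real (p2 x) * cpoly_eval (op_apply B f) x"
        using mult.IH(2)[of G f] G by blast
      ultimately show "cpoly_eval (op_apply B g) x = complex_of_real (p1 x * p2 x) * cpoly_eval (op_apply B f) x"
        by simp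
    qed
  qed
  show ?thesis
  proof (rule poly_op_eqI)
    fix f x
    define E where "E = Abs_cpoly (\<lambda>_. 1)"
    have E: "cpoly_eval E = (\<lambda>_. 1)" unfolding E_def by (rule Abs_cpoly_inverse) simp
    define G where "G p = Abs_cpoly (\<lambda>x. complex_of_real (p x))" for p :: "real^3 \<Rightarrow> real"
    have G: "cpoly_eval (G p) x = complex_of_real (p x)" if "real_polynomial_function p" for p x
      unfolding G_def using that by (subst Abs_cpoly_inverse) (auto intro!: polynomial_function_of_real)
    have z: "op_apply B (G p) = 0" if "real_polynomial_function p" for p
      using B_poly[OF that, of "G p" E] one[OF E]
      by (simp flip: cpoly_eval_inject add: fun_eq_iff E G[OF that] cpoly_eval_simps)
    have re: "real_polynomial_function (\<lambda>x. Re (cpoly_eval f x))" "real_polynomial_function (\<lambda>x. Im (cpoly_eval f x))"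
      using poly_cpoly[of f] by (simp_all add: polynomial_function_complex_iff)
    have "f = G (\<lambda>x. Re (cpoly_eval f x)) + \<i> *\<^sub>C G (\<lambda>x. Im (cpoly_eval f x))"
      by (simp flip: cpoly_eval_inject add: fun_eq_iff cpoly_eval_simps G re complex_eq_iff)
    then have "op_apply B f = 0"
      using z[OF re(1)] z[OF re(2)] op_apply_linear(1)[of B "G (\<lambda>x. Re (cpoly_eval f x))" "\<i> *\<^sub>C G (\<lambda>x. Im (cpoly_eval f x))"]
      by (simp add: op_apply_linear(2))
    then show "cpoly_eval (op_apply B f) x = cpoly_eval (op_apply 0 f) x"
      by (simp add: op_apply_simps)
  qed
qed

lemma dunkl_one:
  assumes "cpoly_eval f = (\<lambda>_. 1)"
  shows "op_apply (dunkl_op m \<kappa> j) f = 0"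
proof -
  have "refl_quot \<alpha> (\<lambda>_. 1) = (\<lambda>_. 0)" if "\<alpha> \<in> pos_roots m" for \<alpha>
    using pos_roots_nonzero[OF that] by (intro refl_quot_eqI) auto
  then show ?thesis
    by (simp flip: cpoly_eval_inject add: fun_eq_iff eval_dunkl dunkl_dir_def assms cpoly_eval_simps frechet_derivative_const)
qed

lemma dunkl_commute:
  assumes m: "m \<ge> 1" and inv: "refl_invariant m \<kappa>"
  shows "dunkl_op m \<kappa> j * dunkl_op m \<kappa> k = dunkl_op m \<kappa> k * dunkl_op m \<kappa> j"
proof -
  interpret dunkl_exchange mult_var_op "dunkl_op m \<kappa>" refl_op "pos_roots m" \<kappa> "refl_sum m \<kappa>" "refl_weight m \<kappa>"
    by (rule dunkl_exchange[OF assms])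
  have "dunkl_op m \<kappa> j * dunkl_op m \<kappa> k - dunkl_op m \<kappa> k * dunkl_op m \<kappa> j = 0"
    by (rule op_zeroI[OF D_D_comm_x]) (simp add: op_apply_simps dunkl_one op_apply_zero)
  then show ?thesis by simp
qed

section \<open>The ladder operators of the dihedral system\<close>

definition ang :: "nat \<Rightarrow> (real^3 \<Rightarrow> complex) \<Rightarrow> 3 \<Rightarrow> poly_op" where
  "ang m \<kappa> k = ang_mom m \<kappa> (k + 1) (k + 2)"

lemma pos_roots_axial:
  assumes "\<alpha> \<in> pos_roots m"
  shows "\<alpha> = axis 3 1 \<or> \<alpha> $ 3 = 0"
proof -
  obtain j where "\<alpha> = root_vec m j" using assms by (auto simp: pos_roots_def)
  then show ?thesis by (cases "j = 0") (simp_all add: root_vec_0 root_vec_planar planar_nth)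
qed

text \<open>The reflection along the third axis maps every root to itself or to its negative.\<close>

lemma refl_op_axis_commute:
  assumes "\<alpha> \<in> pos_roots m"
  shows "refl_op (axis 3 1) * refl_op \<alpha> = refl_op \<alpha> * refl_op (axis 3 1)"
proof (rule poly_op_eqI)
  fix f x
  have u: "axis 3 1 \<bullet> (axis 3 1 :: real^3) = 1" by (simp add: inner_axis_axis)
  have "reflection (axis 3 1) \<alpha> = \<alpha> \<or> reflection (axis 3 1) \<alpha> = - \<alpha>"
    using pos_roots_axial[OF assms] by (auto simp: reflection_self[OF u]) (simp add: reflection_unit[OF u] inner_axis)
  then have "reflection (reflection (axis 3 1) \<alpha>) = reflection \<alpha>"
    by (auto simp: reflection_minus fun_eq_iff)
  with reflection_conj[OF u, of \<alpha> x]
  have "reflection \<alpha> (reflection (axis 3 1) x) = reflection (axis 3 1) (reflection \<alpha> x)" by simp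
  then show "cpoly_eval (op_apply (refl_op (axis 3 1) * refl_op \<alpha>) f) x = cpoly_eval (op_apply (refl_op \<alpha> * refl_op (axis 3 1)) f) x"
    by (simp add: op_apply_simps eval_refl)
qed

lemma axial_dunkl:
  assumes m: "m \<ge> 1" and inv: "refl_invariant m \<kappa>" and eps: "\<epsilon> * \<epsilon> = 1"
  shows "axial_angular_algebra \<epsilon> (ang m \<kappa>) (refl_weight m \<kappa>) (refl_sum m \<kappa>) (- refl_sum m \<kappa> - (1/2) *\<^sub>C 1)"
proof -
  interpret dunkl_exchange mult_var_op "dunkl_op m \<kappa>" refl_op "pos_roots m" \<kappa> "refl_sum m \<kappa>" "refl_weight m \<kappa>"
    by (rule dunkl_exchange[OF m inv])
  interpret dunkl_commutation mult_var_op "dunkl_op m \<kappa>" refl_op "pos_roots m" \<kappa> "refl_sum m \<kappa>" "refl_weight m \<kappa>"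
    by standard (rule dunkl_commute[OF m inv])
  have L: "L = ang m \<kappa>"
    by (simp add: fun_eq_iff L_def ang_def ang_mom_def)
  interpret A: angular_algebra \<epsilon> "ang m \<kappa>" "refl_weight m \<kappa>" "refl_sum m \<kappa>" "- refl_sum m \<kappa> - (1/2) *\<^sub>C 1"
    using angular_algebra[OF eps] unfolding L .
  show ?thesis
  proof
    have "refl_weight m \<kappa> j 3 = 0" if "j \<noteq> 3" for j
      unfolding refl_weight_def
    proof (rule sum.neutral, rule ballI)
      fix \<alpha> assume "\<alpha> \<in> pos_roots m"
      then have 0: "coord \<alpha> j * coord \<alpha> 3 = 0"
        using pos_roots_axial[of \<alpha> m] that by (auto simp: axis_def)
      show "(\<kappa> \<alpha> * coord \<alpha> j * coord \<alpha> 3) *\<^sub>C refl_op \<alpha> = 0"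
        unfolding mult.assoc 0 by simp
    qed
    then show "refl_weight m \<kappa> 1 3 = 0" "refl_weight m \<kappa> 2 3 = 0" by simp_all
    \<comment> \<open>Only the root along the third axis contributes to \<open>C 3 3\<close>.\<close>
    have *: "(coord \<alpha> 3 * coord \<alpha> 3) *\<^sub>C (refl_op \<alpha> * T) = (coord \<alpha> 3 * coord \<alpha> 3) *\<^sub>C (T * refl_op \<alpha>)"
      if "\<alpha> \<in> pos_roots m" "refl_op (axis 3 1) * T = T * refl_op (axis 3 1)" for \<alpha> T
      using pos_roots_axial[OF that(1)] that(2) by auto
    show "refl_weight m \<kappa> 3 3 * refl_weight m \<kappa> j k = refl_weight m \<kappa> j k * refl_weight m \<kappa> 3 3" for j k
    proof -
      have "refl_op (axis 3 1) * refl_weight m \<kappa> j k = refl_weight m \<kappa> j k * refl_op (axis 3 1)"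
        unfolding refl_weight_def sum_distrib_left sum_distrib_right
        by (rule sum.cong) (simp_all add: refl_op_axis_commute)
      from *[OF _ this] show ?thesis
        unfolding refl_weight_def[of m \<kappa> 3 3] sum_distrib_left sum_distrib_right mult.assoc mult_scaleC_left mult_scaleC_right
        by (intro sum.cong refl) (simp flip: scaleC_scaleC)
    qed
  qed
qed

lemma tensor_sum_right: "T \<otimes> (\<Sum>i\<in>I. c i *\<^sub>C a i) = (\<Sum>i\<in>I. c i *\<^sub>C (T \<otimes> a i))"
proof (induction I rule: infinite_finite_induct)
  case (insert i I)
  then show ?case
    by (simp flip: cl_coeff_inject add: fun_eq_iff tensor.rep_eq plus_cl3.rep_eq scaleC_cl3.rep_eq scaleC_add_left)
qed (simp_all flip: cl_coeff_inject add: fun_eq_iff tensor.rep_eq zero_cl3.rep_eq)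

lemma (in clifford_sign) coef_sum: "coef (\<Sum>i\<in>I. f i) = (\<Sum>i\<in>I. coef (f i))"
  by (induction I rule: infinite_finite_induct) (simp_all add: coef_linear)

lemma cl_mult_sum_left: "(\<Sum>i\<in>I. f i) \<cdot>\<^bsub>\<epsilon>\<^esub> b = (\<Sum>i\<in>I. f i \<cdot>\<^bsub>\<epsilon>\<^esub> b)"
  by (induction I rule: infinite_finite_induct) (simp_all add: cl_mult_linear)

context
  fixes m :: nat and \<epsilon> :: complex and \<kappa> :: "real^3 \<Rightarrow> complex"
  assumes ax: "axial_angular_algebra \<epsilon> (ang m \<kappa>) (refl_weight m \<kappa>) (refl_sum m \<kappa>) (- refl_sum m \<kappa> - (1/2) *\<^sub>C 1)"
begin

interpretation axial_angular_algebra \<epsilon> "ang m \<kappa>" "refl_weight m \<kappa>" "refl_sum m \<kappa>" "- refl_sum m \<kappa> - (1/2) *\<^sub>C 1"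
  by (rule ax)

lemma sym1_eq: "sym1 m \<epsilon> \<kappa> = O1"
proof
  fix k
  have "(\<Sum>i = 0..m. (\<kappa> (root_vec m i) * complex_of_real (root_vec m i \<bullet> axis k 1)) *\<^sub>C refl_tilde (root_vec m i))
    = (\<Sum>\<alpha>\<in>pos_roots m. (\<kappa> \<alpha> * coord \<alpha> k) *\<^sub>C (\<Sum>j\<in>UNIV. coord \<alpha> j *\<^sub>C (coef (refl_op \<alpha>) \<odot> e j)))"
    by (simp add: sum_pos_roots refl_tilde_def tensor_sum_right inner_axis tensor_gen)
  also have "\<dots> = (\<Sum>j\<in>UNIV. coef (refl_weight m \<kappa> j k) \<odot> e j)"
    unfolding refl_weight_def coef_sum cl_mult_sum_left scaleC_sum_right
    by (subst sum.swap) (simp add: coef_linear cl_mult_linear mult_ac)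
  finally show "sym1 m \<epsilon> \<kappa> k = O1 k"
    by (simp add: sym1_def O1_def sum_3)
qed

lemma sym2_eq: "sym2 m \<epsilon> \<kappa> (k + 1) (k + 2) = O2 k"
proof -
  have "e (k + 1) \<odot> e (k + 2) = \<epsilon> *\<^sub>C (\<omega> \<odot> (e k :: poly_op cl3))"
    using e_cyc(1)[of "k + 1"] exhaust_3[of k] by (auto simp: cyc_3)
  then show ?thesis
    unfolding sym2_def O2_def sym1_eq ang_def[symmetric] coef_def[symmetric] e_def[symmetric]
    by (simp add: eps)
qed

lemma sym2_eqs: "sym2 m \<epsilon> \<kappa> 1 2 = O2 3" "sym2 m \<epsilon> \<kappa> 3 1 = O2 2" "sym2 m \<epsilon> \<kappa> 2 3 = O2 1"
  using sym2_eq[of 1] sym2_eq[of 2] sym2_eq[of 3] by (simp_all add: cyc_3)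

lemma sym3_eq: "sym3 m \<epsilon> \<kappa> = O3"
  unfolding sym3_def O3_def sym1_eq sym2_eqs e_def[symmetric] by simp

end

theorem proposition5:
  fixes m :: nat and \<epsilon> :: complex and \<kappa> :: "real^3 \<Rightarrow> complex"
  assumes "m \<ge> 1" and "\<epsilon> \<in> {- 1, 1}" and "refl_invariant m \<kappa>"
  shows "let O0 = O_zero m \<epsilon> \<kappa>; O123 = sym3 m \<epsilon> \<kappa>; T0 = T_zero m \<epsilon> \<kappa>;
             Tp = T_plus m \<epsilon> \<kappa>; Tm = T_minus m \<epsilon> \<kappa>;
             Lp = L_plus m \<epsilon> \<kappa>; Lm = L_minus m \<epsilon> \<kappa>
    in cl_comm \<epsilon> O0 Lp = Lp \<and>
       cl_comm \<epsilon> O0 Lm = - Lm \<and>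
       Lp \<cdot>\<^bsub>\<epsilon>\<^esub> Lm =
         - ((cl_square \<epsilon> (O0 - (1/2) *\<^sub>C 1) + \<epsilon> *\<^sub>C cl_square \<epsilon> (\<epsilon> *\<^sub>C O123 + T0))
             \<cdot>\<^bsub>\<epsilon>\<^esub> (cl_square \<epsilon> (O0 - (1/2) *\<^sub>C 1) - \<epsilon> *\<^sub>C (Tp \<cdot>\<^bsub>\<epsilon>\<^esub> Tm))) \<and>
       Lm \<cdot>\<^bsub>\<epsilon>\<^esub> Lp =
         - ((cl_square \<epsilon> (O0 + (1/2) *\<^sub>C 1) + \<epsilon> *\<^sub>C cl_square \<epsilon> (\<epsilon> *\<^sub>C O123 - T0))
             \<cdot>\<^bsub>\<epsilon>\<^esub> (cl_square \<epsilon> (O0 + (1/2) *\<^sub>C 1) - \<epsilon> *\<^sub>C (Tm \<cdot>\<^bsub>\<epsilon>\<^esub> Tp)))"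
proof -
  have eps: "\<epsilon> * \<epsilon> = 1" using assms(2) by auto
  note ax = axial_dunkl[OF assms(1,3) eps]
  interpret axial_angular_algebra \<epsilon> "ang m \<kappa>" "refl_weight m \<kappa>" "refl_sum m \<kappa>" "- refl_sum m \<kappa> - (1/2) *\<^sub>C 1"
    by (rule ax)
  note eqs = O_zero_def O_plus_def O_minus_def T_zero_def T_plus_def T_minus_def
    sym1_eq[OF ax] sym2_eqs[OF ax] sym3_eq[OF ax]
  have defs: "O_zero m \<epsilon> \<kappa> = H" "O_plus m \<epsilon> \<kappa> = Op" "O_minus m \<epsilon> \<kappa> = Om" "sym3 m \<epsilon> \<kappa> = O3"
    "T_zero m \<epsilon> \<kappa> = T0" "T_plus m \<epsilon> \<kappa> = Tp" "T_minus m \<epsilon> \<kappa> = Tm"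
    unfolding eqs H_def Op_def Om_def T0_def Tp_def Tm_def by (rule refl)+
  show ?thesis
    unfolding Let_def L_plus_def L_minus_def defs cl_comm_def cl_anticomm_def cl_square_def
    using ladder_up ladder_down by blast
qed

end
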